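(* Let $p$ be an odd prime and let $s \in \mathbb{F}_p$. For $a_i \in \mathbb{Q} \cap \mathbb{Z}_p$, $1 \leq i \leq n$, \begin{equation*} {_{n+1}G_{n+1}} \biggl[ \begin{array}{ccccc} a_1 & a_2 & \dotsc & a_n & \frac{1}{2} \\ 1 & 1 & \dotsc & 1 & 1 \end{array} \Big| \; s \; \biggr]_p = - \sum_{t=2}^{p-1} {_{n}G_{n}} \biggl[ \begin{array}{cccc} a_1 & a_2 & \dotsc & a_n \\ 1 & 1 & \dotsc & 1 \end{array} \Big| \; st \; \biggr]_p \cdot \; \omega^{\frac{p-1}{2}}(1-t), \end{equation*} where $\omega$ is the Teichm\"{u}ller character.
   Context: $\Gamma_p$ denotes Morita's $p$-adic gamma function and $\omega$ the Teichmüller character of $\mathbb{F}_p$ (with $\omega(x)\equiv x \pmod p$), $\bar\omega$ its inverse. For $x\in\mathbb{Q}$, $\lfloor x\rfloor$ is the floor and $\langle x\rangle = x-\lfloor x\rfloor$. For $s\in\mathbb{F}_p$ and $a_i,b_i\in\mathbb{Q}\cap\mathbb{Z}_p$, ${_{n}G_{n}}[a_1,\dots,a_n; b_1,\dots,b_n \mid s]_p := \frac{-1}{p-1}\sum_{j=0}^{p-2}(-1)^{jn}\bar\omega^j(s)\prod_{i=1}^n \frac{\Gamma_p(\langle a_i - \frac{j}{p-1}\rangle)}{\Gamma_p(\langle a_i\rangle)}\frac{\Gamma_p(\langle -b_i + \frac{j}{p-1}\rangle)}{\Gamma_p(\langle -b_i\rangle)}(-p)^{-\lfloor \langle a_i\rangle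 - \frac{j}{p-1}\rfloor - \lfloor \langle -b_i\rangle + \frac{j}{p-1}\rfloor}$. *)

theory Defs
  imports Complex_Main "Berlekamp_Zassenhaus.Finite_Field"
begin

section \<open>The $p$-adic absolute value on the rationals\<close>

definition rat_padic_val :: "nat \<Rightarrow> rat \<Rightarrow> int" where
  "rat_padic_val p q =
     int (multiplicity (int p) (fst (quotient_of q))) -
     int (multiplicity (int p) (snd (quotient_of q)))"

definition rat_padic_abs :: "nat \<Rightarrow> rat \<Rightarrow> real" where
  "rat_padic_abs p q = (if q = 0 then 0 else real p powi (- rat_padic_val p q))"

lemma rat_padic_abs_0 [simp]: "rat_padic_abs p 0 = 0"
  by (simp add: rat_padic_abs_def)

lemma rat_padic_val_divide:
  assumes "prime p" "a \<noteq> 0" "b \<noteq> 0"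
  shows "rat_padic_val p (of_int a / of_int b) =
           int (multiplicity (int p) a) - int (multiplicity (int p) b)"
proof -
  obtain c d where cd: "quotient_of (of_int a / of_int b) = (c, d)"
    by (cases "quotient_of (of_int a / of_int b)")
  have d: "d > 0" using quotient_of_denom_pos[OF cd] .
  have eq: "(of_int a / of_int b :: rat) = of_int c / of_int d"
    using quotient_of_div[OF cd] .
  have "of_int (a * d) = (of_int (c * b) :: rat)"
    using eq assms d by (simp add: field_simps)
  then have ad: "a * d = c * b" by (simp only: of_int_eq_iff)
  have c: "c \<noteq> 0" using ad assms d by auto
  have pr: "prime_elem (int p)" using assms(1) by auto
  have "multiplicity (int p) (a * d) = multiplicity (int p) a + multiplicity (int p) d"
    using assms d pr by (intro prime_elem_multiplicity_mult_distrib) auto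
  moreover have "multiplicity (int p) (c * b) = multiplicity (int p) c + multiplicity (int p) b"
    using assms c pr by (intro prime_elem_multiplicity_mult_distrib) auto
  ultimately show ?thesis
    using ad by (simp add: rat_padic_val_def cd)
qed

lemma rat_quotientE:
  fixes q :: rat
  assumes "q \<noteq> 0"
  obtains a b where "a \<noteq> 0" "b \<noteq> 0" "q = of_int a / of_int b"
proof -
  obtain c d where cd: "quotient_of q = (c, d)" by (cases "quotient_of q")
  have "d > 0" "q = of_int c / of_int d"
    using quotient_of_denom_pos[OF cd] quotient_of_div[OF cd] by auto
  with assms show ?thesis by (intro that[of c d]) auto
qed

lemma rat_padic_val_mult:
  assumes "prime p" "x \<noteq> 0" "y \<noteq> 0"
  shows "rat_padic_val p (x * y) = rat_padic_val p x + rat_padic_val p y"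
proof -
  obtain a b where ab: "a \<noteq> 0" "b \<noteq> 0" "x = of_int a / of_int b"
    using rat_quotientE[OF assms(2)] .
  obtain c d where cd: "c \<noteq> 0" "d \<noteq> 0" "y = of_int c / of_int d"
    using rat_quotientE[OF assms(3)] .
  have xy: "x * y = of_int (a * c) / of_int (b * d)" using ab cd by simp
  have pr: "prime_elem (int p)" using assms(1) by auto
  have "rat_padic_val p (x * y) =
          int (multiplicity (int p) (a * c)) - int (multiplicity (int p) (b * d))"
    unfolding xy using ab cd assms(1) by (intro rat_padic_val_divide) auto
  also have "\<dots> = rat_padic_val p x + rat_padic_val p y"
    unfolding ab(3) cd(3) using ab cd assms(1) pr
    by (simp add: rat_padic_val_divide prime_elem_multiplicity_mult_distrib)
  finally show ?thesis .
qed

lemma rat_padic_abs_mult: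
  assumes "prime p"
  shows "rat_padic_abs p (x * y) = rat_padic_abs p x * rat_padic_abs p y"
proof (cases "x = 0 \<or> y = 0")
  case False
  have "real p \<noteq> 0" using assms by (auto dest: prime_gt_0_nat)
  then have "real p powi (- rat_padic_val p x - rat_padic_val p y) =
             real p powi (- rat_padic_val p x) * real p powi (- rat_padic_val p y)"
    using power_int_add[of "real p" "- rat_padic_val p x" "- rat_padic_val p y"] by simp
  with False show ?thesis
    by (simp add: rat_padic_abs_def rat_padic_val_mult[OF assms])
qed (auto simp: rat_padic_abs_def)

lemma rat_padic_abs_nonneg [simp]: "rat_padic_abs p x \<ge> 0"
  by (simp add: rat_padic_abs_def)

lemma rat_padic_abs_eq_0_iff: "prime p \<Longrightarrow> rat_padic_abs p x = 0 \<longleftrightarrow> x = 0"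
  by (auto simp: rat_padic_abs_def dest: prime_gt_0_nat)

lemma rat_padic_abs_1 [simp]: "prime p \<Longrightarrow> rat_padic_abs p 1 = 1"
  using rat_padic_abs_mult[of p 1 1] rat_padic_abs_eq_0_iff[of p 1] by simp

lemma rat_padic_abs_minus: "prime p \<Longrightarrow> rat_padic_abs p (- x) = rat_padic_abs p x"
proof -
  assume p: "prime p"
  have "(rat_padic_abs p (-1))\<^sup>2 = 1"
    using rat_padic_abs_mult[OF p, of "-1" "-1"] p by (simp add: power2_eq_square)
  then have "rat_padic_abs p (-1) = 1"
    using rat_padic_abs_nonneg[of p "-1"] by (simp add: power2_eq_1_iff)
  then show ?thesis using rat_padic_abs_mult[OF p, of "-1" x] by simp
qed

lemma rat_padic_abs_minus_commute:
  "prime p \<Longrightarrow> rat_padic_abs p (x - y) = rat_padic_abs p (y - x)"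
  using rat_padic_abs_minus[of p "x - y"] by simp

lemma rat_padic_abs_ultrametric:
  assumes p: "prime p"
  shows "rat_padic_abs p (x + y) \<le> max (rat_padic_abs p x) (rat_padic_abs p y)"
proof (cases "x = 0 \<or> y = 0 \<or> x + y = 0")
  case True
  then show ?thesis by (auto simp: le_max_iff_disj)
next
  case False
  obtain a b where ab: "a \<noteq> 0" "b \<noteq> 0" "x = of_int a / of_int b"
    using rat_quotientE[of x] False by metis
  obtain c d where cd: "c \<noteq> 0" "d \<noteq> 0" "y = of_int c / of_int d"
    using rat_quotientE[of y] False by metis
  have sum: "x + y = of_int (a * d + c * b) / of_int (b * d)"
    using ab cd by (simp add: field_simps)
  have nz: "a * d + c * b \<noteq> 0" using sum False by (metis div_0 of_int_0)
  have x: "x = of_int (a * d) / of_int (b * d)" and y: "y = of_int (c * b) / of_int (b * d)"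
    using ab cd by simp_all
  define m where "m = min (multiplicity (int p) (a * d)) (multiplicity (int p) (c * b))"
  have "int p ^ m dvd a * d" "int p ^ m dvd c * b"
    unfolding m_def by (intro multiplicity_dvd'; simp)+
  then have dv: "int p ^ m dvd a * d + c * b" by (rule dvd_add)
  have nu: "\<not> is_unit (int p)" using p by auto
  have "m \<le> multiplicity (int p) (a * d + c * b)"
    using dv nz nu by (intro multiplicity_geI) auto
  then have "min (rat_padic_val p x) (rat_padic_val p y) \<le> rat_padic_val p (x + y)"
    unfolding sum using ab cd nz p
    unfolding x y m_def
    by (subst (1 2 3) rat_padic_val_divide) auto
  then have "- rat_padic_val p (x + y) \<le> - rat_padic_val p x \<or>
             - rat_padic_val p (x + y) \<le> - rat_padic_val p y" by linarith
  moreover have "real p \<ge> 1" using p prime_ge_1_nat by auto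
  ultimately show ?thesis
    using False by (auto simp: rat_padic_abs_def le_max_iff_disj intro: power_int_increasing)
qed

lemma rat_padic_abs_triangle:
  assumes p: "prime p"
  shows "rat_padic_abs p (x + y) \<le> rat_padic_abs p x + rat_padic_abs p y"
  using rat_padic_abs_ultrametric[OF p, of x y] rat_padic_abs_nonneg[of p x]
    rat_padic_abs_nonneg[of p y] by linarith

lemma rat_padic_abs_diff_le:
  assumes p: "prime p"
  shows "\<bar>rat_padic_abs p x - rat_padic_abs p y\<bar> \<le> rat_padic_abs p (x - y)"
  using rat_padic_abs_triangle[OF p, of "x - y" y] rat_padic_abs_triangle[OF p, of "y - x" x]
    rat_padic_abs_minus_commute[OF p, of x y] by simp

lemma rat_padic_abs_inverse:
  assumes p: "prime p"
  shows "rat_padic_abs p (inverse x) = inverse (rat_padic_abs p x)"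
proof (cases "x = 0")
  case False
  then have "rat_padic_abs p x * rat_padic_abs p (inverse x) = 1"
    using rat_padic_abs_mult[OF p, of x "inverse x"] p by simp
  then show ?thesis by (metis inverse_unique)
qed auto

section \<open>Cauchy sequences\<close>

definition padic_Cauchy :: "nat \<Rightarrow> (nat \<Rightarrow> rat) \<Rightarrow> bool" where
  "padic_Cauchy p X \<longleftrightarrow>
     (\<forall>e>0. \<exists>M. \<forall>m\<ge>M. \<forall>n\<ge>M. rat_padic_abs p (X m - X n) < e)"

definition padic_null :: "nat \<Rightarrow> (nat \<Rightarrow> rat) \<Rightarrow> bool" where
  "padic_null p X \<longleftrightarrow> (\<lambda>n. rat_padic_abs p (X n)) \<longlonglongrightarrow> 0"

lemma padic_Cauchy_const [simp]: "padic_Cauchy p (\<lambda>_. c)"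
  by (auto simp: padic_Cauchy_def)

lemma padic_Cauchy_add:
  assumes p: "prime p" and "padic_Cauchy p X" "padic_Cauchy p Y"
  shows "padic_Cauchy p (\<lambda>n. X n + Y n)"
  unfolding padic_Cauchy_def
proof (intro allI impI)
  fix e :: real assume e: "e > 0"
  obtain M where M: "\<And>m n. m \<ge> M \<Longrightarrow> n \<ge> M \<Longrightarrow> rat_padic_abs p (X m - X n) < e"
    using assms(2) e unfolding padic_Cauchy_def by meson
  obtain N where N: "\<And>m n. m \<ge> N \<Longrightarrow> n \<ge> N \<Longrightarrow> rat_padic_abs p (Y m - Y n) < e"
    using assms(3) e unfolding padic_Cauchy_def by meson
  show "\<exists>M. \<forall>m\<ge>M. \<forall>n\<ge>M. rat_padic_abs p (X m + Y m - (X n + Y n)) < e"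
  proof (intro exI[of _ "max M N"] allI impI)
    fix m n assume mn: "max M N \<le> m" "max M N \<le> n"
    have "rat_padic_abs p ((X m - X n) + (Y m - Y n)) < e"
      using rat_padic_abs_ultrametric[OF p, of "X m - X n" "Y m - Y n"] M[of m n] N[of m n] mn
      by simp
    then show "rat_padic_abs p (X m + Y m - (X n + Y n)) < e" by (simp add: algebra_simps)
  qed
qed

lemma padic_Cauchy_minus:
  assumes p: "prime p" and "padic_Cauchy p X"
  shows "padic_Cauchy p (\<lambda>n. - X n)"
proof -
  have "rat_padic_abs p (- X m - - X n) = rat_padic_abs p (X m - X n)" for m n
    using rat_padic_abs_minus_commute[OF p, of "X m" "X n"] by (simp add: algebra_simps)
  then show ?thesis using assms(2) by (simp only: padic_Cauchy_def)
qed

lemma padic_Cauchy_abs_convergent: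
  assumes p: "prime p" and X: "padic_Cauchy p X"
  shows "convergent (\<lambda>n. rat_padic_abs p (X n))"
proof -
  have "Cauchy (\<lambda>n. rat_padic_abs p (X n))"
    unfolding Cauchy_def dist_real_def
    using X rat_padic_abs_diff_le[OF p] unfolding padic_Cauchy_def by (meson le_less_trans)
  then show ?thesis by (rule Cauchy_convergent)
qed

lemma padic_Cauchy_bounded:
  assumes p: "prime p" and X: "padic_Cauchy p X"
  obtains B where "B > 0" "\<And>n. rat_padic_abs p (X n) \<le> B"
proof -
  have "Bseq (\<lambda>n. rat_padic_abs p (X n))"
    using padic_Cauchy_abs_convergent[OF assms] by (rule convergent_imp_Bseq)
  then show ?thesis by (elim BseqE) (auto intro: that)
qed

lemma padic_Cauchy_mult:
  assumes p: "prime p" and X: "padic_Cauchy p X" and Y: "padic_Cauchy p Y"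
  shows "padic_Cauchy p (\<lambda>n. X n * Y n)"
  unfolding padic_Cauchy_def
proof (intro allI impI)
  fix e :: real assume e: "e > 0"
  obtain B where B: "B > 0" "\<And>n. rat_padic_abs p (X n) \<le> B"
    using padic_Cauchy_bounded[OF p X] by blast
  obtain C where C: "C > 0" "\<And>n. rat_padic_abs p (Y n) \<le> C"
    using padic_Cauchy_bounded[OF p Y] by blast
  obtain M where M: "\<And>m n. m \<ge> M \<Longrightarrow> n \<ge> M \<Longrightarrow> rat_padic_abs p (X m - X n) < e / C"
    using X e C(1) unfolding padic_Cauchy_def by (meson divide_pos_pos)
  obtain N where N: "\<And>m n. m \<ge> N \<Longrightarrow> n \<ge> N \<Longrightarrow> rat_padic_abs p (Y m - Y n) < e / B"
    using Y e B(1) unfolding padic_Cauchy_def by (meson divide_pos_pos)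
  show "\<exists>M. \<forall>m\<ge>M. \<forall>n\<ge>M. rat_padic_abs p (X m * Y m - X n * Y n) < e"
  proof (intro exI[of _ "max M N"] allI impI)
    fix m n assume mn: "max M N \<le> m" "max M N \<le> n"
    have eq: "X m * Y m - X n * Y n = (X m - X n) * Y m + X n * (Y m - Y n)"
      by (simp add: algebra_simps)
    have "rat_padic_abs p (X m - X n) * rat_padic_abs p (Y m)
            \<le> rat_padic_abs p (X m - X n) * C"
      using C(2) by (intro mult_left_mono) auto
    also have "\<dots> < e" using M[of m n] mn C(1) by (simp add: field_simps)
    finally have 1: "rat_padic_abs p ((X m - X n) * Y m) < e"
      by (simp add: rat_padic_abs_mult[OF p])
    have "rat_padic_abs p (X n) * rat_padic_abs p (Y m - Y n)
            \<le> B * rat_padic_abs p (Y m - Y n)"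
      using B(2) by (intro mult_right_mono) auto
    also have "\<dots> < e" using N[of m n] mn B(1) by (simp add: field_simps)
    finally have 2: "rat_padic_abs p (X n * (Y m - Y n)) < e"
      by (simp add: rat_padic_abs_mult[OF p])
    show "rat_padic_abs p (X m * Y m - X n * Y n) < e"
      unfolding eq using 1 2 rat_padic_abs_ultrametric[OF p, of "(X m - X n) * Y m" "X n * (Y m - Y n)"]
      by simp
  qed
qed

lemma padic_Cauchy_not_null:
  assumes p: "prime p" and X: "padic_Cauchy p X" and nn: "\<not> padic_null p X"
  obtains b where "b > 0" "\<forall>\<^sub>F n in sequentially. b < rat_padic_abs p (X n)"
proof -
  obtain L where L: "(\<lambda>n. rat_padic_abs p (X n)) \<longlonglongrightarrow> L"
    using padic_Cauchy_abs_convergent[OF p X] by (auto simp: convergent_def)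
  have "L \<noteq> 0" using L nn by (auto simp: padic_null_def)
  moreover have "L \<ge> 0" using L by (rule LIMSEQ_le_const) auto
  ultimately have "L > 0" by simp
  then have "\<forall>\<^sub>F n in sequentially. L / 2 < rat_padic_abs p (X n)"
    using L by (intro order_tendstoD(1)) auto
  with \<open>L > 0\<close> show ?thesis by (intro that[of "L / 2"]) auto
qed

lemma padic_Cauchy_inverse:
  assumes p: "prime p" and X: "padic_Cauchy p X" and nn: "\<not> padic_null p X"
  shows "padic_Cauchy p (\<lambda>n. inverse (X n))"
  unfolding padic_Cauchy_def
proof (intro allI impI)
  fix e :: real assume e: "e > 0"
  obtain b where b: "b > 0" and "\<forall>\<^sub>F n in sequentially. b < rat_padic_abs p (X n)"
    using padic_Cauchy_not_null[OF assms] by blast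
  then obtain N where N: "\<And>n. n \<ge> N \<Longrightarrow> b < rat_padic_abs p (X n)"
    by (auto simp: eventually_sequentially)
  obtain M where M: "\<And>m n. m \<ge> M \<Longrightarrow> n \<ge> M \<Longrightarrow> rat_padic_abs p (X m - X n) < e * (b * b)"
    using X e b unfolding padic_Cauchy_def by (meson mult_pos_pos)
  show "\<exists>M. \<forall>m\<ge>M. \<forall>n\<ge>M. rat_padic_abs p (inverse (X m) - inverse (X n)) < e"
  proof (intro exI[of _ "max M N"] allI impI)
    fix m n assume mn: "max M N \<le> m" "max M N \<le> n"
    have bm: "b < rat_padic_abs p (X m)" and bn: "b < rat_padic_abs p (X n)"
      using N mn by auto
    have nz: "X m \<noteq> 0" "X n \<noteq> 0" using bm bn b by auto
    have "inverse (X m) - inverse (X n) = (X n - X m) * inverse (X m * X n)"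
      using nz by (simp add: field_simps)
    then have eq: "rat_padic_abs p (inverse (X m) - inverse (X n)) =
        rat_padic_abs p (X n - X m) / (rat_padic_abs p (X m) * rat_padic_abs p (X n))"
      by (simp add: rat_padic_abs_mult[OF p] rat_padic_abs_inverse[OF p] divide_inverse)
    have bb: "b * b < rat_padic_abs p (X m) * rat_padic_abs p (X n)"
      using bm bn b by (intro mult_strict_mono) auto
    have "rat_padic_abs p (X n - X m) < e * (b * b)" using M[of n m] mn by simp
    also have "\<dots> \<le> e * (rat_padic_abs p (X m) * rat_padic_abs p (X n))"
      using bb e by (intro mult_left_mono) auto
    finally show "rat_padic_abs p (inverse (X m) - inverse (X n)) < e"
      unfolding eq using bb b by (subst pos_divide_less_eq) (auto intro: less_trans[OF mult_pos_pos])
  qed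
qed

lemma padic_null_add:
  assumes p: "prime p" and "padic_null p X" "padic_null p Y"
  shows "padic_null p (\<lambda>n. X n + Y n)"
  unfolding padic_null_def
proof (rule tendsto_sandwich[where f = "\<lambda>_. 0"])
  show "(\<lambda>n. rat_padic_abs p (X n) + rat_padic_abs p (Y n)) \<longlonglongrightarrow> 0"
    using tendsto_add[OF assms(2,3)[unfolded padic_null_def]] by simp
qed (auto simp: rat_padic_abs_triangle[OF p])

lemma padic_null_minus:
  "prime p \<Longrightarrow> padic_null p X \<Longrightarrow> padic_null p (\<lambda>n. - X n)"
  by (simp add: padic_null_def rat_padic_abs_minus)

lemma padic_null_mult:
  assumes p: "prime p" and X: "padic_null p X" and Y: "padic_Cauchy p Y"
  shows "padic_null p (\<lambda>n. X n * Y n)"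
proof -
  obtain L where L: "(\<lambda>n. rat_padic_abs p (Y n)) \<longlonglongrightarrow> L"
    using padic_Cauchy_abs_convergent[OF p Y] by (auto simp: convergent_def)
  show ?thesis
    using tendsto_mult[OF X[unfolded padic_null_def] L]
    by (simp add: padic_null_def rat_padic_abs_mult[OF p])
qed

section \<open>The field of $p$-adic numbers\<close>

text \<open>
  The prime is carried by the type parameter: it is the cardinality of \<open>'p\<close>. The field
  \<open>'p padic\<close> is the completion of the rationals, i.e. Cauchy sequences modulo null sequences.
\<close>

typedef (overloaded) ('p :: prime_card) padic_seq = "{X. padic_Cauchy CARD('p) X}"
  by (rule exI[of _ "\<lambda>_. 0"]) simp

setup_lifting type_definition_padic_seq

lift_definition padic_rel :: "'p :: prime_card padic_seq \<Rightarrow> 'p padic_seq \<Rightarrow> bool" is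
  "\<lambda>X Y. padic_null CARD('p) (\<lambda>n. X n - Y n)" .

lemma equivp_padic_rel: "equivp (padic_rel :: 'p :: prime_card padic_seq \<Rightarrow> _)"
proof (rule equivpI)
  show "reflp (padic_rel :: 'p padic_seq \<Rightarrow> _)"
    by (rule reflpI, transfer) (simp add: padic_null_def)
  show "symp (padic_rel :: 'p padic_seq \<Rightarrow> _)"
    by (rule sympI, transfer) (drule padic_null_minus[OF prime_card], simp)
  show "transp (padic_rel :: 'p padic_seq \<Rightarrow> _)"
    by (rule transpI, transfer) (drule (1) padic_null_add[OF prime_card], simp)
qed

quotient_type (overloaded) 'p padic = "'p :: prime_card padic_seq" / padic_rel
  by (rule equivp_padic_rel)

lift_definition pseq_const :: "rat \<Rightarrow> 'p :: prime_card padic_seq" is "\<lambda>q _. q"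
  by simp

lift_definition pseq_add :: "'p :: prime_card padic_seq \<Rightarrow> 'p padic_seq \<Rightarrow> 'p padic_seq" is
  "\<lambda>X Y n. X n + Y n"
  by (rule padic_Cauchy_add[OF prime_card])

lift_definition pseq_minus :: "'p :: prime_card padic_seq \<Rightarrow> 'p padic_seq" is
  "\<lambda>X n. - X n"
  by (rule padic_Cauchy_minus[OF prime_card])

lift_definition pseq_mult :: "'p :: prime_card padic_seq \<Rightarrow> 'p padic_seq \<Rightarrow> 'p padic_seq" is
  "\<lambda>X Y n. X n * Y n"
  by (rule padic_Cauchy_mult[OF prime_card])

lift_definition pseq_inverse :: "'p :: prime_card padic_seq \<Rightarrow> 'p padic_seq" is
  "\<lambda>X. if padic_null CARD('p) X then (\<lambda>_. 0) else (\<lambda>n. inverse (X n))"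
  by (simp add: padic_Cauchy_inverse[OF prime_card])

lift_definition pseq_abs :: "'p :: prime_card padic_seq \<Rightarrow> real" is
  "\<lambda>X. lim (\<lambda>n. rat_padic_abs CARD('p) (X n))" .

lemma padic_rel_add:
  "padic_rel X X' \<Longrightarrow> padic_rel Y Y' \<Longrightarrow> padic_rel (pseq_add X Y) (pseq_add X' Y')"
proof (transfer, goal_cases)
  case (1 X X' Y Y')
  from padic_null_add[OF prime_card 1(3,6)] show ?case by (simp add: algebra_simps)
qed

lemma padic_rel_minus: "padic_rel X X' \<Longrightarrow> padic_rel (pseq_minus X) (pseq_minus X')"
proof (transfer, goal_cases)
  case (1 X X')
  from padic_null_minus[OF prime_card 1(3)] show ?case by (simp add: algebra_simps)
qed

lemma padic_rel_mult:
  "padic_rel X X' \<Longrightarrow> padic_rel Y Y' \<Longrightarrow> padic_rel (pseq_mult X Y) (pseq_mult X' Y')"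
proof (transfer, goal_cases)
  case (1 X X' Y Y')
  from padic_null_add[OF prime_card padic_null_mult[OF prime_card 1(3,4)]
      padic_null_mult[OF prime_card 1(6,2)]]
  show ?case by (simp add: algebra_simps)
qed

lemma padic_null_cong:
  assumes "prime p" "padic_null p (\<lambda>n. X n - Y n)"
  shows "padic_null p X \<longleftrightarrow> padic_null p Y"
  using padic_null_add[OF assms, of Y]
    padic_null_add[OF assms(1) padic_null_minus[OF assms], of X] by auto

lemma padic_rel_inverse: "padic_rel X Y \<Longrightarrow> padic_rel (pseq_inverse X) (pseq_inverse Y)"
proof (transfer, goal_cases)
  case (1 X Y)
  let ?p = "CARD('a)"
  have p: "prime ?p" by (rule prime_card)
  have XY: "padic_null ?p X \<longleftrightarrow> padic_null ?p Y" by (rule padic_null_cong[OF p 1(3)])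
  show ?case
  proof (cases "padic_null ?p X")
    case True
    then show ?thesis using XY by (simp add: padic_null_def)
  next
    case nX: False
    then have nY: "\<not> padic_null ?p Y" using XY by simp
    have X: "padic_Cauchy ?p X" and Y: "padic_Cauchy ?p Y" using 1 by auto
    have "padic_null ?p (\<lambda>n. (X n - Y n) * (inverse (X n) * inverse (Y n)))"
      by (intro padic_null_mult[OF p 1(3)] padic_Cauchy_mult[OF p] padic_Cauchy_inverse p X Y nX nY)
    then have null: "padic_null ?p (\<lambda>n. - ((X n - Y n) * (inverse (X n) * inverse (Y n))))"
      by (rule padic_null_minus[OF p])
    obtain b where b: "b > 0" "\<forall>\<^sub>F n in sequentially. b < rat_padic_abs ?p (X n)"
      using padic_Cauchy_not_null[OF p X nX] by blast
    obtain c where c: "c > 0" "\<forall>\<^sub>F n in sequentially. c < rat_padic_abs ?p (Y n)"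
      using padic_Cauchy_not_null[OF p Y nY] by blast
    have "\<forall>\<^sub>F n in sequentially.
        rat_padic_abs ?p (- ((X n - Y n) * (inverse (X n) * inverse (Y n)))) =
        rat_padic_abs ?p (inverse (X n) - inverse (Y n))"
      using b(2) c(2)
    proof eventually_elim
      case (elim n)
      then have "X n \<noteq> 0" "Y n \<noteq> 0" using b(1) c(1) by auto
      then have "- ((X n - Y n) * (inverse (X n) * inverse (Y n))) = inverse (X n) - inverse (Y n)"
        by (simp add: field_simps)
      then show ?case by simp
    qed
    from tendsto_cong[OF this] null have "padic_null ?p (\<lambda>n. inverse (X n) - inverse (Y n))"
      by (simp only: padic_null_def)
    then show ?thesis using nX nY by simp
  qed
qed

lemma padic_rel_abs: "padic_rel X Y \<Longrightarrow> pseq_abs X = pseq_abs Y"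
proof (transfer, goal_cases)
  case (1 X Y)
  let ?p = "CARD('a)"
  have p: "prime ?p" by (rule prime_card)
  obtain L where L: "(\<lambda>n. rat_padic_abs ?p (X n)) \<longlonglongrightarrow> L"
    using padic_Cauchy_abs_convergent[OF p] 1(1) by (auto simp: convergent_def)
  have "(\<lambda>n. rat_padic_abs ?p (X n) - rat_padic_abs ?p (Y n)) \<longlonglongrightarrow> 0"
  proof (rule tendsto_rabs_zero_cancel, rule tendsto_sandwich[where f = "\<lambda>_. 0"])
    show "(\<lambda>n. rat_padic_abs ?p (X n - Y n)) \<longlonglongrightarrow> 0"
      using 1(3) by (simp add: padic_null_def)
  qed (auto simp: rat_padic_abs_diff_le[OF p])
  from tendsto_diff[OF L this] have "(\<lambda>n. rat_padic_abs ?p (Y n)) \<longlonglongrightarrow> L" by simp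
  then show ?case using L by (simp add: limI)
qed

instantiation padic :: (prime_card) field
begin

lift_definition zero_padic :: "'a padic" is "pseq_const 0" .
lift_definition one_padic :: "'a padic" is "pseq_const 1" .
lift_definition plus_padic :: "'a padic \<Rightarrow> 'a padic \<Rightarrow> 'a padic" is pseq_add
  by (rule padic_rel_add)
lift_definition uminus_padic :: "'a padic \<Rightarrow> 'a padic" is pseq_minus
  by (rule padic_rel_minus)
lift_definition times_padic :: "'a padic \<Rightarrow> 'a padic \<Rightarrow> 'a padic" is pseq_mult
  by (rule padic_rel_mult)
lift_definition inverse_padic :: "'a padic \<Rightarrow> 'a padic" is pseq_inverse
  by (rule padic_rel_inverse)

definition minus_padic :: "'a padic \<Rightarrow> 'a padic \<Rightarrow> 'a padic" where
  "minus_padic x y = x + (- y)"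

definition divide_padic :: "'a padic \<Rightarrow> 'a padic \<Rightarrow> 'a padic" where
  "divide_padic x y = x * inverse y"

instance
proof
  fix x y z :: "'a padic"
  show "x + y + z = x + (y + z)"
    by (transfer, transfer) (simp add: padic_null_def algebra_simps)
  show "x + y = y + x"
    by (transfer, transfer) (simp add: padic_null_def algebra_simps)
  show "0 + x = x"
    by (transfer, transfer) (simp add: padic_null_def)
  show "- x + x = 0"
    by (transfer, transfer) (simp add: padic_null_def)
  show "x - y = x + - y"
    by (simp add: minus_padic_def)
  show "x * y * z = x * (y * z)"
    by (transfer, transfer) (simp add: padic_null_def algebra_simps)
  show "x * y = y * x"
    by (transfer, transfer) (simp add: padic_null_def algebra_simps)
  show "1 * x = x"
    by (transfer, transfer) (simp add: padic_null_def)
  show "(x + y) * z = x * z + y * z"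
    by (transfer, transfer) (simp add: padic_null_def algebra_simps)
  show "(0 :: 'a padic) \<noteq> 1"
    by (transfer, transfer)
      (simp add: padic_null_def rat_padic_abs_minus[OF prime_card] prime_card LIMSEQ_const_iff)
  show "inverse (0 :: 'a padic) = 0"
    by (transfer, transfer) (simp add: padic_null_def)
  show "x div y = x * inverse y"
    by (simp add: divide_padic_def)
  show "x \<noteq> 0 \<Longrightarrow> inverse x * x = 1"
  proof (transfer, transfer, goal_cases)
    case (1 X)
    then have X: "padic_Cauchy CARD('a) X" and nX: "\<not> padic_null CARD('a) X" by simp_all
    obtain b where b: "b > 0" "\<forall>\<^sub>F n in sequentially. b < rat_padic_abs CARD('a) (X n)"
      using padic_Cauchy_not_null[OF prime_card X nX] by blast
    have "\<forall>\<^sub>F n in sequentially. rat_padic_abs CARD('a) (inverse (X n) * X n - 1) = 0"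
      using b(2)
    proof eventually_elim
      case (elim n)
      then have "X n \<noteq> 0" using b(1) by auto
      then show ?case by simp
    qed
    then have "padic_null CARD('a) (\<lambda>n. inverse (X n) * X n - 1)"
      unfolding padic_null_def by (rule tendsto_eventually)
    with nX show ?case by simp
  qed
qed

end

lift_definition padic_abs :: "'p :: prime_card padic \<Rightarrow> real" is pseq_abs
  by (rule padic_rel_abs)

lemma padic_seq_lim:
  assumes "padic_Cauchy CARD('p :: prime_card) X"
  shows "(\<lambda>n. rat_padic_abs CARD('p) (X n)) \<longlonglongrightarrow> lim (\<lambda>n. rat_padic_abs CARD('p) (X n))"
  using padic_Cauchy_abs_convergent[OF prime_card assms] by (simp add: convergent_LIMSEQ_iff)

lemma padic_abs_eq_0_iff [simp]: "padic_abs x = 0 \<longleftrightarrow> x = 0"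
proof (transfer, transfer, goal_cases)
  case (1 X)
  then have lim: "(\<lambda>n. rat_padic_abs CARD('a) (X n)) \<longlonglongrightarrow>
      lim (\<lambda>n. rat_padic_abs CARD('a) (X n))"
    by (intro padic_seq_lim) simp
  have "padic_null CARD('a) X \<longleftrightarrow> lim (\<lambda>n. rat_padic_abs CARD('a) (X n)) = 0"
    unfolding padic_null_def using lim limI by metis
  then show ?case by simp
qed

lemma padic_abs_0 [simp]: "padic_abs 0 = 0"
  by simp

lemma padic_abs_minus [simp]: "padic_abs (- x) = padic_abs x"
  by (transfer, transfer) (simp add: rat_padic_abs_minus[OF prime_card])

lemma padic_abs_mult: "padic_abs (x * y) = padic_abs x * padic_abs y"
proof (transfer, transfer, goal_cases)
  case (1 X Y)
  then have X: "padic_Cauchy CARD('a) X" and Y: "padic_Cauchy CARD('a) Y" by simp_all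
  from limI[OF tendsto_mult[OF padic_seq_lim[OF X] padic_seq_lim[OF Y]]]
  show ?case by (simp only: rat_padic_abs_mult[OF prime_card])
qed

lemma padic_abs_ultrametric: "padic_abs (x + y) \<le> max (padic_abs x) (padic_abs y)"
proof (transfer, transfer, goal_cases)
  case (1 X Y)
  then have X: "padic_Cauchy CARD('a) X" and Y: "padic_Cauchy CARD('a) Y" by simp_all
  show ?case
    by (rule LIMSEQ_le[OF padic_seq_lim[OF padic_Cauchy_add[OF prime_card X Y]]
          tendsto_max[OF padic_seq_lim[OF X] padic_seq_lim[OF Y]]])
      (auto intro!: rat_padic_abs_ultrametric[OF prime_card])
qed

lemma padic_abs_nonneg [simp]: "padic_abs x \<ge> 0"
proof -
  have "padic_abs (x + - x) \<le> max (padic_abs x) (padic_abs (- x))"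
    by (rule padic_abs_ultrametric)
  then show ?thesis by simp
qed

lemma padic_of_nat_abs_eq: "of_nat n = abs_padic (pseq_const (of_nat n) :: 'p :: prime_card padic_seq)"
proof (induction n)
  case 0
  then show ?case by (simp add: zero_padic_def)
next
  case (Suc n)
  have "pseq_add (pseq_const 1) (pseq_const (of_nat n)) =
        (pseq_const (of_nat (Suc n)) :: 'p padic_seq)"
    by transfer simp
  with Suc show ?case
    by (simp add: one_padic_def plus_padic.abs_eq)
qed

instance padic :: (prime_card) field_char_0
proof
  show "inj (of_nat :: nat \<Rightarrow> 'a padic)"
  proof (rule injI)
    fix m n :: nat
    assume "of_nat m = (of_nat n :: 'a padic)"
    then have "padic_rel (pseq_const (of_nat m)) (pseq_const (of_nat n) :: 'a padic_seq)"
      by (simp add: padic_of_nat_abs_eq padic.abs_eq_iff)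
    then have "padic_null CARD('a) (\<lambda>_. of_nat m - of_nat n :: rat)"
      by transfer
    then show "m = n"
      by (simp add: padic_null_def LIMSEQ_const_iff rat_padic_abs_eq_0_iff[OF prime_card])
  qed
qed

instantiation padic :: (prime_card) metric_space
begin

definition dist_padic :: "'a padic \<Rightarrow> 'a padic \<Rightarrow> real" where
  "dist_padic x y = padic_abs (x - y)"

definition uniformity_padic :: "('a padic \<times> 'a padic) filter" where
  "uniformity_padic = (INF e\<in>{0 <..}. principal {(x, y). dist x y < e})"

definition open_padic :: "'a padic set \<Rightarrow> bool" where
  "open_padic U \<longleftrightarrow> (\<forall>x\<in>U. eventually (\<lambda>(x', y). x' = x \<longrightarrow> y \<in> U) uniformity)"

instance
proof
  fix x y z :: "'a padic"
  show "dist x y = 0 \<longleftrightarrow> x = y" by (simp add: dist_padic_def)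
  have "padic_abs (x - y) = padic_abs ((x - z) + - (y - z))" by simp
  also have "\<dots> \<le> max (padic_abs (x - z)) (padic_abs (- (y - z)))"
    by (rule padic_abs_ultrametric)
  also have "\<dots> \<le> padic_abs (x - z) + padic_abs (y - z)"
    unfolding padic_abs_minus by simp
  finally show "dist x y \<le> dist x z + dist y z" by (simp add: dist_padic_def)
qed (rule uniformity_padic_def open_padic_def)+

end

definition padic_ints :: "'p :: prime_card padic set" where
  "padic_ints = {x. padic_abs x \<le> 1}"


section \<open>Morita's gamma function\<close>

definition morita_nat :: "nat \<Rightarrow> 'p :: prime_card padic" where
  "morita_nat n = (-1) ^ n * (\<Prod>j | 0 < j \<and> j < n \<and> \<not> CARD('p) dvd j. of_nat j)"

text \<open>
  At a $p$-adic integer \<open>x\<close> the value is the limit of \<open>morita_nat n\<close> as \<open>n\<close> runs through the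
  positive integers approaching \<open>x\<close>. This is intended for odd primes; outside the $p$-adic
  integers the value is unspecified.
\<close>

definition morita_Gamma :: "'p :: prime_card padic \<Rightarrow> 'p padic" where
  "morita_Gamma x =
     (if x = 0 then 1
      else Lim (inf (filtercomap of_nat (nhds x)) (principal {0<..})) morita_nat)"


section \<open>The Teichmueller character\<close>

text \<open>Characters of the multiplicative group, extended by zero (the trivial one included).\<close>

definition mult_character :: "('p :: prime_card mod_ring \<Rightarrow> 'p padic) \<Rightarrow> bool" where
  "mult_character \<chi> \<longleftrightarrow>
     \<chi> 0 = 0 \<and> \<chi> 1 = 1 \<and> (\<forall>x y. \<chi> (x * y) = \<chi> x * \<chi> y)"

definition teichmuller :: "'p :: prime_card mod_ring \<Rightarrow> 'p padic" where
  "teichmuller = (THE \<chi>. mult_character \<chi> \<and>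
     (\<forall>x. \<exists>z\<in>padic_ints. \<chi> x - of_int (to_int_mod_ring x) = of_nat CARD('p) * z))"

definition char_pow ::
    "('p :: prime_card mod_ring \<Rightarrow> 'p padic) \<Rightarrow> nat \<Rightarrow> 'p mod_ring \<Rightarrow> 'p padic" where
  "char_pow \<chi> k x = (if x = 0 then 0 else \<chi> x ^ k)"

definition char_inv ::
    "('p :: prime_card mod_ring \<Rightarrow> 'p padic) \<Rightarrow> 'p mod_ring \<Rightarrow> 'p padic" where
  "char_inv \<chi> x = inverse (\<chi> x)"


section \<open>The $p$-adic hypergeometric function\<close>

text \<open>The parameters are indexed from 1 to \<open>n\<close>; other values of \<open>a\<close> and \<open>b\<close> are ignored.\<close>

definition padic_G ::
    "nat \<Rightarrow> (nat \<Rightarrow> rat) \<Rightarrow> (nat \<Rightarrow> rat) \<Rightarrow> 'p :: prime_card mod_ring \<Rightarrow> 'p padic" where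
  "padic_G n a b s =
     (- 1) / of_nat (CARD('p) - 1) *
     (\<Sum>j = 0..CARD('p) - 2.
        (- 1) ^ (j * n) * char_pow (char_inv teichmuller) j s *
        (\<Prod>i = 1..n.
           let r = of_nat j / of_nat (CARD('p) - 1) :: rat;
               \<Gamma> = \<lambda>x. morita_Gamma (of_rat x :: 'p padic)
           in \<Gamma> (frac (a i - r)) / \<Gamma> (frac (a i)) *
              (\<Gamma> (frac (- b i + r)) / \<Gamma> (frac (- b i))) *
              (- of_nat CARD('p)) powi (- \<lfloor>frac (a i) - r\<rfloor> - \<lfloor>frac (- b i) + r\<rfloor>)))"

end

theory Submission
  imports Defs
    "HOL-Number_Theory.Modular_Inverse"
    "HOL-Computational_Algebra.Polynomial_FPS"
    "HOL-Real_Asymp.Real_Asymp"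
begin

text \<open>
  Comparing the summands with index \<open>j\<close>, the claim says that the Jacobi sum \<open>J\<close> of the \<open>j\<close>-th power of
  the inverse Teichmueller character and the quadratic character is, up to sign, the gamma factor
  belonging to \<open>a = 1/2\<close>, \<open>b = 1\<close>: the Gross-Koblitz formula for this Jacobi sum. It is proved by
  Dwork's method in an elementary form. Let \<open>\<alpha> f = \<psi> (x ^ (-j) * (1 - x) ^ (-1/2) / (1 - x ^ p) ^ (-1/2) * f)\<close>,
  where \<open>\<psi>\<close> keeps the coefficients with index divisible by \<open>p\<close>, act on power series in \<open>1 / (1 - x)\<close>.
  On the one hand \<open>(p - 1) tr \<alpha> = J\<close>, by partial fractions. On the other hand \<open>\<alpha>\<close> commutes up to a factor
  \<open>p\<close> with a first-order differential operator whose cokernel is a line, so \<open>(1 - p) tr \<alpha>\<close> is the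
  eigenvalue of \<open>\<alpha>\<close> on that line. Replacing \<open>-1/2\<close> and \<open>j / (p - 1)\<close> by nearby integers, this eigenvalue
  becomes a quotient of two binomial coefficients, whose limit is a quotient of gamma values.
\<close>

section \<open>The topological field of p-adic numbers\<close>

text \<open>The operator occurs only through its matrix: \<open>frob_mat\<close> expands
  \<open>x ^ c * (1 - x ^ p) ^ (k - 1/2)\<close> in the powers \<open>(1 - x) ^ (l - 1/2)\<close>,
  with \<open>c = p - 1 - j\<close>. Polynomials have no half-integral exponents, so
  \<open>-1/2\<close> is replaced by a natural number \<open>M\<close>; an entry is then a
  coefficient of an integer polynomial and depends polynomially on \<open>M\<close>. Identities
  between entries are checked there and carried to \<open>-1/2\<close> by continuity. The shift
  \<open>m = (p - 1) / 2\<close> is forced by \<open>m + p * (-1/2) = -1/2\<close>, which gives rows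
  and columns the same exponents. With \<open>r = j / (p - 1)\<close> the eigenvector is formally
  \<open>x ^ (r - 1)\<close>, since \<open>x ^ c * (x ^ p) ^ (r - 1) = x ^ (r - 1)\<close>. The two
  binomial coefficients are its coefficients at \<open>(1 - x) ^ (-1/2)\<close> after and before the
  operator; formally they agree, but the quotient of their integral approximations tends to the
  eigenvalue. The obstacle is the exchange of limits in \<open>M\<close> with infinite sums. Entries
  on and below the diagonal of row \<open>k\<close> are divisible by \<open>p ^ k\<close>, while the
  denominators of the other factors cost at most a polynomial in \<open>k\<close>.\<close>

lemma padic_abs_1 [simp]: "padic_abs (1 :: 'p :: prime_card padic) = 1"
proof -
  have "padic_abs (1 :: 'p padic) * padic_abs (1 :: 'p padic) = padic_abs (1 :: 'p padic)"
    using padic_abs_mult[of "1 :: 'p padic" 1] by simp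
  moreover have "padic_abs (1 :: 'p padic) \<noteq> 0" by simp
  ultimately show ?thesis by (metis mult_cancel_right1)
qed

lemma padic_abs_power: "padic_abs (x ^ n) = padic_abs x ^ n"
  by (induction n) (simp_all add: padic_abs_mult)

lemma padic_abs_inverse: "padic_abs (inverse x) = inverse (padic_abs x)"
proof (cases "x = 0")
  case False
  then have "padic_abs x * padic_abs (inverse x) = 1"
    using padic_abs_mult[of x "inverse x"] by simp
  then show ?thesis by (metis inverse_unique)
qed auto

lemma padic_abs_divide: "padic_abs (x / y) = padic_abs x / padic_abs y"
  by (simp add: divide_inverse padic_abs_mult padic_abs_inverse)

lemma padic_abs_prod: "padic_abs (\<Prod>i\<in>A. f i) = (\<Prod>i\<in>A. padic_abs (f i))"
  by (induction A rule: infinite_finite_induct) (simp_all add: padic_abs_mult)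

lemma padic_abs_add_le: "padic_abs x \<le> b \<Longrightarrow> padic_abs y \<le> b \<Longrightarrow> padic_abs (x + y) \<le> b"
  using padic_abs_ultrametric[of x y] by linarith

lemma padic_abs_diff_le: "padic_abs x \<le> b \<Longrightarrow> padic_abs y \<le> b \<Longrightarrow> padic_abs (x - y) \<le> b"
  using padic_abs_add_le[of x b "- y"] by simp

lemma padic_abs_triangle: "padic_abs (x + y) \<le> padic_abs x + padic_abs y"
  using padic_abs_ultrametric[of x y] padic_abs_nonneg[of x] padic_abs_nonneg[of y] by linarith

lemma padic_abs_diff_commute: "padic_abs (x - y) = padic_abs (y - x)"
  using padic_abs_minus[of "x - y"] by (simp del: padic_abs_minus)

lemma padic_abs_sum_le:
  assumes "\<And>i. i \<in> A \<Longrightarrow> padic_abs (f i) \<le> b" "b \<ge> 0"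
  shows "padic_abs (\<Sum>i\<in>A. f i) \<le> b"
  using assms by (induction A rule: infinite_finite_induct) (auto intro: padic_abs_add_le)

lemma padic_abs_mult_le:
  "padic_abs x \<le> a \<Longrightarrow> padic_abs y \<le> b \<Longrightarrow> padic_abs (x * y) \<le> a * b"
  unfolding padic_abs_mult by (intro mult_mono) (auto intro: order.trans[OF padic_abs_nonneg])

section \<open>Values on rational numbers and integers\<close>

text \<open>\<open>of_rat\<close> comes from the generic field structure and constant sequences from
  the completion. Constant sequences form a ring homomorphism, hence agree with
  \<open>of_rat\<close> on integers and then on quotients.\<close>

lemma of_rat_padic: "(of_rat q :: 'p :: prime_card padic) = abs_padic (pseq_const q)"
proof -
  let ?h = "\<lambda>q. abs_padic (pseq_const q) :: 'p padic"
  have mult: "?h (x * y) = ?h x * ?h y" for x y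
  proof -
    have "pseq_mult (pseq_const x) (pseq_const y) = (pseq_const (x * y) :: 'p padic_seq)"
      by transfer simp
    then show ?thesis by (simp add: times_padic.abs_eq)
  qed
  have minus: "?h (- x) = - ?h x" for x
  proof -
    have "pseq_minus (pseq_const x) = (pseq_const (- x) :: 'p padic_seq)"
      by transfer simp
    then show ?thesis by (simp add: uminus_padic.abs_eq)
  qed
  have nat: "?h (of_nat n) = of_nat n" for n
    by (simp add: padic_of_nat_abs_eq)
  have int: "?h (of_int n) = of_int n" for n
    by (cases n rule: int_cases2) (simp_all add: nat minus)
  obtain a b where ab: "quotient_of q = (a, b)" by (cases "quotient_of q")
  have b: "b > 0" and q: "q = of_int a / of_int b"
    using quotient_of_denom_pos[OF ab] quotient_of_div[OF ab] by auto
  have "?h q * of_int b = ?h (q * of_int b)" by (simp only: mult int)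
  also have "q * of_int b = of_int a" using b q by simp
  finally have "?h q * of_int b = of_int a" by (simp only: int)
  moreover have "(of_rat q :: 'p padic) * of_int b = of_int a"
    using b unfolding q by (simp add: of_rat_divide)
  ultimately have "?h q * of_int b = of_rat q * of_int b" by simp
  then show ?thesis using b by simp
qed

lemma padic_abs_of_rat: "padic_abs (of_rat q :: 'p :: prime_card padic) = rat_padic_abs CARD('p) q"
proof -
  have "pseq_abs (pseq_const q :: 'p padic_seq) = rat_padic_abs CARD('p) q"
    by transfer simp
  then show ?thesis by (simp add: of_rat_padic padic_abs.abs_eq)
qed

lemma padic_abs_of_int:
  assumes "n \<noteq> 0"
  shows "padic_abs (of_int n :: 'p :: prime_card padic) =
           1 / real CARD('p) ^ multiplicity (int CARD('p)) n"
proof -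
  have "padic_abs (of_int n :: 'p padic) = rat_padic_abs CARD('p) (of_int n / of_int 1)"
    using padic_abs_of_rat[of "of_int n", where 'p = 'p] by simp
  also have "\<dots> = 1 / real CARD('p) ^ multiplicity (int CARD('p)) n"
    using assms rat_padic_val_divide[OF prime_card[where 'a = 'p], of n 1]
    by (simp add: rat_padic_abs_def power_int_minus divide_inverse)
  finally show ?thesis .
qed

lemma card_gt_1 [simp]: "1 < real CARD('p :: prime_card)"
  using prime_gt_1_nat[OF prime_card[where 'a = 'p]] by simp

lemma card_pos [simp]: "0 < real CARD('p :: prime_card)"
  using card_gt_1[where 'p = 'p] by linarith

text \<open>The dictionary between congruences modulo \<open>p ^ k\<close> and estimates; nearly all
  later arithmetic is phrased on the analytic side.\<close>

lemma padic_abs_of_int_le_power_iff: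
  "padic_abs (of_int n :: 'p :: prime_card padic) \<le> 1 / real CARD('p) ^ k \<longleftrightarrow> int CARD('p) ^ k dvd n"
proof (cases "n = 0")
  case False
  have pr: "prime (int CARD('p))" by (rule prime_card_int)
  have "\<not> is_unit (int CARD('p))" using pr not_prime_unit by blast
  then have "int CARD('p) ^ k dvd n \<longleftrightarrow> k \<le> multiplicity (int CARD('p)) n"
    using False by (subst power_dvd_iff_le_multiplicity) auto
  also have "\<dots> \<longleftrightarrow> real CARD('p) ^ k \<le> real CARD('p) ^ multiplicity (int CARD('p)) n"
    using card_gt_1[where 'p = 'p] by (simp only: power_increasing_iff)
  finally show ?thesis using False
    by (simp add: padic_abs_of_int divide_simps)
qed auto

lemma padic_abs_of_int_le_1 [simp]: "padic_abs (of_int n) \<le> 1"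
  using padic_abs_of_int_le_power_iff[of n 0] by simp

lemma padic_abs_of_nat_le_1 [simp]: "padic_abs (of_nat n) \<le> 1"
  using padic_abs_of_int_le_1[of "int n"] by (simp del: padic_abs_of_int_le_1)

lemma padic_abs_of_nat_diff_le_iff:
  "padic_abs (of_nat a - of_nat b :: 'p :: prime_card padic) \<le> 1 / real CARD('p) ^ k \<longleftrightarrow>
     [int a = int b] (mod int CARD('p) ^ k)"
  using padic_abs_of_int_le_power_iff[of "int a - int b" k, where 'p = 'p]
  by (simp add: cong_iff_dvd_diff)

lemma padic_abs_card: "padic_abs (of_nat CARD('p) :: 'p :: prime_card padic) = 1 / real CARD('p)"
proof -
  have "prime (int CARD('p))" by (rule prime_card_int)
  then show ?thesis
    using padic_abs_of_int[of "int CARD('p)", where 'p = 'p] by simp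
qed

lemma padic_abs_of_nat_unit:
  assumes "\<not> CARD('p) dvd n"
  shows "padic_abs (of_nat n :: 'p :: prime_card padic) = 1"
proof -
  have "n \<noteq> 0" using assms by (auto intro: Nat.gr0I)
  moreover have "multiplicity (int CARD('p)) (int n) = 0"
    using assms by (intro not_dvd_imp_multiplicity_0) simp
  ultimately show ?thesis using padic_abs_of_int[of "int n", where 'p = 'p] by simp
qed

text \<open>The \<open>p\<close>-part of \<open>n\<close> is at most \<open>n\<close>. A denominator
  therefore costs only a linear factor, which is harmless against geometric decay.\<close>

lemma padic_abs_inverse_of_nat_le:
  assumes "n > 0"
  shows "padic_abs (inverse (of_nat n) :: 'p :: prime_card padic) \<le> real n"
proof -
  let ?e = "multiplicity (int CARD('p)) (int n)"
  have "int CARD('p) ^ ?e dvd int n" by (rule multiplicity_dvd)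
  then have "int (CARD('p) ^ ?e) dvd int n" by simp
  then have "CARD('p) ^ ?e \<le> n" using assms by (intro dvd_imp_le) (simp only: int_dvd_int_iff, simp)
  then have "real CARD('p) ^ ?e \<le> real n" by (metis of_nat_le_iff of_nat_power)
  then show ?thesis
    using assms padic_abs_of_int[of "int n", where 'p = 'p] by (simp add: padic_abs_inverse)
qed

section \<open>Continuity of the field operations and completeness\<close>

lemma padic_tendsto_iff: "(f \<longlongrightarrow> (l :: 'p :: prime_card padic)) F \<longleftrightarrow> ((\<lambda>x. padic_abs (f x - l)) \<longlongrightarrow> 0) F"
  using tendsto_dist_iff[of f l F] by (simp add: dist_padic_def)

lemma tendsto_padic_abs:
  assumes "(f \<longlongrightarrow> (l :: 'p :: prime_card padic)) F"
  shows "((\<lambda>x. padic_abs (f x)) \<longlongrightarrow> padic_abs l) F"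
  using tendsto_dist[OF assms tendsto_const[of 0]] by (simp add: dist_padic_def)

lemma tendsto_fst_nhds: "(fst \<longlongrightarrow> a) (nhds a \<times>\<^sub>F nhds b)"
  using tendsto_fst[OF filterlim_ident[of "nhds (a, b)"]] by (simp add: nhds_prod)

lemma tendsto_snd_nhds: "(snd \<longlongrightarrow> b) (nhds a \<times>\<^sub>F nhds b)"
  using tendsto_snd[OF filterlim_ident[of "nhds (a, b)"]] by (simp add: nhds_prod)

instance padic :: (prime_card) topological_ab_group_add
proof
  fix a b :: "'a padic"
  show "((\<lambda>x. fst x + snd x) \<longlongrightarrow> a + b) (nhds a \<times>\<^sub>F nhds b)"
    unfolding padic_tendsto_iff
  proof (rule tendsto_sandwich[where f = "\<lambda>_. 0"])
    let ?F = "nhds a \<times>\<^sub>F nhds b"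
    have "((\<lambda>x. padic_abs (fst x - a) + padic_abs (snd x - b)) \<longlongrightarrow> 0 + 0) ?F"
      by (intro tendsto_add)
        (simp_all add: padic_tendsto_iff[symmetric] tendsto_fst_nhds tendsto_snd_nhds)
    then show "((\<lambda>x. padic_abs (fst x - a) + padic_abs (snd x - b)) \<longlongrightarrow> 0) ?F" by simp
    have "padic_abs (x + y - (a + b)) \<le> padic_abs (x - a) + padic_abs (y - b)" for x y
      using padic_abs_triangle[of "x - a" "y - b"] by (simp add: algebra_simps)
    then show "\<forall>\<^sub>F x in ?F. padic_abs (fst x + snd x - (a + b)) \<le>
        padic_abs (fst x - a) + padic_abs (snd x - b)" by simp
  qed auto
  have "padic_abs (- x - - a) = padic_abs (x - a)" for x
    using padic_abs_minus[of "x - a"] by (simp del: padic_abs_minus)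
  moreover have "((\<lambda>x. x) \<longlongrightarrow> a) (nhds a)" by (rule filterlim_ident)
  ultimately show "(uminus \<longlongrightarrow> - a) (nhds a)"
    by (simp add: padic_tendsto_iff)
qed

instance padic :: (prime_card) topological_comm_monoid_mult
proof
  fix a b :: "'a padic"
  let ?F = "nhds a \<times>\<^sub>F nhds b"
  have a: "((\<lambda>x. padic_abs (fst x - a)) \<longlongrightarrow> 0) ?F" and b: "((\<lambda>x. padic_abs (snd x - b)) \<longlongrightarrow> 0) ?F"
    by (simp_all add: padic_tendsto_iff[symmetric] tendsto_fst_nhds tendsto_snd_nhds)
  show "((\<lambda>x. fst x * snd x) \<longlongrightarrow> a * b) ?F"
    unfolding padic_tendsto_iff
  proof (rule tendsto_sandwich[where f = "\<lambda>_. 0"])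
    let ?g = "\<lambda>x. padic_abs (fst x - a) * padic_abs (snd x - b) +
        (padic_abs a * padic_abs (snd x - b) + padic_abs (fst x - a) * padic_abs b)"
    have "(?g \<longlongrightarrow> 0 * 0 + (padic_abs a * 0 + 0 * padic_abs b)) ?F"
      by (intro tendsto_intros a b)
    then show "(?g \<longlongrightarrow> 0) ?F" by simp
    have "padic_abs (x * y - a * b) \<le> padic_abs (x - a) * padic_abs (y - b) +
        (padic_abs a * padic_abs (y - b) + padic_abs (x - a) * padic_abs b)" for x y
    proof -
      have "x * y - a * b = (x - a) * (y - b) + (a * (y - b) + (x - a) * b)"
        by (simp add: algebra_simps)
      then show ?thesis
        using padic_abs_triangle[of "(x - a) * (y - b)" "a * (y - b) + (x - a) * b"]
          padic_abs_triangle[of "a * (y - b)" "(x - a) * b"]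
        by (simp add: padic_abs_mult)
    qed
    then show "\<forall>\<^sub>F x in ?F. padic_abs (fst x * snd x - a * b) \<le> ?g x" by simp
  qed auto
qed

lemma tendsto_inverse_padic:
  assumes f: "(f \<longlongrightarrow> (l :: 'p :: prime_card padic)) F" and l: "l \<noteq> 0"
  shows "((\<lambda>x. inverse (f x)) \<longlongrightarrow> inverse l) F"
proof -
  have pos: "padic_abs l > 0" using l by (simp add: less_le)
  have "((\<lambda>x. padic_abs (f x - l) / (padic_abs (f x) * padic_abs l)) \<longlongrightarrow>
      0 / (padic_abs l * padic_abs l)) F"
    using l f by (intro tendsto_intros tendsto_padic_abs f) (simp_all add: padic_tendsto_iff)
  moreover have "\<forall>\<^sub>F x in F. padic_abs (f x) \<noteq> 0"
    using tendsto_padic_abs[OF f] pos by (intro tendsto_imp_eventually_ne) auto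
  then have "\<forall>\<^sub>F x in F. padic_abs (f x - l) / (padic_abs (f x) * padic_abs l) =
      padic_abs (inverse (f x) - inverse l)"
  proof eventually_elim
    case (elim x)
    then have "inverse (f x) - inverse l = - ((f x - l) / (f x * l))"
      using l by (simp add: field_simps)
    then show ?case by (simp add: padic_abs_divide padic_abs_mult)
  qed
  ultimately show ?thesis
    unfolding padic_tendsto_iff by (simp cong: filterlim_cong)
qed

lemma tendsto_divide_padic:
  assumes "(f \<longlongrightarrow> (l :: 'p :: prime_card padic)) F" "(g \<longlongrightarrow> k) F" "k \<noteq> 0"
  shows "((\<lambda>x. f x / g x) \<longlongrightarrow> l / k) F"
  unfolding divide_inverse by (intro tendsto_mult assms tendsto_inverse_padic)

lemma tendsto_card_power: "(\<lambda>n. of_nat CARD('p) ^ n :: 'p :: prime_card padic) \<longlonglongrightarrow> 0"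
proof -
  have "(\<lambda>n. (1 / real CARD('p)) ^ n) \<longlonglongrightarrow> 0"
    using card_gt_1[where 'p = 'p] by (intro LIMSEQ_power_zero) (simp add: divide_simps)
  then show ?thesis by (simp add: padic_tendsto_iff padic_abs_power padic_abs_card)
qed

lemma rat_dense_padic:
  assumes "e > 0"
  obtains q where "padic_abs (x - of_rat q :: 'p :: prime_card padic) < e"
proof -
  obtain X where x: "x = abs_padic X" by (metis Quotient3_abs_rep Quotient3_padic)
  let ?X = "Rep_padic_seq X"
  have C: "padic_Cauchy CARD('p) ?X" using Rep_padic_seq[of X] by simp
  then obtain M where M: "\<And>m n. m \<ge> M \<Longrightarrow> n \<ge> M \<Longrightarrow> rat_padic_abs CARD('p) (?X m - ?X n) < e / 2"
    using assms unfolding padic_Cauchy_def by (meson half_gt_zero)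
  let ?q = "?X M"
  have "x - of_rat ?q = abs_padic (pseq_add X (pseq_minus (pseq_const ?q)))"
    by (simp add: x of_rat_padic minus_padic_def plus_padic.abs_eq uminus_padic.abs_eq)
  then have "padic_abs (x - of_rat ?q) = lim (\<lambda>n. rat_padic_abs CARD('p) (?X n + - ?q))"
    by (simp add: padic_abs.abs_eq pseq_abs.rep_eq pseq_add.rep_eq pseq_minus.rep_eq
        pseq_const.rep_eq)
  also have "\<dots> \<le> e / 2"
  proof (rule Lim_bounded)
    show "(\<lambda>n. rat_padic_abs CARD('p) (?X n + - ?q)) \<longlonglongrightarrow>
        lim (\<lambda>n. rat_padic_abs CARD('p) (?X n + - ?q))"
      by (intro padic_seq_lim padic_Cauchy_add prime_card C) simp
    show "\<forall>n\<ge>M. rat_padic_abs CARD('p) (?X n + - ?q) \<le> e / 2"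
      using M[of _ M] by (auto intro: less_imp_le)
  qed
  finally have "padic_abs (x - of_rat ?q) < e" using assms by simp
  then show ?thesis by (rule that)
qed

text \<open>Diagonal argument: the \<open>n\<close>-th term is replaced by a rational number within
  \<open>1 / 2 ^ n\<close>. These rationals form a Cauchy sequence, which is itself a representative
  of the limit.\<close>

instance padic :: (prime_card) complete_space
proof
  fix X :: "nat \<Rightarrow> 'a padic"
  assume X: "Cauchy X"
  have "\<exists>q. padic_abs (X n - of_rat q) < 1 / 2 ^ n" for n
    using rat_dense_padic[of "1 / 2 ^ n" "X n"] by (metis zero_less_divide_1_iff zero_less_power zero_less_numeral)
  then obtain q where q: "\<And>n. padic_abs (X n - of_rat (q n)) < 1 / 2 ^ n" by metis
  have half: "(\<lambda>n. 1 / 2 ^ n :: real) \<longlonglongrightarrow> 0"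
    using LIMSEQ_power_zero[of "1 / 2 :: real"] by (simp add: power_divide)
  have small: "\<exists>M. \<forall>n\<ge>M. 1 / 2 ^ n < e" if "e > 0" for e :: real
    using order_tendstoD(2)[OF half that] by (simp add: eventually_sequentially)
  have C: "padic_Cauchy CARD('a) q"
    unfolding padic_Cauchy_def
  proof (intro allI impI)
    fix e :: real assume e: "e > 0"
    obtain M1 where M1: "\<And>m n. m \<ge> M1 \<Longrightarrow> n \<ge> M1 \<Longrightarrow> dist (X m) (X n) < e"
      using metric_CauchyD[OF X e] by blast
    obtain M2 where M2: "\<And>n. n \<ge> M2 \<Longrightarrow> 1 / 2 ^ n < e" using small[OF e] by blast
    show "\<exists>M. \<forall>m\<ge>M. \<forall>n\<ge>M. rat_padic_abs CARD('a) (q m - q n) < e"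
    proof (intro exI[of _ "max M1 M2"] allI impI)
      fix m n assume mn: "max M1 M2 \<le> m" "max M1 M2 \<le> n"
      have "padic_abs (X m - X n) < e" using M1[of m n] mn by (simp add: dist_padic_def)
      moreover have "padic_abs (X m - of_rat (q m)) < e" "padic_abs (X n - of_rat (q n)) < e"
        using q[of m] q[of n] M2[of m] M2[of n] mn by auto
      moreover have "of_rat (q m - q n) =
          (X m - X n) + (- (X m - of_rat (q m)) + (X n - of_rat (q n)))"
        by (simp add: of_rat_diff)
      ultimately have "padic_abs (of_rat (q m - q n) :: 'a padic) < e"
        using padic_abs_ultrametric[of "X m - X n" "- (X m - of_rat (q m)) + (X n - of_rat (q n))"]
          padic_abs_ultrametric[of "- (X m - of_rat (q m))" "X n - of_rat (q n)"]
        unfolding padic_abs_minus by simp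
      then show "rat_padic_abs CARD('a) (q m - q n) < e" by (simp add: padic_abs_of_rat)
    qed
  qed
  define Y :: "'a padic_seq" where "Y = Abs_padic_seq q"
  have Y: "Rep_padic_seq Y = q"
    using C by (simp add: Y_def Abs_padic_seq_inverse)
  define L where "L = abs_padic Y"
  have "(\<lambda>n. of_rat (q n) :: 'a padic) \<longlonglongrightarrow> L"
    unfolding padic_tendsto_iff
  proof (rule LIMSEQ_I)
    fix e :: real assume e: "e > 0"
    obtain M where M: "\<And>m n. m \<ge> M \<Longrightarrow> n \<ge> M \<Longrightarrow> rat_padic_abs CARD('a) (q m - q n) < e / 2"
      using C e unfolding padic_Cauchy_def by (meson half_gt_zero)
    show "\<exists>N. \<forall>n\<ge>N. norm (padic_abs (of_rat (q n) - L) - 0) < e"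
    proof (intro exI[of _ M] allI impI)
      fix n assume n: "n \<ge> M"
      have "of_rat (q n) - L = abs_padic (pseq_add (pseq_const (q n)) (pseq_minus Y))"
        by (simp add: L_def of_rat_padic minus_padic_def plus_padic.abs_eq uminus_padic.abs_eq)
      then have "padic_abs (of_rat (q n) - L) = lim (\<lambda>k. rat_padic_abs CARD('a) (q n + - q k))"
        by (simp add: padic_abs.abs_eq pseq_abs.rep_eq pseq_add.rep_eq pseq_minus.rep_eq
            pseq_const.rep_eq Y)
      also have "\<dots> \<le> e / 2"
      proof (rule Lim_bounded)
        show "(\<lambda>k. rat_padic_abs CARD('a) (q n + - q k)) \<longlonglongrightarrow>
            lim (\<lambda>k. rat_padic_abs CARD('a) (q n + - q k))"
          by (intro padic_seq_lim padic_Cauchy_add padic_Cauchy_minus prime_card C) simp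
        show "\<forall>k\<ge>M. rat_padic_abs CARD('a) (q n + - q k) \<le> e / 2"
          using M[OF n] by (auto intro: less_imp_le)
      qed
      finally show "norm (padic_abs (of_rat (q n) - L) - 0) < e" using e by simp
    qed
  qed
  moreover have "(\<lambda>n. X n - of_rat (q n)) \<longlonglongrightarrow> 0"
    unfolding padic_tendsto_iff
    by (rule tendsto_sandwich[OF _ _ tendsto_const half]) (simp_all add: less_imp_le[OF q])
  ultimately have "(\<lambda>n. of_rat (q n) + (X n - of_rat (q n))) \<longlonglongrightarrow> L + 0"
    by (rule tendsto_add)
  then have "X \<longlonglongrightarrow> L" by simp
  then show "convergent X" by (auto simp: convergent_def)
qed

section \<open>The Teichmueller character\<close>

lemma inverse_card_power_tendsto_0: "(\<lambda>n. 1 / real CARD('p :: prime_card) ^ n) \<longlonglongrightarrow> 0"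
  using LIMSEQ_power_zero[of "1 / real CARD('p)"] card_gt_1[where 'p = 'p]
  by (simp add: power_divide)

text \<open>By the ultrametric inequality a sum of later steps is no larger than the bound on the
  first of them.\<close>

lemma padic_convergent_if_Suc_close:
  fixes f :: "nat \<Rightarrow> 'p :: prime_card padic"
  assumes "\<And>n. padic_abs (f (Suc n) - f n) \<le> 1 / real CARD('p) ^ n"
  shows "convergent f"
proof (rule Cauchy_convergent)
  have le: "padic_abs (f (n + k) - f n) \<le> 1 / real CARD('p) ^ n" for n k
  proof (induction k)
    case (Suc k)
    have "padic_abs (f (Suc (n + k)) - f (n + k)) \<le> 1 / real CARD('p) ^ (n + k)"
      by (rule assms)
    also have "\<dots> \<le> 1 / real CARD('p) ^ n"
      using card_gt_1[where 'p = 'p] by (intro divide_left_mono power_increasing) auto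
    finally show ?case
      using padic_abs_add_le[OF _ Suc, of "f (Suc (n + k)) - f (n + k)"] by simp
  qed simp
  show "Cauchy f"
  proof (rule CauchyI')
    fix e :: real assume "e > 0"
    then obtain M where M: "\<And>n. n \<ge> M \<Longrightarrow> 1 / real CARD('p) ^ n < e"
      using order_tendstoD(2)[OF inverse_card_power_tendsto_0[where 'p = 'p]]
      by (auto simp: eventually_sequentially)
    show "\<exists>M. \<forall>m\<ge>M. \<forall>n>m. dist (f m) (f n) < e"
    proof (intro exI[of _ M] allI impI)
      fix m n assume "M \<le> m" "m < n"
      then have "padic_abs (f n - f m) < e"
        using le[of m "n - m"] M[of m] by simp
      then show "dist (f m) (f n) < e" by (simp add: dist_padic_def padic_abs_diff_commute)
    qed
  qed
qed

lemma padic_abs_power_diff_le: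
  assumes "padic_abs x \<le> 1" "padic_abs y \<le> 1"
  shows "padic_abs (x ^ n - y ^ n) \<le> padic_abs (x - y)"
proof (induction n)
  case (Suc n)
  have "x ^ Suc n - y ^ Suc n = x * (x ^ n - y ^ n) + (x - y) * y ^ n"
    by (simp add: algebra_simps)
  moreover have "padic_abs (x * (x ^ n - y ^ n)) \<le> 1 * padic_abs (x - y)"
    using assms Suc by (intro padic_abs_mult_le)
  moreover have "padic_abs ((x - y) * y ^ n) \<le> padic_abs (x - y) * 1"
    using assms by (intro padic_abs_mult_le) (simp_all add: padic_abs_power power_le_one)
  ultimately show ?case by (simp add: padic_abs_add_le)
qed simp

text \<open>In \<open>x ^ p - y ^ p = (x - y) * S\<close> the factor \<open>S\<close> is congruent
  to \<open>p * y ^ (p - 1)\<close> modulo \<open>x - y\<close>, so each \<open>p\<close>-th power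
  gains a factor \<open>p\<close>.\<close>

lemma padic_abs_power_card_diff_le:
  fixes x y :: "'p :: prime_card padic"
  assumes x: "padic_abs x \<le> 1" and y: "padic_abs y \<le> 1"
    and le: "padic_abs (x - y) \<le> 1 / real CARD('p) ^ Suc k"
  shows "padic_abs (x ^ CARD('p) - y ^ CARD('p)) \<le> 1 / real CARD('p) ^ Suc (Suc k)"
proof -
  let ?p = "CARD('p)"
  have le1: "padic_abs (x - y) \<le> 1 / real ?p"
  proof -
    have "real ?p ^ 1 \<le> real ?p ^ Suc k"
      using card_gt_1[where 'p = 'p] by (intro power_increasing) auto
    then have "1 / real ?p ^ Suc k \<le> 1 / real ?p"
      by (intro divide_left_mono) auto
    with le show ?thesis by linarith
  qed
  have ypow: "padic_abs (y ^ i) \<le> 1" for i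
    using y by (simp add: padic_abs_power power_le_one)
  define S where "S = (\<Sum>i<?p. y ^ (?p - Suc i) * x ^ i)"
  have "S = (\<Sum>i<?p. y ^ (?p - Suc i) * (x ^ i - y ^ i) + y ^ (?p - 1))"
    unfolding S_def by (intro sum.cong) (auto simp: algebra_simps simp flip: power_add)
  also have "\<dots> = (\<Sum>i<?p. y ^ (?p - Suc i) * (x ^ i - y ^ i)) + of_nat ?p * y ^ (?p - 1)"
    by (simp add: sum.distrib)
  also have "padic_abs \<dots> \<le> 1 / real ?p"
  proof (intro padic_abs_add_le padic_abs_sum_le)
    fix i
    have "padic_abs (y ^ (?p - Suc i) * (x ^ i - y ^ i)) \<le> 1 * (1 / real ?p)"
      using padic_abs_power_diff_le[OF x y, of i] le1 ypow by (intro padic_abs_mult_le) auto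
    then show "padic_abs (y ^ (?p - Suc i) * (x ^ i - y ^ i)) \<le> 1 / real ?p" by simp
  next
    have "padic_abs (of_nat ?p * y ^ (?p - 1)) \<le> 1 / real ?p * 1"
      using ypow by (intro padic_abs_mult_le) (auto simp: padic_abs_card)
    then show "padic_abs (of_nat ?p * y ^ (?p - 1)) \<le> 1 / real ?p" by simp
  qed auto
  finally have "padic_abs ((x - y) * S) \<le> 1 / real ?p ^ Suc k * (1 / real ?p)"
    using le by (intro padic_abs_mult_le)
  moreover have "x ^ ?p - y ^ ?p = (x - y) * S"
    unfolding S_def by (rule power_diff_sumr2)
  ultimately show ?thesis by (simp add: mult.commute)
qed

lemma padic_abs_power_card_power_diff_le:
  fixes x y :: "'p :: prime_card padic"
  assumes x: "padic_abs x \<le> 1" and y: "padic_abs y \<le> 1"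
    and le: "padic_abs (x - y) \<le> 1 / real CARD('p)"
  shows "padic_abs (x ^ (CARD('p) ^ n) - y ^ (CARD('p) ^ n)) \<le> 1 / real CARD('p) ^ Suc n"
proof (induction n)
  case (Suc n)
  have "padic_abs ((x ^ (CARD('p) ^ n)) ^ CARD('p) - (y ^ (CARD('p) ^ n)) ^ CARD('p))
      \<le> 1 / real CARD('p) ^ Suc (Suc n)"
    using x y by (intro padic_abs_power_card_diff_le Suc) (simp_all add: padic_abs_power power_le_one)
  then show ?case by (simp add: mult.commute flip: power_mult)
qed (use le in simp)

section \<open>Residues and the Teichmueller lift\<close>

lemma power_card_mod_ring [simp]: "(x :: 'p :: prime_card mod_ring) ^ CARD('p) = x"
proof (cases "x = 0")
  case False
  have "x ^ (CARD('p) - 2) * x = 1"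
    using False left_inverse[of x] by (simp add: inverse_mod_ring_def)
  moreover have "CARD('p) = Suc (Suc (CARD('p) - 2))"
    using prime_ge_2_nat[OF prime_card[where 'a = 'p]] by simp
  ultimately show ?thesis by (metis mult.commute mult_1_right power_Suc)
qed simp

lemma to_int_mod_ring_power:
  "to_int_mod_ring (x ^ n :: 'p :: prime_card mod_ring) = to_int_mod_ring x ^ n mod int CARD('p)"
  by (induction n) (simp_all add: to_int_mod_ring_mult mod_simps)

abbreviation residue :: "'p :: prime_card mod_ring \<Rightarrow> 'p padic" where
  "residue x \<equiv> of_int (to_int_mod_ring x)"

lemma residue_cong:
  assumes "[to_int_mod_ring x = n] (mod int CARD('p))"
  shows "padic_abs (residue (x :: 'p :: prime_card mod_ring) - of_int n) \<le> 1 / real CARD('p)"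
  using assms padic_abs_of_int_le_power_iff[of "to_int_mod_ring x - n" 1, where 'p = 'p]
  by (simp add: cong_iff_dvd_diff)

lemma residue_mult:
  "padic_abs (residue (x * y :: 'p :: prime_card mod_ring) - residue x * residue y) \<le> 1 / real CARD('p)"
  using residue_cong[of "x * y" "to_int_mod_ring x * to_int_mod_ring y"]
  by (simp add: to_int_mod_ring_mult)

lemma residue_power:
  "padic_abs (residue (x ^ n :: 'p :: prime_card mod_ring) - residue x ^ n) \<le> 1 / real CARD('p)"
  using residue_cong[of "x ^ n" "to_int_mod_ring x ^ n"]
  by (simp add: to_int_mod_ring_power)

lemma residue_diff:
  "padic_abs (residue (x - y :: 'p :: prime_card mod_ring) - (residue x - residue y)) \<le> 1 / real CARD('p)"
proof -
  have "to_int_mod_ring (x - y) = (to_int_mod_ring x - to_int_mod_ring y) mod int CARD('p)"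
    by transfer simp
  then show ?thesis
    using residue_cong[of "x - y" "to_int_mod_ring x - to_int_mod_ring y"] by simp
qed

lemma padic_abs_residue:
  assumes "x \<noteq> 0"
  shows "padic_abs (residue (x :: 'p :: prime_card mod_ring)) = 1"
proof -
  have "to_int_mod_ring x \<in> {0..<int CARD('p)}" using range_to_int_mod_ring by blast
  moreover have "to_int_mod_ring x \<noteq> 0" using assms by simp
  ultimately have "\<not> int CARD('p) dvd to_int_mod_ring x" using zdvd_not_zless by force
  then have "\<not> CARD('p) dvd nat (to_int_mod_ring x)"
    using \<open>to_int_mod_ring x \<in> _\<close> by (simp flip: int_dvd_int_iff)
  then show ?thesis
    using padic_abs_of_nat_unit[of "nat (to_int_mod_ring x)", where 'p = 'p]
      \<open>to_int_mod_ring x \<in> _\<close> by simp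
qed

lemma power_card_power_fixed: "(x :: 'a :: monoid_mult) ^ q = x \<Longrightarrow> x ^ (q ^ n) = x"
  by (induction n) (simp_all add: power_mult)

text \<open>Justifies the definite description. The second claim allows an arbitrary integral lift
  \<open>y\<close> of \<open>x\<close>: lifts that agree modulo \<open>p\<close> have
  \<open>p ^ n\<close>-th powers that agree modulo \<open>p ^ (n + 1)\<close>. It is applied later
  to lifts that are not roots of unity.\<close>

lemma Teichmuller_characterization:
  fixes x :: "'p :: prime_card mod_ring"
  defines "P \<equiv> \<lambda>\<chi> :: 'p mod_ring \<Rightarrow> 'p padic. mult_character \<chi> \<and>
     (\<forall>x. \<exists>z\<in>padic_ints. \<chi> x - of_int (to_int_mod_ring x) = of_nat CARD('p) * z)"
  shows "P teichmuller"
    and "padic_abs y \<le> 1 \<Longrightarrow> padic_abs (y - residue x) \<le> 1 / real CARD('p) \<Longrightarrow>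
      (\<lambda>n. y ^ (CARD('p) ^ n)) \<longlonglongrightarrow> teichmuller x"
proof -
  let ?p = "CARD('p)"
  define \<tau> :: "'p mod_ring \<Rightarrow> 'p padic" where "\<tau> x = lim (\<lambda>n. residue x ^ (?p ^ n))" for x
  have P_iff: "P \<chi> \<longleftrightarrow> mult_character \<chi> \<and> (\<forall>x. padic_abs (\<chi> x - residue x) \<le> 1 / real ?p)" for \<chi>
  proof -
    have "(\<exists>z\<in>padic_ints. u = of_nat ?p * z) \<longleftrightarrow> padic_abs u \<le> 1 / real ?p" for u :: "'p padic"
    proof
      assume "padic_abs u \<le> 1 / real ?p"
      then have "u / of_nat ?p \<in> padic_ints"
        by (simp add: padic_ints_def padic_abs_divide padic_abs_card field_simps)
      moreover have "u = of_nat ?p * (u / of_nat ?p)" by simp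
      ultimately show "\<exists>z\<in>padic_ints. u = of_nat ?p * z" by blast
    next
      assume "\<exists>z\<in>padic_ints. u = of_nat ?p * z"
      then show "padic_abs u \<le> 1 / real ?p"
        by (auto simp: padic_ints_def padic_abs_mult padic_abs_card divide_right_mono)
    qed
    then show ?thesis by (simp add: P_def)
  qed
  have lim: "(\<lambda>n. residue x ^ (?p ^ n)) \<longlonglongrightarrow> \<tau> x" for x
  proof -
    have "convergent (\<lambda>n. residue x ^ (?p ^ n))"
    proof (rule padic_convergent_if_Suc_close)
      fix n
      have "padic_abs (residue x ^ ?p - residue x) \<le> 1 / real ?p"
        using residue_power[of x ?p] by (simp add: padic_abs_diff_commute)
      then have "padic_abs ((residue x ^ ?p) ^ (?p ^ n) - residue x ^ (?p ^ n)) \<le> 1 / real ?p ^ Suc n"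
        by (intro padic_abs_power_card_power_diff_le) (simp_all add: padic_abs_power power_le_one)
      also have "\<dots> \<le> 1 / real ?p ^ n"
        using card_gt_1[where 'p = 'p] by (intro divide_left_mono power_increasing) auto
      finally show "padic_abs (residue x ^ (?p ^ Suc n) - residue x ^ (?p ^ n)) \<le> 1 / real ?p ^ n"
        by (simp flip: power_mult)
    qed
    then show ?thesis by (simp add: \<tau>_def convergent_LIMSEQ_iff)
  qed
  have lim': "(\<lambda>n. y ^ (?p ^ n)) \<longlonglongrightarrow> \<tau> x"
    if "padic_abs y \<le> 1" "padic_abs (y - residue x) \<le> 1 / real ?p" for x y
  proof -
    have "(\<lambda>n. y ^ (?p ^ n) - residue x ^ (?p ^ n)) \<longlonglongrightarrow> 0"
      unfolding padic_tendsto_iff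
    proof (rule tendsto_sandwich[OF _ _ tendsto_const LIMSEQ_Suc[OF inverse_card_power_tendsto_0[where 'p = 'p]]])
      show "\<forall>\<^sub>F n in sequentially. padic_abs (y ^ ?p ^ n - residue x ^ ?p ^ n - 0) \<le> 1 / real ?p ^ Suc n"
        using padic_abs_power_card_power_diff_le[OF that(1) _ that(2)] by simp
    qed simp
    from tendsto_add[OF this lim[of x]] show ?thesis by simp
  qed
  have \<tau>: "P \<tau>"
    unfolding P_iff mult_character_def
  proof (intro conjI allI)
    show "\<tau> 0 = 0"
      using lim[of 0] by (intro LIMSEQ_unique[OF lim[of 0]]) (simp add: power_0_left)
    show "\<tau> 1 = 1"
      by (intro LIMSEQ_unique[OF lim[of 1]]) simp
    fix x y :: "'p mod_ring"
    have "padic_abs (residue x * residue y) \<le> 1 * 1"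
      by (intro padic_abs_mult_le) auto
    then have "(\<lambda>n. (residue x * residue y) ^ (?p ^ n)) \<longlonglongrightarrow> \<tau> (x * y)"
      using residue_mult[of x y] by (intro lim') (simp_all add: padic_abs_diff_commute)
    moreover have "(\<lambda>n. (residue x * residue y) ^ (?p ^ n)) \<longlonglongrightarrow> \<tau> x * \<tau> y"
      using tendsto_mult[OF lim[of x] lim[of y]] by (simp add: power_mult_distrib)
    ultimately show "\<tau> (x * y) = \<tau> x * \<tau> y" by (rule LIMSEQ_unique)
  next
    fix x :: "'p mod_ring"
    show "padic_abs (\<tau> x - residue x) \<le> 1 / real ?p"
    proof (rule Lim_bounded)
      show "(\<lambda>n. padic_abs (residue x ^ (?p ^ n) - residue x)) \<longlonglongrightarrow> padic_abs (\<tau> x - residue x)"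
        by (intro tendsto_padic_abs tendsto_diff lim tendsto_const)
      show "\<forall>n\<ge>0. padic_abs (residue x ^ (?p ^ n) - residue x) \<le> 1 / real ?p"
        using residue_power[of x "?p ^ n" for n]
        by (simp add: padic_abs_diff_commute power_card_power_fixed)
    qed
  qed
  \<comment> \<open>From \<open>x ^ p = x\<close> the value \<open>\<chi> x\<close> is fixed by
    \<open>p\<close>-th powers; being a lift of \<open>x\<close>, it makes the converging sequence
    constant.\<close>
  have unique: "\<chi> = \<tau>" if "P \<chi>" for \<chi>
  proof
    fix x
    have mult: "\<chi> (x * y) = \<chi> x * \<chi> y" and one: "\<chi> 1 = 1"
      and le: "padic_abs (\<chi> x - residue x) \<le> 1 / real ?p" for x y
      using that by (auto simp: P_iff mult_character_def)
    have pow: "\<chi> (x ^ n) = \<chi> x ^ n" for n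
      by (induction n) (simp_all add: mult one)
    have "padic_abs (residue x + (\<chi> x - residue x)) \<le> 1"
      using order.trans[OF le[of x], of 1] card_gt_1[where 'p = 'p]
      by (intro padic_abs_add_le) simp_all
    then have "(\<lambda>n. \<chi> x ^ (?p ^ n)) \<longlonglongrightarrow> \<tau> x"
      by (intro lim' le) simp
    then have "(\<lambda>n. \<chi> x) \<longlonglongrightarrow> \<tau> x"
      by (simp add: power_card_power_fixed flip: pow)
    then show "\<chi> x = \<tau> x" by (simp add: LIMSEQ_const_iff)
  qed
  have "teichmuller = \<tau>"
    unfolding teichmuller_def
    using \<tau> unique unfolding P_def by (intro the_equality) blast+
  with \<tau> lim' show "P teichmuller" and "padic_abs y \<le> 1 \<Longrightarrow> padic_abs (y - residue x) \<le> 1 / real CARD('p) \<Longrightarrow>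
      (\<lambda>n. y ^ (CARD('p) ^ n)) \<longlonglongrightarrow> teichmuller x"
    by auto
qed

lemma teichmuller_0 [simp]: "teichmuller 0 = 0"
  and teichmuller_1 [simp]: "teichmuller 1 = 1"
  and teichmuller_mult: "teichmuller (x * y) = teichmuller x * teichmuller y"
  using Teichmuller_characterization(1) by (auto simp: mult_character_def)

lemma teichmuller_power: "teichmuller (x ^ n) = teichmuller x ^ n"
  by (induction n) (simp_all add: teichmuller_mult)

lemma padic_abs_teichmuller_diff_le:
  "padic_abs (teichmuller x - residue (x :: 'p :: prime_card mod_ring)) \<le> 1 / real CARD('p)"
proof -
  obtain z where "padic_abs z \<le> 1" "teichmuller x - residue x = of_nat CARD('p) * z"
    using Teichmuller_characterization(1)[where 'p = 'p] by (auto simp: padic_ints_def)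
  then show ?thesis by (simp add: padic_abs_mult padic_abs_card divide_right_mono)
qed

lemma teichmuller_power_card_minus_1:
  assumes "x \<noteq> 0"
  shows "teichmuller (x :: 'p :: prime_card mod_ring) ^ (CARD('p) - 1) = 1"
proof -
  have "x * x ^ (CARD('p) - 1) = x * 1"
    using power_card_mod_ring[of x] prime_gt_0_nat[OF prime_card[where 'a = 'p]]
    by (metis Suc_pred' mult.right_neutral power_Suc)
  then have "x ^ (CARD('p) - 1) = 1" using assms by (metis mult_left_cancel)
  then show ?thesis by (metis teichmuller_1 teichmuller_power)
qed

lemma teichmuller_eq_0_iff [simp]: "teichmuller x = 0 \<longleftrightarrow> x = 0"
proof
  assume "teichmuller x = 0"
  show "x = 0"
  proof (rule ccontr)
    assume "x \<noteq> 0"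
    then have "teichmuller x * teichmuller (inverse x) = 1"
      by (simp flip: teichmuller_mult)
    with \<open>teichmuller x = 0\<close> show False by simp
  qed
qed simp

lemma padic_abs_teichmuller:
  assumes "x \<noteq> 0"
  shows "padic_abs (teichmuller (x :: 'p :: prime_card mod_ring)) = 1"
proof -
  have "padic_abs (teichmuller x) ^ (CARD('p) - 1) = 1"
    using teichmuller_power_card_minus_1[OF assms] by (simp flip: padic_abs_power)
  moreover have "CARD('p) - 1 > 0" using prime_gt_1_nat[OF prime_card[where 'a = 'p]] by simp
  ultimately show ?thesis using power_eq_imp_eq_base[of "padic_abs (teichmuller x)" "CARD('p) - 1" 1] by simp
qed

lemma inj_teichmuller: "inj (teichmuller :: 'p :: prime_card mod_ring \<Rightarrow> 'p padic)"
proof (rule injI, rule ccontr)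
  fix x y :: "'p mod_ring" assume eq: "teichmuller x = teichmuller y" and ne: "x \<noteq> y"
  have "padic_abs ((residue (x - y) - (residue x - residue y)) -
      ((teichmuller x - residue x) - (teichmuller y - residue y))) \<le> 1 / real CARD('p)"
    by (intro padic_abs_diff_le[of _ "1 / real CARD('p)"] residue_diff padic_abs_teichmuller_diff_le)
  moreover have "padic_abs (residue (x - y)) = 1" using ne by (intro padic_abs_residue) simp
  ultimately show False using card_gt_1[where 'p = 'p] by (simp add: eq divide_simps)
qed

text \<open>\<open>1 - teichmuller t\<close> lifts \<open>1 - t\<close>. This limit is where the
  character of \<open>1 - t\<close> in the Jacobi sum comes from.\<close>

lemma tendsto_one_minus_teichmuller:
  "(\<lambda>n. (1 - teichmuller (t :: 'p :: prime_card mod_ring)) ^ (CARD('p) ^ n)) \<longlonglongrightarrow> teichmuller (1 - t)"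
proof (rule Teichmuller_characterization(2))
  have t: "padic_abs (teichmuller t) \<le> 1"
    by (cases "t = 0") (simp_all add: padic_abs_teichmuller)
  then show "padic_abs (1 - teichmuller t) \<le> 1" by (intro padic_abs_diff_le) simp_all
  have "padic_abs (- (residue (1 - t) - (residue 1 - residue t)) - (teichmuller t - residue t)) \<le> 1 / real CARD('p)"
    by (intro padic_abs_diff_le residue_diff padic_abs_teichmuller_diff_le)
      (simp only: padic_abs_minus residue_diff)
  then show "padic_abs (1 - teichmuller t - residue (1 - t)) \<le> 1 / real CARD('p)"
    by (simp add: algebra_simps)
qed

text \<open>The powers have a limit of absolute value 1, and powers of an integral element are no
  larger than the element itself.\<close>

lemma padic_abs_one_minus_teichmuller:
  assumes "t \<noteq> 1"
  shows "padic_abs (1 - teichmuller (t :: 'p :: prime_card mod_ring)) = 1"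
proof -
  have "(\<lambda>n. padic_abs (1 - teichmuller t) ^ (CARD('p) ^ n)) \<longlonglongrightarrow> 1"
    using tendsto_padic_abs[OF tendsto_one_minus_teichmuller[of t]] assms
    by (simp add: padic_abs_power padic_abs_teichmuller)
  moreover have "padic_abs (teichmuller t) \<le> 1"
    by (cases "t = 0") (simp_all add: padic_abs_teichmuller)
  then have le: "padic_abs (1 - teichmuller t) \<le> 1" by (intro padic_abs_diff_le) simp_all
  moreover have "padic_abs (1 - teichmuller t) ^ (CARD('p) ^ n) \<le> padic_abs (1 - teichmuller t)" for n
    using power_decreasing[of 1 "CARD('p) ^ n" "padic_abs (1 - teichmuller t)"] le by simp
  ultimately have "1 \<le> padic_abs (1 - teichmuller t)"
    by (intro LIMSEQ_le_const2) auto
  with le show ?thesis by simp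
qed

text \<open>Orthogonality: substituting \<open>g * x\<close> multiplies the sum by the
  \<open>n\<close>-th power of \<open>teichmuller g\<close>. Some \<open>g\<close> gives a factor
  other than 1, for otherwise the polynomial \<open>X ^ k - 1\<close> with
  \<open>0 < k < p - 1\<close> would have \<open>p - 1\<close> roots.\<close>

lemma sum_teichmuller_power:
  assumes "\<not> CARD('p) - 1 dvd n"
  shows "(\<Sum>x\<in>- {0}. teichmuller (x :: 'p :: prime_card mod_ring) ^ n) = 0"
proof -
  let ?q = "CARD('p) - 1"
  define k where "k = n mod ?q"
  have q: "?q > 0" using prime_gt_1_nat[OF prime_card[where 'a = 'p]] by simp
  have k: "0 < k" "k < ?q" using assms q by (auto simp: k_def mod_eq_0_iff_dvd intro: Nat.gr0I)
  have red: "teichmuller x ^ n = teichmuller x ^ k" if "x \<noteq> 0" for x :: "'p mod_ring"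
  proof -
    have "teichmuller x ^ n = teichmuller x ^ (?q * (n div ?q) + k)" by (simp add: k_def)
    then show ?thesis using teichmuller_power_card_minus_1[OF that] by (simp add: power_add power_mult)
  qed
  obtain g :: "'p mod_ring" where g: "g \<noteq> 0" "teichmuller g ^ k \<noteq> 1"
  proof (rule ccontr)
    assume "\<not> thesis"
    then have all: "teichmuller x ^ k = 1" if "x \<noteq> 0" for x :: "'p mod_ring"
      using that \<open>\<And>g. \<lbrakk>g \<noteq> 0; teichmuller g ^ k \<noteq> 1\<rbrakk> \<Longrightarrow> thesis\<close> by blast
    let ?P = "monom 1 k - 1 :: 'p padic poly"
    have deg: "degree ?P \<le> k" by (intro degree_diff_le) (simp_all add: degree_monom_eq)
    have "coeff ?P k = 1" using k by simp
    then have "?P \<noteq> 0" by (metis coeff_0 zero_neq_one)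
    have "card (teichmuller ` (- {0 :: 'p mod_ring})) \<le> card {x. poly ?P x = 0}"
      using all by (intro card_mono poly_roots_finite \<open>?P \<noteq> 0\<close>) (auto simp: poly_monom)
    also have "\<dots> \<le> k" using card_poly_roots_bound[OF \<open>?P \<noteq> 0\<close>] deg by simp
    also have "card (teichmuller ` (- {0 :: 'p mod_ring})) = ?q"
      using inj_teichmuller by (subst card_image) (auto intro: inj_on_subset simp: Compl_eq_Diff_UNIV)
    finally show False using k by simp
  qed
  have "(\<Sum>x\<in>- {0}. teichmuller (x :: 'p mod_ring) ^ k) = (\<Sum>x\<in>- {0}. teichmuller (g * x) ^ k)"
    using g(1) by (intro sum.reindex_bij_witness[of _ "\<lambda>x. g * x" "\<lambda>x. inverse g * x"])
      (auto simp: mult.assoc[symmetric])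
  also have "\<dots> = teichmuller g ^ k * (\<Sum>x\<in>- {0}. teichmuller (x :: 'p mod_ring) ^ k)"
    by (simp add: teichmuller_mult power_mult_distrib sum_distrib_left)
  finally have "(teichmuller g ^ k - 1) * (\<Sum>x\<in>- {0}. teichmuller (x :: 'p mod_ring) ^ k) = 0"
    by (simp add: algebra_simps)
  then have "(\<Sum>x\<in>- {0}. teichmuller (x :: 'p mod_ring) ^ k) = 0" using g(2) by simp
  then show ?thesis using red by (metis (no_types, lifting) ComplD insertI1 sum.cong)
qed

section \<open>Morita's gamma function\<close>

lemma morita_nat_0 [simp]: "morita_nat 0 = 1"
  by (simp add: morita_nat_def)

lemma morita_nat_Suc:
  "(morita_nat (Suc n) :: 'p :: prime_card padic) =
     - (if CARD('p) dvd n then 1 else of_nat n) * morita_nat n"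
proof (cases "CARD('p) dvd n")
  case True
  then have "{j. 0 < j \<and> j < Suc n \<and> \<not> CARD('p) dvd j} = {j. 0 < j \<and> j < n \<and> \<not> CARD('p) dvd j}"
    by (auto simp: less_Suc_eq)
  with True show ?thesis by (simp add: morita_nat_def)
next
  case False
  then have "n > 0" by (auto intro: Nat.gr0I)
  with False have "{j. 0 < j \<and> j < Suc n \<and> \<not> CARD('p) dvd j} =
      insert n {j. 0 < j \<and> j < n \<and> \<not> CARD('p) dvd j}"
    by (auto simp: less_Suc_eq)
  with False show ?thesis by (simp add: morita_nat_def)
qed

lemma morita_nat_1 [simp]: "morita_nat (Suc 0) = -1"
  by (simp add: morita_nat_Suc)

lemma padic_abs_morita_nat [simp]: "padic_abs (morita_nat n :: 'p :: prime_card padic) = 1"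
  by (induction n) (auto simp: morita_nat_Suc padic_abs_mult padic_abs_of_nat_unit)

text \<open>The multiples of \<open>p\<close> up to \<open>n\<close> contribute
  \<open>p ^ (n div p) * fact (n div p)\<close>; the other factors form
  \<open>morita_nat (Suc n)\<close> up to sign. This is the passage from binomial coefficients to
  gamma values.\<close>

lemma fact_padic:
  "(fact n :: 'p :: prime_card padic) =
     (-1) ^ Suc n * morita_nat (Suc n) * of_nat CARD('p) ^ (n div CARD('p)) * fact (n div CARD('p))"
proof (induction n)
  case (Suc n)
  let ?p = "CARD('p)"
  have fact: "(fact (Suc n) :: 'p padic) = of_nat (Suc n) * fact n" by (rule fact_Suc)
  show ?case
  proof (cases "?p dvd Suc n")
    case True
    then have d: "Suc n div ?p = Suc (n div ?p)" by (simp add: div_Suc mod_eq_0_iff_dvd)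
    from True have 1: "(of_nat (Suc n) :: 'p padic) = of_nat ?p * of_nat (Suc (n div ?p))"
      using dvd_mult_div_cancel[OF True] unfolding d by (simp only: of_nat_mult[symmetric])
    have 2: "(fact (Suc (n div ?p)) :: 'p padic) = of_nat (Suc (n div ?p)) * fact (n div ?p)"
      by (rule fact_Suc)
    have 3: "(morita_nat (Suc (Suc n)) :: 'p padic) = - morita_nat (Suc n)"
      using True by (simp add: morita_nat_Suc[of "Suc n"])
    have "A * S * ((-1) ^ Suc n * M * A ^ q * F) = (-1) ^ Suc (Suc n) * (- M) * A ^ Suc q * (S * F)"
      for A S M F :: "'p padic" and q by (simp add: mult_ac)
    then show ?thesis unfolding fact 1 3 Suc d 2 .
  next
    case False
    then have d: "Suc n div ?p = n div ?p" by (simp add: div_Suc mod_eq_0_iff_dvd)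
    have 3: "(morita_nat (Suc (Suc n)) :: 'p padic) = - of_nat (Suc n) * morita_nat (Suc n)"
      using False by (simp add: morita_nat_Suc[of "Suc n"] del: of_nat_Suc)
    have "S * ((-1) ^ Suc n * M * A * F) = (-1) ^ Suc (Suc n) * (- S * M) * A * F"
      for A S M F :: "'p padic" by (simp add: mult_ac)
    then show ?thesis unfolding fact 3 d Suc .
  qed
qed simp

section \<open>Wilson's theorem modulo prime powers and continuity of the gamma function\<close>

text \<open>Inversion permutes the units, so the product equals the product of the inverses. The
  remaining sign is settled separately, modulo \<open>p\<close>.\<close>

lemma prod_units_power_cong:
  assumes p: "prime p" and n: "n = p ^ k" "k > 0"
  shows "[(\<Prod>j | 0 < j \<and> j < int n \<and> \<not> int p dvd j. j) ^ 2 = 1] (mod int n)"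
proof -
  define S where "S = {j. 0 < j \<and> j < int n \<and> \<not> int p dvd j}"
  let ?inv = "modular_inverse (int n)"
  have "int p > 1" using prime_gt_1_nat[OF p] by simp
  then have n1: "int n > 1" using n one_less_power[of "int p" k] by simp
  have "prime (int p)" using p by simp
  then have "coprime (int p) j \<longleftrightarrow> \<not> int p dvd j" for j
    using prime_imp_coprime[of "int p" j] by (auto simp: coprime_absorb_left)
  then have cop: "coprime j (int n) \<longleftrightarrow> \<not> int p dvd j" for j
    using n by (simp add: coprime_commute)
  have inv: "?inv j \<in> S" "[j * ?inv j = 1] (mod int n)" "?inv (?inv j) = j" if "j \<in> S" for j
  proof -
    have c: "coprime j (int n)" using that by (simp add: S_def cop)
    show 1: "[j * ?inv j = 1] (mod int n)" by (rule cong_modular_inverse1[OF c])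
    have nd: "\<not> int p dvd ?inv j" using c by (simp flip: cop)
    moreover have "?inv j \<noteq> 0" using nd by auto
    moreover have "?inv j \<ge> 0" "?inv j < int n"
      using n1 by (auto intro: modular_inverse_int_nonneg modular_inverse_int_less)
    ultimately show "?inv j \<in> S" by (simp add: S_def)
    show "?inv (?inv j) = j"
      using that 1 by (intro modular_inverse_int_eqI) (auto simp: S_def mult.commute)
  qed
  have "(\<Prod>j\<in>S. j) = (\<Prod>j\<in>S. ?inv j)"
    by (rule prod.reindex_bij_witness[of _ ?inv ?inv]) (simp_all add: inv)
  then have "(\<Prod>j\<in>S. j) ^ 2 = (\<Prod>j\<in>S. j * ?inv j)"
    by (simp add: power2_eq_square prod.distrib)
  also have "[\<dots> = (\<Prod>j\<in>S. 1)] (mod int n)"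
    by (intro cong_prod inv)
  finally show ?thesis by (simp add: S_def)
qed

text \<open>Induction on \<open>n\<close>: the factors acquired at \<open>n\<close> and at
  \<open>n + q\<close> differ by \<open>q\<close>, or are both 1, since \<open>p\<close> divides
  \<open>q\<close>.\<close>

lemma morita_nat_shift_aux:
  assumes base: "padic_abs (morita_nat q - 1 :: 'p :: prime_card padic) \<le> e"
    and q: "CARD('p) dvd q" "padic_abs (of_nat q :: 'p padic) \<le> e" and e: "e \<ge> 0"
  shows "padic_abs (morita_nat (n + q) - morita_nat n :: 'p padic) \<le> e"
proof (induction n)
  case (Suc n)
  let ?h = "\<lambda>n. if CARD('p) dvd n then 1 else of_nat n :: 'p padic"
  have "padic_abs (?h (n + q) - ?h n) \<le> e" using q e by (auto simp: dvd_add_left_iff)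
  moreover have "padic_abs (?h n) \<le> 1" by simp
  moreover have "morita_nat (Suc n + q) - morita_nat (Suc n) =
      - ((?h (n + q) - ?h n) * morita_nat (n + q) + ?h n * (morita_nat (n + q) - morita_nat n))"
    by (simp only: add_Suc morita_nat_Suc) (simp add: algebra_simps)
  ultimately show ?case
    using padic_abs_mult_le[of "?h (n + q) - ?h n" e "morita_nat (n + q)" 1]
      padic_abs_mult_le[of "?h n" 1 "morita_nat (n + q) - morita_nat n" e] Suc
    by (simp only: padic_abs_minus) (intro padic_abs_add_le; simp)
qed (use base in simp)

lemma morita_nat_shift_mult_aux:
  assumes base: "padic_abs (morita_nat q - 1 :: 'p :: prime_card padic) \<le> e"
    and q: "CARD('p) dvd q" "padic_abs (of_nat q :: 'p padic) \<le> e" and e: "e \<ge> 0"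
  shows "padic_abs (morita_nat (n + i * q) - morita_nat n :: 'p padic) \<le> e"
proof (induction i)
  case (Suc i)
  have "padic_abs ((morita_nat (n + i * q + q) - morita_nat (n + i * q)) +
      (morita_nat (n + i * q) - morita_nat n) :: 'p padic) \<le> e"
    by (intro padic_abs_add_le Suc morita_nat_shift_aux assms)
  then show ?case by (simp add: algebra_simps)
qed (use e in simp)

text \<open>
  Wilson's theorem modulo \<open>p ^ k\<close>: the square of the product of the units is 1, and modulo \<open>p\<close>
  the product is a power of \<open>(p - 1)!\<close>.
\<close>

lemma morita_nat_card_power:
  assumes odd: "odd CARD('p)"
  shows "padic_abs (morita_nat (CARD('p) ^ k) - 1 :: 'p :: prime_card padic) \<le> 1 / real CARD('p) ^ k"
proof (cases "k = 0")
  case True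
  have "padic_abs (morita_nat (CARD('p) ^ k) - 1 :: 'p padic) \<le> 1"
    by (intro padic_abs_diff_le) simp_all
  with True show ?thesis by simp
next
  case False
  let ?p = "CARD('p)"
  have p: "prime ?p" by (rule prime_card)
  define x where "x = (morita_nat (?p ^ k) :: 'p padic)"
  have pred: "Suc (?p - 1) = ?p" using prime_gt_0_nat[OF p] by simp
  have p1: "padic_abs (morita_nat ?p - 1 :: 'p padic) \<le> 1 / real ?p"
  proof -
    have "(fact (?p - 1) :: 'p padic) = - morita_nat ?p"
      using fact_padic[of "?p - 1", where 'p = 'p] odd prime_gt_0_nat[OF p]
      unfolding pred by simp
    moreover have "int ?p ^ 1 dvd fact (?p - 1) - (- 1)"
      using wilson_theorem[OF p] by (simp only: cong_iff_dvd_diff power_one_right)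
    then have "padic_abs (of_int (fact (?p - 1) - (- 1)) :: 'p padic) \<le> 1 / real ?p ^ 1"
      by (subst padic_abs_of_int_le_power_iff)
    then have "padic_abs (fact (?p - 1) + 1 :: 'p padic) \<le> 1 / real ?p" by simp
    ultimately have "padic_abs (- (morita_nat ?p - 1) :: 'p padic) \<le> 1 / real ?p" by simp
    then show ?thesis by (simp only: padic_abs_minus)
  qed
  have "padic_abs (morita_nat (0 + ?p ^ (k - 1) * ?p) - morita_nat 0 :: 'p padic) \<le> 1 / real ?p"
    by (rule morita_nat_shift_mult_aux[OF p1]) (simp_all add: padic_abs_card)
  moreover have "0 + ?p ^ (k - 1) * ?p = ?p ^ k" using False by (cases k) auto
  ultimately have "padic_abs (x - 1) \<le> 1 / real ?p"
    unfolding x_def by (simp only: morita_nat_0)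
  \<comment> \<open>Since \<open>x\<close> is congruent to 1 and \<open>2\<close> is a unit,
    \<open>x + 1\<close> is a unit; the bound on \<open>(x - 1) * (x + 1)\<close> then passes to
    \<open>x - 1\<close>. Oddness is essential: \<open>morita_nat 4 = 3\<close> is not 1 modulo 4
    when \<open>p = 2\<close>.\<close>
  moreover have "padic_abs (x + 1) = 1"
  proof (rule antisym)
    show "padic_abs (x + 1) \<le> 1" by (intro padic_abs_add_le) (simp_all add: x_def)
    have "\<not> ?p dvd 2"
    proof
      assume "?p dvd 2"
      then have "?p \<le> 2" by (rule dvd_imp_le) simp
      with prime_ge_2_nat[OF p] have "?p = 2" by simp
      with odd show False by simp
    qed
    then have two: "padic_abs (2 :: 'p padic) = 1" using padic_abs_of_nat_unit[of 2, where 'p = 'p] by simp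
    show "1 \<le> padic_abs (x + 1)"
    proof (rule ccontr)
      assume "\<not> 1 \<le> padic_abs (x + 1)"
      moreover have "padic_abs (x - 1) < 1"
        using le_less_trans[OF \<open>padic_abs (x - 1) \<le> _\<close>, of 1] card_gt_1[where 'p = 'p] by simp
      moreover have "padic_abs (2 :: 'p padic) \<le> max (padic_abs (x + 1)) (padic_abs (- (x - 1)))"
        using padic_abs_ultrametric[of "x + 1" "- (x - 1)"] by simp
      ultimately show False using two unfolding padic_abs_minus by linarith
    qed
  qed
  moreover have "padic_abs ((x - 1) * (x + 1)) \<le> 1 / real ?p ^ k"
  proof -
    define P where "P = (\<Prod>j | 0 < j \<and> j < int (?p ^ k) \<and> \<not> int ?p dvd j. j)"
    have "{j. 0 < j \<and> j < int (?p ^ k) \<and> \<not> int ?p dvd j} = int ` {j. 0 < j \<and> j < ?p ^ k \<and> \<not> ?p dvd j}"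
      (is "?A = int ` ?B")
    proof
      show "?A \<subseteq> int ` ?B"
      proof
        fix j assume j: "j \<in> ?A"
        then obtain i where "j = int i" using zero_le_imp_eq_int[of j] by auto
        with j show "j \<in> int ` ?B" by simp
      qed
    qed auto
    then have "P = (\<Prod>j\<in>?B. int j)" by (simp add: P_def prod.reindex)
    then have x: "x = (-1) ^ (?p ^ k) * of_int P" by (simp add: x_def morita_nat_def)
    have "(u - 1) * (u + 1) = of_int (P\<^sup>2 - 1)" if "u = s * of_int P" "s * s = 1" for u s :: "'p padic"
    proof -
      have "(u - 1) * (u + 1) = u * u - 1" by (simp add: algebra_simps)
      also have "u * u = (s * s) * (of_int P * of_int P)" unfolding that(1) by (simp only: mult_ac)
      finally show ?thesis by (simp add: that(2) power2_eq_square)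
    qed
    moreover have "(-1) ^ q * (-1) ^ q = (1 :: 'p padic)" for q
      by (simp only: power_mult_distrib[symmetric]) simp
    ultimately have "(x - 1) * (x + 1) = of_int (P\<^sup>2 - 1)" using x by blast
    moreover have "int ?p ^ k dvd P\<^sup>2 - 1"
      using prod_units_power_cong[OF p refl, of k] False
      by (simp add: P_def cong_iff_dvd_diff)
    ultimately show ?thesis by (simp add: padic_abs_of_int_le_power_iff del: of_int_diff)
  qed
  ultimately show ?thesis by (simp add: padic_abs_mult x_def)
qed

lemma morita_nat_cong:
  assumes odd: "odd CARD('p)"
    and le: "padic_abs (of_nat a - of_nat b :: 'p :: prime_card padic) \<le> 1 / real CARD('p) ^ k"
  shows "padic_abs (morita_nat a - morita_nat b :: 'p padic) \<le> 1 / real CARD('p) ^ k"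
proof (cases "k = 0")
  case True
  have "padic_abs (morita_nat a - morita_nat b :: 'p padic) \<le> 1"
    by (intro padic_abs_diff_le) simp_all
  with True show ?thesis by simp
next
  case False
  let ?p = "CARD('p)"
  have *: "padic_abs (morita_nat (n + i * ?p ^ k) - morita_nat n :: 'p padic) \<le> 1 / real ?p ^ k" for n i
    using False by (intro morita_nat_shift_mult_aux morita_nat_card_power odd)
      (simp_all add: padic_abs_power padic_abs_card power_divide)
  have cong: "[a = b] (mod ?p ^ k)"
    using le by (simp add: padic_abs_of_nat_diff_le_iff flip: cong_int_iff)
  show ?thesis
  proof (cases "b \<le> a")
    case True
    with cong have "?p ^ k dvd a - b" by (simp add: cong_altdef_nat)
    then obtain i where "a - b = ?p ^ k * i" by (elim dvdE)
    with True have "a = b + i * ?p ^ k" by (simp add: mult.commute)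
    then show ?thesis using *[of b i] by simp
  next
    case False
    with cong have "?p ^ k dvd b - a" by (simp add: cong_altdef_nat cong_sym_eq[of a])
    then obtain i where "b - a = ?p ^ k * i" by (elim dvdE)
    with False have "b = a + i * ?p ^ k" by (simp add: mult.commute)
    then show ?thesis using *[of a i] by (simp add: padic_abs_diff_commute[of "morita_nat a"])
  qed
qed

text \<open>Raising \<open>t\<close> moves one factor from the first product to the second, and
  \<open>p ^ f - Suc t\<close> is congruent to \<open>- Suc t\<close>. Each nonmultiple of
  \<open>p\<close> thus gives a sign, and there are \<open>t - t div p\<close> of them up to
  \<open>t\<close>.\<close>

lemma morita_nat_reflection:
  assumes odd: "odd CARD('p)" and t: "t < CARD('p) ^ f"
  shows "padic_abs (morita_nat (CARD('p) ^ f - t) * morita_nat (Suc t) +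
    (-1) ^ (t - t div CARD('p)) :: 'p :: prime_card padic) \<le> 1 / real CARD('p) ^ f"
  using t
proof (induction t)
  case 0
  show ?case using morita_nat_card_power[OF odd, of f]
    by (simp add: padic_abs_diff_commute[of 1])
next
  case (Suc t)
  let ?p = "CARD('p)"
  let ?A = "morita_nat (?p ^ f - Suc t) :: 'p padic" and ?B = "morita_nat (Suc t) :: 'p padic"
  have IH: "padic_abs (morita_nat (?p ^ f - t) * ?B + (-1) ^ (t - t div ?p)) \<le> 1 / real ?p ^ f"
    using Suc by simp
  have fpos: "?p dvd ?p ^ f" using Suc.prems by (cases f) auto
  have eq: "?p ^ f - t = Suc (?p ^ f - Suc t)" using Suc.prems by simp
  have dvd: "?p dvd ?p ^ f - Suc t \<longleftrightarrow> ?p dvd Suc t"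
    using dvd_diffD1[OF _ fpos, of "Suc t"] dvd_diff_nat[OF fpos, of "Suc t"] Suc.prems
    by (meson less_imp_le)
  have A: "morita_nat (?p ^ f - t) = - (if ?p dvd Suc t then 1 else of_nat ?p ^ f - of_nat (Suc t)) * ?A"
    unfolding eq morita_nat_Suc[of "?p ^ f - Suc t"] dvd
    using Suc.prems by (simp only: of_nat_diff[OF less_imp_le] of_nat_power)
  have B: "morita_nat (Suc (Suc t)) = - (if ?p dvd Suc t then 1 else of_nat (Suc t)) * ?B"
    by (rule morita_nat_Suc)
  show ?case
  proof (cases "?p dvd Suc t")
    case True
    then have "Suc t - Suc t div ?p = t - t div ?p" by (simp add: div_Suc mod_eq_0_iff_dvd)
    with IH show ?thesis unfolding A B using True by simp
  next
    case False
    have "t div ?p \<le> t" by simp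
    with False have e: "Suc t - Suc t div ?p = Suc (t - t div ?p)"
      by (simp add: div_Suc mod_eq_0_iff_dvd Suc_diff_le)
    have 1: "morita_nat (?p ^ f - t) * ?B = - (of_nat ?p ^ f - of_nat (Suc t)) * ?A * ?B"
      unfolding A using False by simp
    have 2: "morita_nat (Suc (Suc t)) = - of_nat (Suc t) * ?B"
      unfolding B using False by simp
    have "?A * morita_nat (Suc (Suc t)) + (-1) ^ (Suc t - Suc t div ?p) =
        - (morita_nat (?p ^ f - t) * ?B + (-1) ^ (t - t div ?p)) - of_nat ?p ^ f * (?A * ?B)"
      unfolding 1 2 e by (simp add: algebra_simps del: of_nat_Suc)
    also have "padic_abs \<dots> \<le> 1 / real ?p ^ f"
      using IH by (intro padic_abs_diff_le)
        (simp_all only: padic_abs_minus, simp add: padic_abs_mult padic_abs_power padic_abs_card power_divide)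
    finally show ?thesis .
  qed
qed

text \<open>Replaces the limit along a filter in \<open>morita_Gamma\<close> by limits along
  arbitrary sequences of naturals; all gamma values below are computed this way.\<close>

lemma tendsto_morita_nat:
  fixes x :: "'p :: prime_card padic"
  assumes odd: "odd CARD('p)" and g: "(\<lambda>n. of_nat (g n)) \<longlonglongrightarrow> x"
  shows "(\<lambda>n. morita_nat (g n)) \<longlonglongrightarrow> morita_Gamma x"
proof -
  let ?p = "CARD('p)"
  have small: "\<exists>k. 1 / real ?p ^ k < e" if "e > 0" for e :: real
    using order_tendstoD(2)[OF inverse_card_power_tendsto_0[where 'p = 'p] that]
    by (auto simp: eventually_sequentially)
  have pos: "1 / real ?p ^ k > 0" for k by simp
  have near: "\<exists>N. \<forall>n\<ge>N. padic_abs (of_nat (g n) - x) < 1 / real ?p ^ k" for k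
    using metric_LIMSEQ_D[OF g pos[of k]] by (simp add: dist_padic_def)
  have close: "padic_abs (morita_nat a - morita_nat b :: 'p padic) \<le> 1 / real ?p ^ k"
    if "padic_abs (of_nat a - x) < 1 / real ?p ^ k" "padic_abs (of_nat b - x) < 1 / real ?p ^ k" for a b k
  proof (rule morita_nat_cong[OF odd])
    have "padic_abs ((of_nat a - x) - (of_nat b - x)) \<le> 1 / real ?p ^ k"
      by (rule padic_abs_diff_le) (use that in auto)
    then show "padic_abs (of_nat a - of_nat b :: 'p padic) \<le> 1 / real ?p ^ k" by simp
  qed
  have "Cauchy (\<lambda>n. morita_nat (g n) :: 'p padic)"
  proof (rule CauchyI')
    fix e :: real assume "e > 0"
    then obtain k where k: "1 / real ?p ^ k < e" using small by blast
    obtain N where N: "\<And>n. n \<ge> N \<Longrightarrow> padic_abs (of_nat (g n) - x) < 1 / real ?p ^ k"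
      using near by blast
    show "\<exists>M. \<forall>m\<ge>M. \<forall>n>m. dist (morita_nat (g m) :: 'p padic) (morita_nat (g n)) < e"
      using le_less_trans[OF close[OF N N] k] by (intro exI[of _ N]) (auto simp: dist_padic_def)
  qed
  then obtain L :: "'p padic" where L: "(\<lambda>n. morita_nat (g n)) \<longlonglongrightarrow> L"
    using Cauchy_convergent unfolding convergent_def by blast
  have lim: "padic_abs (morita_nat a - L) \<le> 1 / real ?p ^ k"
    if a: "padic_abs (of_nat a - x) < 1 / real ?p ^ k" for a k
  proof -
    obtain N where N: "\<And>n. n \<ge> N \<Longrightarrow> padic_abs (of_nat (g n) - x) < 1 / real ?p ^ k"
      using near by blast
    show ?thesis
    proof (rule Lim_bounded)
    show "(\<lambda>n. padic_abs (morita_nat a - morita_nat (g n) :: 'p padic)) \<longlonglongrightarrow> padic_abs (morita_nat a - L)"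
      by (intro tendsto_padic_abs tendsto_diff tendsto_const L)
    show "\<forall>n\<ge>N. padic_abs (morita_nat a - morita_nat (g n) :: 'p padic) \<le> 1 / real ?p ^ k"
      using close[OF a N] by blast
    qed
  qed
  have "morita_Gamma x = L"
  proof (cases "x = 0")
    \<comment> \<open>At 0 the definition prescribes 1; this agrees with the limit because
      \<open>morita_nat 0 = 1\<close> takes part in the uniform estimate.\<close>
    case True
    have "padic_abs (1 - L) \<le> 1 / real ?p ^ k" for k
      using lim[of 0 k] True by simp
    then have "padic_abs (1 - L) \<le> 0"
      by (intro LIMSEQ_le_const[OF inverse_card_power_tendsto_0[where 'p = 'p]]) auto
    then have "padic_abs (1 - L) = 0" using padic_abs_nonneg[of "1 - L"] by linarith
    then show ?thesis using True by (simp add: morita_Gamma_def)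
  next
    case False
    let ?F = "inf (filtercomap of_nat (nhds x)) (principal {0 :: nat<..})"
    have "(morita_nat \<longlongrightarrow> L) ?F"
    proof (rule tendstoI)
      fix e :: real assume "e > 0"
      then obtain k where k: "1 / real ?p ^ k < e" using small by blast
      have "\<forall>\<^sub>F y in nhds x. dist y x < 1 / real ?p ^ k"
        using pos eventually_nhds_metric by blast
      then have "\<forall>\<^sub>F n in filtercomap of_nat (nhds x). dist (of_nat n) x < 1 / real ?p ^ k"
        by (rule eventually_filtercomapI)
      then have "\<forall>\<^sub>F n in filtercomap of_nat (nhds x). dist (morita_nat n) L < e"
        by eventually_elim (use lim k in \<open>auto simp: dist_padic_def intro: le_less_trans\<close>)
      then show "\<forall>\<^sub>F n in ?F. dist (morita_nat n) L < e"
        by (rule filter_leD[OF inf_le1])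
    qed
    moreover have "?F \<noteq> bot"
    proof
      assume "?F = bot"
      then have "eventually (\<lambda>_. False) ?F" by simp
      then have "\<forall>\<^sub>F n in filtercomap of_nat (nhds x). \<not> (n > (0 :: nat))"
        by (simp add: eventually_inf_principal)
      then obtain P where P: "eventually P (nhds x)" "\<And>n. P (of_nat n) \<Longrightarrow> n = 0"
        by (auto simp: eventually_filtercomap)
      \<comment> \<open>Adding \<open>p ^ n\<close> makes the approximating naturals positive
        without changing their limit, so the filter is proper.\<close>
      have "(\<lambda>n. of_nat (g n) + of_nat ?p ^ n) \<longlonglongrightarrow> x + 0"
        by (intro tendsto_add g tendsto_card_power)
      then have "(\<lambda>n. of_nat (g n + ?p ^ n)) \<longlonglongrightarrow> x" by simp
      then have "\<forall>\<^sub>F n in sequentially. P (of_nat (g n + ?p ^ n))"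
        using P(1) by (simp add: filterlim_iff)
      then obtain n where "P (of_nat (g n + ?p ^ n))"
        by (auto simp: eventually_sequentially)
      then have "g n + ?p ^ n = 0" by (rule P(2))
      then show False by simp
    qed
    ultimately have "Lim ?F morita_nat = L" by (intro tendsto_Lim)
    with False show ?thesis by (simp add: morita_Gamma_def)
  qed
  with L show ?thesis by simp
qed

section \<open>The matrix of the Frobenius operator\<close>

text \<open>For an odd prime \<open>p\<close> and the polynomial variable \<open>z\<close> this is
  \<open>(1 - (1 - z) ^ p - z ^ p) / p\<close>. Its terms have degrees between 1 and
  \<open>p - 1\<close>; both ends are used.\<close>

definition frob_rem :: "nat \<Rightarrow> int poly" where
  "frob_rem p = (\<Sum>i=1..<p. monom (- ((-1) ^ i) * int ((p choose i) div p)) i)"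

lemma coeff_frob_rem:
  "coeff (frob_rem p) n = (if 1 \<le> n \<and> n < p then - ((-1) ^ n) * int ((p choose n) div p) else 0)"
  unfolding frob_rem_def coeff_sum coeff_monom
  by (subst sum.delta) auto

lemma frob_rem:
  assumes p: "prime p" "odd p"
  shows "1 - [:1, -1:] ^ p = monom 1 p + smult (int p) (frob_rem p)"
proof (rule poly_eqI)
  fix n
  have "p > 0" using p(1) by (simp add: prime_gt_0_nat)
  have c: "coeff ([:1, -1:] ^ p) n = (-1) ^ n * int (p choose n)"
  proof (cases "n \<le> p")
    case False
    then show ?thesis by (simp add: coeff_eq_0 degree_linear_power)
  qed (simp add: coeff_linear_poly_power)
  show "coeff (1 - [:1, -1:] ^ p) n = coeff (monom 1 p + smult (int p) (frob_rem p)) n"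
  proof (cases "1 \<le> n \<and> n < p")
    case True
    then have "p dvd p choose n" using p by (intro dvd_choose_prime) auto
    then have "int p * int ((p choose n) div p) = int (p choose n)"
      by (metis dvd_mult_div_cancel of_nat_mult)
    with True show ?thesis by (simp add: c coeff_frob_rem coeff_1 mult.left_commute)
  next
    case False
    then consider "n = 0" | "n = p" | "n > p" by linarith
    then show ?thesis using c p \<open>p > 0\<close>
      by cases (auto simp: coeff_frob_rem coeff_1)
  qed
qed

lemma degree_frob_rem: "degree (frob_rem p) \<le> p - 1"
  by (rule degree_le) (auto simp: coeff_frob_rem)

text \<open>Vanishing in low degree yields the decay of the matrix entries; vanishing in high degree
  makes their defining sum finite with a range independent of \<open>M\<close>.\<close>

lemma coeff_mult_frob_rem_power_eq_0:
  assumes "n < \<mu> \<or> c + (p - 1) * \<mu> < n"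
  shows "coeff ([:1, -1:] ^ c * frob_rem p ^ \<mu>) n = 0"
  using assms
proof
  assume n: "n < \<mu>"
  have "coeff (frob_rem p) 0 = 0" by (simp add: coeff_frob_rem)
  then obtain V where "frob_rem p = pCons 0 V" by (cases "frob_rem p") auto
  then have "frob_rem p = monom 1 1 * V" by (simp add: monom_altdef)
  then have "[:1, -1:] ^ c * frob_rem p ^ \<mu> = monom 1 \<mu> * ([:1, -1:] ^ c * V ^ \<mu>)"
    by (simp add: power_mult_distrib monom_power mult.left_commute)
  then show ?thesis using n by (simp only: coeff_monom_mult) auto
next
  assume n: "c + (p - 1) * \<mu> < n"
  have "degree ([:1, -1:] ^ c * frob_rem p ^ \<mu>) \<le> degree ([:1, -1 :: int:] ^ c) + degree (frob_rem p ^ \<mu>)"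
    by (rule degree_mult_le)
  also have "degree ([:1, -1 :: int:] ^ c) \<le> c" by (simp add: degree_power_eq)
  also have "degree (frob_rem p ^ \<mu>) \<le> degree (frob_rem p) * \<mu>" by (rule degree_power_le)
  also have "\<dots> \<le> (p - 1) * \<mu>" by (intro mult_right_mono degree_frob_rem) simp
  finally show ?thesis using n by (intro coeff_eq_0) simp
qed

text \<open>
  For \<open>x = M\<close> a natural number, \<open>frob_mat m c x k l\<close> is the coefficient of \<open>z ^ (m + p M + l)\<close>
  in \<open>(1 - z) ^ c * (1 - (1 - z) ^ p) ^ (M + k)\<close>; writing \<open>1 - (1 - z) ^ p\<close> as \<open>z ^ p\<close> plus
  \<open>p * frob_rem p\<close> makes this coefficient a polynomial in \<open>M\<close>.
\<close>

definition frob_mat :: "nat \<Rightarrow> nat \<Rightarrow> 'p :: prime_card padic \<Rightarrow> nat \<Rightarrow> nat \<Rightarrow> 'p padic" where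
  "frob_mat m c x k l = (\<Sum>\<mu>\<le>c + CARD('p) * k.
     ((x + of_nat k) gchoose \<mu>) * of_nat CARD('p) ^ \<mu> *
     (if CARD('p) * k \<le> m + l + CARD('p) * \<mu>
      then of_int (coeff ([:1, -1:] ^ c * frob_rem CARD('p) ^ \<mu>) (m + l + CARD('p) * \<mu> - CARD('p) * k))
      else 0))"

text \<open>With \<open>x = 1 - z\<close> this is \<open>x ^ c * (1 - x ^ p) ^ n\<close>: the image
  of \<open>(1 - x) ^ n\<close> under \<open>x \<mapsto> x ^ p\<close>, twisted by
  \<open>x ^ c\<close>.\<close>

definition frob_poly :: "nat \<Rightarrow> nat \<Rightarrow> nat \<Rightarrow> int poly" where
  "frob_poly p c n = [:1, -1:] ^ c * (1 - [:1, -1:] ^ p) ^ n"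

lemma frob_mat_of_nat:
  assumes "odd CARD('p)"
  shows "frob_mat m c (of_nat M :: 'p :: prime_card padic) k l =
           of_int (coeff (frob_poly CARD('p) c (M + k)) (m + CARD('p) * M + l))"
proof -
  let ?p = "CARD('p)" and ?n = "M + k" and ?e = "m + CARD('p) * M + l"
  define g where "g \<mu> = (if ?p * k \<le> m + l + ?p * \<mu>
      then coeff ([:1, -1:] ^ c * frob_rem ?p ^ \<mu>) (m + l + ?p * \<mu> - ?p * k) else 0)" for \<mu>
  define t where "t \<mu> = int (?n choose \<mu>) * int ?p ^ \<mu> * g \<mu>" for \<mu>
  have p: "prime ?p" by (rule prime_card)
  have "frob_poly ?p c ?n = [:1, -1:] ^ c * (smult (int ?p) (frob_rem ?p) + monom 1 ?p) ^ ?n"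
    by (simp add: frob_poly_def frob_rem[OF p assms] add.commute)
  also have "\<dots> = (\<Sum>\<mu>\<le>?n. smult (int (?n choose \<mu>) * int ?p ^ \<mu>)
      (monom 1 (?p * (?n - \<mu>)) * ([:1, -1:] ^ c * frob_rem ?p ^ \<mu>)))"
    by (simp add: binomial_ring sum_distrib_left monom_power smult_power of_nat_poly mult_ac)
  also have "coeff \<dots> ?e = (\<Sum>\<mu>\<le>?n. t \<mu>)"
    unfolding coeff_sum
  proof (rule sum.cong)
    fix \<mu> assume "\<mu> \<in> {..?n}"
    then have eq: "?p * (?n - \<mu>) + ?p * \<mu> = ?p * M + ?p * k"
      by (simp flip: distrib_left)
    then have "?p * (?n - \<mu>) \<le> ?e \<longleftrightarrow> ?p * k \<le> m + l + ?p * \<mu>" by linarith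
    moreover have "?e - ?p * (?n - \<mu>) = m + l + ?p * \<mu> - ?p * k" using eq by linarith
    ultimately show "coeff (smult (int (?n choose \<mu>) * int ?p ^ \<mu>)
        (monom 1 (?p * (?n - \<mu>)) * ([:1, -1:] ^ c * frob_rem ?p ^ \<mu>))) ?e = t \<mu>"
      by (simp add: coeff_monom_mult t_def g_def)
  qed simp
  \<comment> \<open>The binomial theorem gives the range \<open>\<mu> \<le> M + k\<close>. Beyond it
    the binomial coefficients vanish, and beyond \<open>c + p * k\<close> the degree bound applies,
    so the range can be freed from \<open>M\<close>.\<close>
  also have "\<dots> = (\<Sum>\<mu>\<le>max ?n (c + ?p * k). t \<mu>)"
    by (rule sum.mono_neutral_left) (auto simp: t_def)
  also have "\<dots> = (\<Sum>\<mu>\<le>c + ?p * k. t \<mu>)"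
  proof (rule sum.mono_neutral_right)
    show "\<forall>\<mu>\<in>{..max ?n (c + ?p * k)} - {..c + ?p * k}. t \<mu> = 0"
    proof
      fix \<mu> assume "\<mu> \<in> {..max ?n (c + ?p * k)} - {..c + ?p * k}"
      then have \<mu>: "c + ?p * k < \<mu>" by auto
      have "(?p - 1) * \<mu> + \<mu> = ?p * \<mu>"
        using prime_gt_0_nat[OF p] by (simp add: algebra_simps)
      then have "c + (?p - 1) * \<mu> < m + l + ?p * \<mu> - ?p * k" using \<mu> by linarith
      then show "t \<mu> = 0" by (simp add: t_def g_def coeff_mult_frob_rem_power_eq_0)
    qed
  qed auto
  finally have "of_int (coeff (frob_poly ?p c ?n) ?e) = (of_int (\<Sum>\<mu>\<le>c + ?p * k. t \<mu>) :: 'p padic)"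
    by (rule arg_cong)
  also have "\<dots> = frob_mat m c (of_nat M) k l"
    unfolding frob_mat_def of_int_sum
  proof (rule sum.cong)
    fix \<mu>
    have "(of_nat M + of_nat k gchoose \<mu>) = (of_nat (?n choose \<mu>) :: 'p padic)"
      by (simp add: binomial_gbinomial)
    then show "of_int (t \<mu>) = (of_nat M + of_nat k gchoose \<mu>) * of_nat ?p ^ \<mu> *
        (if ?p * k \<le> m + l + ?p * \<mu>
         then of_int (coeff ([:1, -1:] ^ c * frob_rem ?p ^ \<mu>) (m + l + ?p * \<mu> - ?p * k))
         else 0 :: 'p padic)"
      by (simp add: t_def g_def)
  qed simp
  finally show ?thesis ..
qed

lemma tendsto_gbinomial_padic:
  assumes "(f \<longlongrightarrow> (x :: 'p :: prime_card padic)) F"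
  shows "((\<lambda>n. f n gchoose k) \<longlongrightarrow> x gchoose k) F"
  unfolding gbinomial_prod_rev
  by (intro tendsto_divide_padic tendsto_prod' tendsto_diff assms tendsto_const) simp

lemma tendsto_frob_mat:
  assumes "(f \<longlongrightarrow> x) F"
  shows "((\<lambda>n. frob_mat m c (f n) k l) \<longlongrightarrow> frob_mat m c x k l) F"
  unfolding frob_mat_def
  by (intro tendsto_sum tendsto_mult tendsto_gbinomial_padic tendsto_add assms tendsto_const)

text \<open>At natural arguments the values are integers; the bound survives in the limit.\<close>

lemma padic_abs_gbinomial_le_1:
  assumes "(\<lambda>n. of_nat (g n)) \<longlonglongrightarrow> (x :: 'p :: prime_card padic)"
  shows "padic_abs (x gchoose k) \<le> 1"
proof (rule Lim_bounded)
  show "(\<lambda>n. padic_abs (of_nat (g n) gchoose k :: 'p padic)) \<longlonglongrightarrow> padic_abs (x gchoose k)"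
    by (intro tendsto_padic_abs tendsto_gbinomial_padic assms)
  show "\<forall>n\<ge>0. padic_abs (of_nat (g n) gchoose k :: 'p padic) \<le> 1"
    by (simp flip: binomial_gbinomial)
qed

text \<open>A summand carries \<open>p ^ \<mu>\<close>. For \<open>\<mu> < k\<close> it vanishes: by
  \<open>l \<le> k\<close> and \<open>m < p - 1\<close> the coefficient asked for lies below degree
  \<open>\<mu>\<close>, where \<open>frob_rem ^ \<mu>\<close> has no terms.\<close>

lemma padic_abs_frob_mat_le:
  fixes x :: "'p :: prime_card padic"
  assumes odd: "odd CARD('p)" and g: "(\<lambda>n. of_nat (g n)) \<longlonglongrightarrow> x"
    and m: "m = (CARD('p) - 1) div 2" and l: "l \<le> k"
  shows "padic_abs (frob_mat m c x k l) \<le> 1 / real CARD('p) ^ k"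
  unfolding frob_mat_def
proof (rule padic_abs_sum_le)
  let ?p = "CARD('p)"
  fix \<mu>
  define a :: "'p padic" where "a = (if ?p * k \<le> m + l + ?p * \<mu>
      then of_int (coeff ([:1, -1:] ^ c * frob_rem ?p ^ \<mu>) (m + l + ?p * \<mu> - ?p * k)) else 0)"
  have "(\<lambda>n. of_nat (g n + k)) \<longlonglongrightarrow> x + of_nat k"
    using tendsto_add[OF g tendsto_const[of "of_nat k"]] by simp
  then have gb: "padic_abs (x + of_nat k gchoose \<mu>) \<le> 1" by (rule padic_abs_gbinomial_le_1)
  have a1: "padic_abs a \<le> 1" by (simp add: a_def)
  have a0: "a = 0" if "\<mu> < k"
  proof -
    have p: "?p \<ge> 3" using odd prime_ge_2_nat[OF prime_card[where 'a = 'p]]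
      by (cases "?p = 2") auto
    have "?p * \<mu> + ?p \<le> ?p * k" using that by (metis Suc_leI mult_Suc_right add.commute mult_le_mono2)
    moreover have "?p * k = k + (?p - 1) * k" "?p * \<mu> = \<mu> + (?p - 1) * \<mu>"
      using p by (simp_all add: algebra_simps)
    moreover have "(?p - 1) * \<mu> + (?p - 1) \<le> (?p - 1) * k"
      using that by (metis Suc_leI mult_Suc_right add.commute mult_le_mono2)
    moreover have "m < ?p - 1" using p m by simp
    ultimately have "m + l + ?p * \<mu> < ?p * k + \<mu>" using l by linarith
    then have "?p * k \<le> m + l + ?p * \<mu> \<Longrightarrow> m + l + ?p * \<mu> - ?p * k < \<mu>" by linarith
    then show ?thesis by (simp add: a_def coeff_mult_frob_rem_power_eq_0)
  qed
  show "padic_abs ((x + of_nat k gchoose \<mu>) * of_nat ?p ^ \<mu> * (if ?p * k \<le> m + l + ?p * \<mu>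
      then of_int (coeff ([:1, -1:] ^ c * frob_rem ?p ^ \<mu>) (m + l + ?p * \<mu> - ?p * k)) else 0))
      \<le> 1 / real ?p ^ k"
    unfolding a_def[symmetric]
  proof (cases "\<mu> < k")
    case False
    have "padic_abs ((x + of_nat k gchoose \<mu>) * of_nat ?p ^ \<mu> * a) \<le> 1 * (1 / real ?p ^ \<mu>) * 1"
      by (intro padic_abs_mult_le gb a1) (simp add: padic_abs_power padic_abs_card power_divide)
    also have "\<dots> \<le> 1 / real ?p ^ k"
      using False card_gt_1[where 'p = 'p] by (simp add: divide_left_mono power_increasing)
    finally show "padic_abs ((x + of_nat k gchoose \<mu>) * of_nat ?p ^ \<mu> * a) \<le> 1 / real ?p ^ k" .
  qed (simp add: a0)
qed simp

section \<open>The differential equation behind the matrix\<close>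

text \<open>Logarithmic differentiation; writing \<open>x ^ p = 1 - (1 - x ^ p)\<close> expresses
  the result by the neighbouring exponents \<open>n - 1\<close> and \<open>n\<close>, that is, by
  two rows of the matrix.\<close>

lemma frob_poly_ode:
  assumes "n > 0"
  shows "[:1, -1:] * pderiv (frob_poly p c n) =
    smult (int n * int p) (frob_poly p c (n - 1) - frob_poly p c n) - smult (int c) (frob_poly p c n)"
proof -
  let ?X = "[:1, -1 :: int:]"
  have pow: "?X * pderiv (?X ^ i) = - smult (int i) (?X ^ i)" for i
  proof (cases i)
    case (Suc j)
    have "pderiv ?X = - 1" by (simp add: pderiv_pCons one_pCons)
    then show ?thesis by (simp add: Suc pderiv_power_Suc del: power_Suc) (simp add: mult_ac)
  qed simp
  obtain n' where n': "n = Suc n'" using assms by (cases n) auto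
  have Y: "?X * pderiv (1 - ?X ^ p) = smult (int p) (?X ^ p)"
    using pow[of p] by (simp add: pderiv_diff)
  have "?X * pderiv (frob_poly p c n) =
      (?X * pderiv (?X ^ c)) * (1 - ?X ^ p) ^ n +
      ?X ^ c * smult (int n) ((1 - ?X ^ p) ^ n' * (?X * pderiv (1 - ?X ^ p)))"
    by (simp add: frob_poly_def pderiv_mult n' pderiv_power_Suc algebra_simps del: power_Suc)
  also have "\<dots> = - smult (int c) (frob_poly p c n) +
      smult (int n * int p) (?X ^ c * ((1 - ?X ^ p) ^ n' * ?X ^ p))"
    by (simp only: pow Y) (simp add: frob_poly_def algebra_simps)
  also have "?X ^ c * ((1 - ?X ^ p) ^ n' * ?X ^ p) = frob_poly p c (n - 1) - frob_poly p c n"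
    by (simp add: frob_poly_def n' algebra_simps)
  finally show ?thesis by simp
qed

lemma coeff_frob_poly_rec:
  assumes "n > 0"
  shows "(int e + 1) * coeff (frob_poly p c n) (Suc e) - int e * coeff (frob_poly p c n) e =
    int n * int p * (coeff (frob_poly p c (n - 1)) e - coeff (frob_poly p c n) e) -
    int c * coeff (frob_poly p c n) e"
proof -
  let ?P = "frob_poly p c n"
  have "coeff ([:1, -1:] * pderiv ?P) e = (int e + 1) * coeff ?P (Suc e) - int e * coeff ?P e"
    by (cases e) (simp_all add: coeff_pderiv algebra_simps)
  moreover have "coeff ([:1, -1:] * pderiv ?P) e =
      int n * int p * (coeff (frob_poly p c (n - 1)) e - coeff ?P e) - int c * coeff ?P e"
    by (simp only: frob_poly_ode[OF assms] coeff_diff coeff_smult)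
  ultimately show ?thesis by metis
qed

text \<open>The Frobenius operator commutes with the twisted derivation, up to a factor \<open>p\<close>.\<close>

lemma frob_mat_rec:
  fixes x :: "'p :: prime_card padic"
  assumes odd: "odd CARD('p)" and g: "(\<lambda>n. of_nat (g n)) \<longlonglongrightarrow> x"
  shows "(of_nat m + of_nat CARD('p) * x + of_nat l + 1) * frob_mat m c x (Suc k) (Suc l) -
     (of_nat m + of_nat CARD('p) * x + of_nat l) * frob_mat m c x (Suc k) l =
     (x + of_nat (Suc k)) * of_nat CARD('p) * (frob_mat m c x k l - frob_mat m c x (Suc k) l) -
     of_nat c * frob_mat m c x (Suc k) l" (is "?L x = ?R x")
proof -
  let ?p = "CARD('p)"
  have "?L (of_nat M) = ?R (of_nat M)" for M
  proof -
    let ?e = "m + ?p * M + l"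
    have "(of_int ((int ?e + 1) * coeff (frob_poly ?p c (M + Suc k)) (Suc ?e) -
          int ?e * coeff (frob_poly ?p c (M + Suc k)) ?e) :: 'p padic) =
        of_int (int (M + Suc k) * int ?p *
          (coeff (frob_poly ?p c (M + Suc k - 1)) ?e - coeff (frob_poly ?p c (M + Suc k)) ?e) -
          int c * coeff (frob_poly ?p c (M + Suc k)) ?e)"
      by (subst coeff_frob_poly_rec) simp_all
    then show ?thesis by (simp add: frob_mat_of_nat[OF odd])
  qed
  moreover have "(\<lambda>n. ?L (of_nat (g n))) \<longlonglongrightarrow> ?L x" "(\<lambda>n. ?R (of_nat (g n))) \<longlonglongrightarrow> ?R x"
    by (intro tendsto_intros tendsto_frob_mat g)+
  ultimately show ?thesis by (simp add: LIMSEQ_unique)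
qed

section \<open>The trace of the Frobenius operator\<close>

text \<open>A tail is bounded by its largest term. Used with a bound uniform in an auxiliary
  parameter, this lets limits be exchanged.\<close>

lemma padic_abs_partial_sum_le:
  fixes f :: "nat \<Rightarrow> 'p :: prime_card padic"
  assumes lim: "(\<lambda>n. \<Sum>k<n. f k) \<longlonglongrightarrow> L" and b: "\<And>k. k \<ge> I \<Longrightarrow> padic_abs (f k) \<le> b" "b \<ge> 0"
  shows "padic_abs ((\<Sum>k<I. f k) - L) \<le> b"
proof (rule Lim_bounded)
  show "(\<lambda>n. padic_abs ((\<Sum>k<I. f k) - (\<Sum>k<n. f k))) \<longlonglongrightarrow> padic_abs ((\<Sum>k<I. f k) - L)"
    by (intro tendsto_padic_abs tendsto_diff tendsto_const lim)
  show "\<forall>n\<ge>I. padic_abs ((\<Sum>k<I. f k) - (\<Sum>k<n. f k)) \<le> b"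
  proof (intro allI impI)
    fix n assume "n \<ge> I"
    then have "(\<Sum>k<n. f k) - (\<Sum>k<I. f k) = (\<Sum>k\<in>{I..<n}. f k)"
      using sum_diff_nat_ivl[of 0 I n f] by (simp add: lessThan_atLeast0)
    moreover have "padic_abs (\<Sum>k\<in>{I..<n}. f k) \<le> b"
      by (intro padic_abs_sum_le b) simp_all
    ultimately show "padic_abs ((\<Sum>k<I. f k) - (\<Sum>k<n. f k)) \<le> b"
      by (subst padic_abs_diff_commute) simp
  qed
qed

text \<open>At most \<open>n\<close> of the \<open>I\<close> factors can contribute a positive
  degree to the coefficient of index \<open>n\<close>; the others contribute the constant term, of
  size at most \<open>1 / p\<close>.\<close>

lemma padic_abs_fps_power_nth_le:
  fixes q :: "'p :: prime_card padic fps"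
  assumes 0: "padic_abs (fps_nth q 0) \<le> 1 / real CARD('p)" and 1: "\<And>n. padic_abs (fps_nth q n) \<le> 1"
  shows "padic_abs (fps_nth (q ^ I) n) \<le> real CARD('p) ^ n / real CARD('p) ^ I"
proof (induction I arbitrary: n)
  case 0
  show ?case by (simp add: fps_one_nth)
next
  case (Suc I)
  let ?p = "real CARD('p)"
  have "fps_nth (q ^ Suc I) n = (\<Sum>i=0..n. fps_nth q i * fps_nth (q ^ I) (n - i))"
    by (simp add: fps_mult_nth)
  also have "padic_abs \<dots> \<le> ?p ^ n / ?p ^ Suc I"
  proof (rule padic_abs_sum_le)
    fix i assume i: "i \<in> {0..n}"
    show "padic_abs (fps_nth q i * fps_nth (q ^ I) (n - i)) \<le> ?p ^ n / ?p ^ Suc I"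
    proof (cases i)
      case 0
      then show ?thesis using padic_abs_mult_le[OF assms(1) Suc[of n]] by (simp add: mult.commute)
    next
      case (Suc i')
      have "padic_abs (fps_nth q i * fps_nth (q ^ I) (n - i)) \<le> 1 * (?p ^ (n - i) / ?p ^ I)"
        by (intro padic_abs_mult_le 1 Suc.IH)
      also have "\<dots> = ?p ^ Suc (n - i) / ?p ^ Suc I" by simp
      also have "\<dots> \<le> ?p ^ n / ?p ^ Suc I"
        using i Suc card_gt_1[where 'p = 'p]
        by (intro divide_right_mono power_increasing) auto
      finally show ?thesis .
    qed
  qed simp
  finally show ?case .
qed

text \<open>
  With \<open>x = 1 - X\<close> and \<open>q = (1 - x ^ p) / (1 - x)\<close>, the geometric series of \<open>q\<close> is
  \<open>1 / (1 - q) = (1 - x) / (x ^ p - x)\<close>, whose poles are at the Teichmueller representatives.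
\<close>

lemma frob_geometric_sum:
  fixes c I :: nat
  defines "x \<equiv> 1 - fps_X :: 'p :: prime_card padic fps"
  defines "q \<equiv> (\<Sum>i<CARD('p). x ^ i)"
  assumes c: "0 < c" "c < CARD('p)" and A: "A > 0"
  shows "padic_abs (of_nat (CARD('p) - 1) * fps_nth (x ^ c * (\<Sum>i<I. q ^ i)) A -
    (\<Sum>t\<in>- {0, 1}. teichmuller (t :: 'p mod_ring) ^ c * inverse (1 - teichmuller t) ^ A))
    \<le> real CARD('p) ^ A / real CARD('p) ^ I"
proof -
  let ?p = "CARD('p)"
  let ?T = "teichmuller :: 'p mod_ring \<Rightarrow> 'p padic"
  have p: "?p \<ge> 2" using prime_ge_2_nat[OF prime_card] .
  obtain c' where c': "c = Suc c'" using c by (cases c) auto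
  obtain p' where p': "?p = Suc p'" "p' > 0" using p by (cases ?p) auto
  define Y where "Y = x ^ c * (\<Sum>i<I. q ^ i)"
  \<comment> \<open>For \<open>\<tau> ^ p' = 1\<close> the series \<open>E \<tau>\<close> is
    \<open>(1 - x ^ p') / (\<tau> - x)\<close>, and \<open>R \<rho>\<close> is
    \<open>1 / (fps_X - \<rho>)\<close>. Hence \<open>W\<close> is the partial fraction form of
    \<open>fps_X * p' * x ^ c' / (1 - x ^ p')\<close>; its summand 1 belongs to the pole at
    \<open>t = 1\<close>.\<close>
  define E where "E \<tau> = (\<Sum>i<p'. fps_const (\<tau> ^ (p' - Suc i)) * x ^ i)" for \<tau> :: "'p padic"
  define R where "R \<rho> = Abs_fps (\<lambda>n. - (inverse \<rho> ^ Suc n))" for \<rho> :: "'p padic"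
  define W where "W = 1 + (\<Sum>t\<in>- {0, 1}. fps_const (?T t ^ c) * (fps_X * R (1 - ?T t)))"
  have E: "(fps_const \<tau> - x) * E \<tau> = 1 - x ^ p'" if "\<tau> ^ p' = 1" for \<tau>
  proof -
    have "x ^ p' - fps_const \<tau> ^ p' = (x - fps_const \<tau>) * (\<Sum>i<p'. fps_const \<tau> ^ (p' - Suc i) * x ^ i)"
      by (rule power_diff_sumr2)
    then show ?thesis using that
      by (simp add: E_def fps_const_power algebra_simps)
  qed
  have T1: "?T t ^ p' = 1" if "t \<noteq> 0" for t
    using teichmuller_power_card_minus_1[OF that] p' by simp
  have R: "(fps_X - fps_const \<rho>) * R \<rho> = 1" if "\<rho> \<noteq> 0" for \<rho>
  proof (rule fps_ext)
    fix n
    show "fps_nth ((fps_X - fps_const \<rho>) * R \<rho>) n = fps_nth 1 n"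
      using that by (cases n) (simp_all add: R_def left_diff_distrib)
  qed
  have ne: "1 - ?T t \<noteq> 0" if "t \<noteq> 1" for t
    using that inj_teichmuller by (metis eq_iff_diff_eq_0 injD teichmuller_1)
  have E1: "fps_X * E 1 = 1 - x ^ p'" using E[of 1] by (simp add: x_def)
  \<comment> \<open>The series \<open>1 - x ^ p'\<close> has constant term 0 and is not invertible;
    being nonzero, it can still be cancelled.\<close>
  have "fps_nth (E 1) 0 = of_nat p'"
    by (simp add: E_def x_def fps_sum_nth fps_power_zeroth)
  then have "E 1 \<noteq> 0" using p' by auto
  then have nz: "1 - x ^ p' \<noteq> 0" unfolding E1[symmetric] by simp
  have ER: "E (?T t) = (1 - x ^ p') * R (1 - ?T t)" if "t \<noteq> 0" "t \<noteq> 1" for t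
  proof -
    have "fps_const (?T t) - x = fps_X - fps_const (1 - ?T t)"
      by (simp add: x_def flip: fps_const_sub)
    then have "(1 - x ^ p') * R (1 - ?T t) = (fps_X - fps_const (1 - ?T t)) * E (?T t) * R (1 - ?T t)"
      using E[OF T1[OF that(1)]] by simp
    also have "\<dots> = E (?T t) * ((fps_X - fps_const (1 - ?T t)) * R (1 - ?T t))"
      by (simp only: mult_ac)
    finally show ?thesis unfolding R[OF ne[OF that(2)]] by simp
  qed
  \<comment> \<open>Orthogonality of the powers of the Teichmueller character singles out the
    exponent \<open>c'\<close>.\<close>
  have sumE: "of_nat p' * x ^ c' = (\<Sum>t\<in>- {0}. fps_const (?T t ^ c) * E (?T t))"
  proof -
    have *: "(\<Sum>t\<in>- {0}. ?T t ^ (c + (p' - Suc i))) = (if i = c' then of_nat p' else 0)" if "i < p'" for i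
    proof (cases "i = c'")
      case True
      with that c' have "c + (p' - Suc i) = p'" by simp
      then have "(\<Sum>t\<in>- {0}. ?T t ^ (c + (p' - Suc i))) = (\<Sum>t\<in>- {0 :: 'p mod_ring}. 1)"
        by (intro sum.cong) (auto simp: T1)
      then show ?thesis using True p' by (simp add: Compl_eq_Diff_UNIV)
    next
      case False
      have "\<not> p' dvd c + (p' - Suc i)"
      proof
        assume "p' dvd c + (p' - Suc i)"
        then obtain d where d: "c + (p' - Suc i) = p' * d" by (elim dvdE)
        have "0 < c + (p' - Suc i)" "c + (p' - Suc i) < p' * 2" using c p' that by auto
        then have "0 < d" "d < 2" unfolding d by (auto intro: Nat.gr0I)
        then have "d = 1" by simp
        with d False that c' show False by simp
      qed
      then show ?thesis using False sum_teichmuller_power[where 'p = 'p, of "c + (p' - Suc i)"] p' by simp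
    qed
    have "(\<Sum>t\<in>- {0}. fps_const (?T t ^ c) * E (?T t)) =
        (\<Sum>t\<in>- {0}. \<Sum>i<p'. fps_const (?T t ^ (c + (p' - Suc i))) * x ^ i)"
      unfolding E_def sum_distrib_left
      by (intro sum.cong refl) (simp only: power_add fps_const_mult[symmetric] mult.assoc)
    also have "\<dots> = (\<Sum>i<p'. \<Sum>t\<in>- {0}. fps_const (?T t ^ (c + (p' - Suc i))) * x ^ i)"
      by (rule sum.swap)
    also have "\<dots> = (\<Sum>i<p'. fps_const (\<Sum>t\<in>- {0}. ?T t ^ (c + (p' - Suc i))) * x ^ i)"
    proof (rule sum.cong)
      fix i
      have "fps_const (\<Sum>t\<in>- {0}. ?T t ^ n) = (\<Sum>t\<in>- {0}. fps_const (?T t ^ n))" for n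
        by (rule fps_ext) (simp add: fps_sum_nth)
      then show "(\<Sum>t\<in>- {0}. fps_const (?T t ^ (c + (p' - Suc i))) * x ^ i) =
          fps_const (\<Sum>t\<in>- {0}. ?T t ^ (c + (p' - Suc i))) * x ^ i"
        by (simp add: sum_distrib_right)
    qed simp
    also have "\<dots> = (\<Sum>i<p'. if i = c' then of_nat p' * x ^ c' else 0)"
    proof (rule sum.cong)
      fix i assume "i \<in> {..<p'}"
      then have i: "i < p'" by simp
      show "fps_const (\<Sum>t\<in>- {0}. ?T t ^ (c + (p' - Suc i))) * x ^ i =
          (if i = c' then of_nat p' * x ^ c' else 0)"
        unfolding *[OF i] by (simp add: fps_of_nat)
    qed simp
    also have "\<dots> = of_nat p' * x ^ c'" using c c' p' by simp
    finally show ?thesis ..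
  qed
  have W: "fps_X * (of_nat p' * x ^ c') = (1 - x ^ p') * W"
  proof -
    have "- {0 :: 'p mod_ring} = insert 1 (- {0, 1})" by auto
    then have "fps_X * (of_nat p' * x ^ c') = fps_X * E 1 +
        (\<Sum>t\<in>- {0, 1}. fps_X * (fps_const (?T t ^ c) * E (?T t)))"
      unfolding sumE by (simp add: distrib_left sum_distrib_left)
    also have "(\<Sum>t\<in>- {0, 1}. fps_X * (fps_const (?T t ^ c) * E (?T t))) =
        (1 - x ^ p') * (\<Sum>t\<in>- {0, 1}. fps_const (?T t ^ c) * (fps_X * R (1 - ?T t)))"
      unfolding sum_distrib_left by (intro sum.cong) (auto simp: ER mult_ac)
    finally show ?thesis unfolding E1 W_def by (simp add: distrib_left)
  qed
  have "fps_X * q = 1 - x ^ ?p"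
    using one_diff_power_eq[of x ?p] unfolding q_def by (simp add: x_def)
  then have q: "fps_X * (1 - q) = x * (x ^ p' - 1)"
    by (simp add: p' x_def algebra_simps)
  have "(1 - q) * Y = x ^ c * (1 - q ^ I)"
    using one_diff_power_eq[of q I] unfolding Y_def by (simp add: mult_ac)
  then have "x * (x ^ p' - 1) * Y = fps_X * (x ^ c * (1 - q ^ I))"
    unfolding q[symmetric] by (simp add: mult.assoc)
  then have "x * ((x ^ p' - 1) * Y) = x * (fps_X * x ^ c' * (1 - q ^ I))"
    by (simp add: c' mult_ac)
  moreover have x: "x \<noteq> 0"
  proof
    assume "x = 0"
    then have "fps_nth x 0 = 0" by simp
    then show False by (simp add: x_def)
  qed
  ultimately have xY: "(x ^ p' - 1) * Y = fps_X * x ^ c' * (1 - q ^ I)"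
    unfolding mult_left_cancel[OF x] by simp
  have "(1 - x ^ p') * (of_nat p' * Y) = - (of_nat p' * ((x ^ p' - 1) * Y))"
    by (simp add: algebra_simps)
  also have "\<dots> = - (of_nat p' * (fps_X * x ^ c' * (1 - q ^ I)))" by (simp only: xY)
  also have "\<dots> = - ((fps_X * (of_nat p' * x ^ c')) * (1 - q ^ I))" by (simp only: mult_ac)
  also have "\<dots> = (1 - x ^ p') * - (W * (1 - q ^ I))" unfolding W by (simp only: mult_ac mult_minus_right)
  finally have Y: "of_nat p' * Y = - (W * (1 - q ^ I))" unfolding mult_left_cancel[OF nz] .
  have WA: "fps_nth W A = - (\<Sum>t\<in>- {0, 1}. ?T t ^ c * inverse (1 - ?T t) ^ A)"
    using A by (cases A) (simp_all add: W_def fps_sum_nth R_def sum_negf)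
  have W1: "padic_abs (fps_nth W n) \<le> 1" for n
  proof -
    have "padic_abs (?T t ^ c * inverse (1 - ?T t) ^ n) \<le> 1" if "t \<in> - {0, 1}" for t n
      using that by (simp add: padic_abs_mult padic_abs_power padic_abs_inverse
          padic_abs_one_minus_teichmuller padic_abs_teichmuller)
    then have "padic_abs (\<Sum>t\<in>- {0, 1}. ?T t ^ c * inverse (1 - ?T t) ^ n) \<le> 1" for n
      by (intro padic_abs_sum_le) simp_all
    then show ?thesis
      by (cases n) (simp_all add: W_def fps_sum_nth R_def sum_negf del: power_Suc)
  qed
  have qint: "\<exists>k :: int. fps_nth q n = of_int k" for n
  proof -
    have "q = fps_of_poly (map_poly of_int (\<Sum>i<?p. [:1, -1 :: int:] ^ i))"
    proof -
      have "fps_of_poly (map_poly of_int [:1, -1 :: int:]) = x"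
        by (simp add: x_def fps_of_poly_pCons numeral_eq_Suc)
      then show ?thesis
        by (simp add: q_def fps_of_poly_sum fps_of_poly_power of_int_poly_hom.hom_sum of_int_poly_hom.hom_power)
    qed
    then show ?thesis by (simp add: coeff_map_poly)
  qed
  have qI: "padic_abs (fps_nth (q ^ I) n) \<le> real ?p ^ n / real ?p ^ I" for n
  proof (rule padic_abs_fps_power_nth_le)
    have "fps_nth q 0 = of_nat ?p" by (simp add: q_def x_def fps_sum_nth fps_power_zeroth)
    then show "padic_abs (fps_nth q 0) \<le> 1 / real ?p" by (simp add: padic_abs_card)
    show "padic_abs (fps_nth q n) \<le> 1" for n using qint[of n] by auto
  qed
  \<comment> \<open>Truncating the geometric series at \<open>I\<close> leaves the error
    \<open>W * q ^ I\<close>, which is small because \<open>q\<close> has constant term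
    \<open>p\<close> and \<open>W\<close> has integral coefficients.\<close>
  have "of_nat p' * fps_nth Y A = fps_nth (of_nat p' * Y) A"
    by (simp flip: fps_of_nat)
  also have "\<dots> = - fps_nth W A + fps_nth (W * q ^ I) A"
    unfolding Y by (simp add: algebra_simps)
  finally have "of_nat p' * fps_nth Y A - (\<Sum>t\<in>- {0, 1}. ?T t ^ c * inverse (1 - ?T t) ^ A) =
      (\<Sum>i=0..A. fps_nth W i * fps_nth (q ^ I) (A - i))"
    unfolding WA by (simp add: fps_mult_nth)
  also have "padic_abs \<dots> \<le> real ?p ^ A / real ?p ^ I"
  proof (rule padic_abs_sum_le)
    fix i
    have "padic_abs (fps_nth W i * fps_nth (q ^ I) (A - i)) \<le> 1 * (real ?p ^ (A - i) / real ?p ^ I)"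
      by (intro padic_abs_mult_le W1 qI)
    also have "\<dots> \<le> real ?p ^ A / real ?p ^ I"
      using card_gt_1[where 'p = 'p] by (simp add: divide_right_mono power_increasing)
    finally show "padic_abs (fps_nth W i * fps_nth (q ^ I) (A - i)) \<le> real ?p ^ A / real ?p ^ I" .
  qed simp
  finally show ?thesis using p' by (simp add: Y_def)
qed

text \<open>\<open>1 - (1 - z) ^ p\<close> is divisible by \<open>z\<close>. Cancelling
  \<open>z ^ (M + k)\<close> leaves an index that does not depend on \<open>k\<close>, so the trace
  is one coefficient of a geometric series.\<close>

lemma frob_mat_of_nat_diag:
  assumes odd: "odd CARD('p)"
  shows "frob_mat m c (of_nat M :: 'p :: prime_card padic) k k =
    of_int (coeff ([:1, -1:] ^ c * (\<Sum>i<CARD('p). [:1, -1:] ^ i) ^ (M + k)) (m + (CARD('p) - 1) * M))"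
proof -
  let ?p = "CARD('p)" and ?Q = "\<Sum>i<CARD('p). [:1, -1 :: int:] ^ i"
  have p: "?p \<ge> 1" using prime_ge_1_nat[OF prime_card] .
  have "1 - [:1, -1 :: int:] = monom 1 1" by (simp add: monom_altdef one_pCons)
  then have "1 - [:1, -1 :: int:] ^ ?p = monom 1 1 * ?Q"
    using one_diff_power_eq[of "[:1, -1 :: int:]" ?p] by simp
  then have "frob_poly ?p c (M + k) = monom 1 (M + k) * ([:1, -1:] ^ c * ?Q ^ (M + k))"
    by (simp add: frob_poly_def power_mult_distrib monom_power mult.left_commute)
  moreover have "m + ?p * M + k - (M + k) = m + (?p - 1) * M"
    using p by (simp add: diff_mult_distrib)
  moreover have "M + k \<le> m + ?p * M + k" using p by (simp add: trans_le_add2)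
  ultimately show ?thesis
    by (simp only: frob_mat_of_nat[OF odd] coeff_monom_mult) simp
qed

lemma frob_trace_tendsto:
  assumes odd: "odd CARD('p)" and m: "m > 0" and c: "0 < c" "c < CARD('p)"
  shows "(\<lambda>I. \<Sum>k<I. frob_mat m c (of_nat M :: 'p :: prime_card padic) k k) \<longlonglongrightarrow>
    (\<Sum>t\<in>- {0, 1}. teichmuller (t :: 'p mod_ring) ^ c *
       inverse (1 - teichmuller t) ^ (m + (CARD('p) - 1) * M)) / of_nat (CARD('p) - 1)"
proof -
  let ?p = "CARD('p)"
  define A where "A = m + (?p - 1) * M"
  define x where "x = (1 - fps_X :: 'p padic fps)"
  define q where "q = (\<Sum>i<?p. x ^ i)"
  define J where "J = (\<Sum>t\<in>- {0, 1}. teichmuller (t :: 'p mod_ring) ^ c * inverse (1 - teichmuller t) ^ A)"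
  let ?X = "[:1, -1 :: int:]" and ?Q = "\<Sum>i<CARD('p). [:1, -1 :: int:] ^ i"
  have p2: "?p \<ge> 2" using prime_ge_2_nat[OF prime_card] .
  have degQ: "degree ?Q \<le> ?p - 1"
    by (intro degree_sum_le) (auto simp: degree_linear_power)
  \<comment> \<open>The diagonal supplies only the powers from \<open>M\<close> on. The missing ones
    have too small a degree to reach index \<open>A\<close>, so the geometric series may start at
    0.\<close>
  have small: "coeff (?X ^ c * ?Q ^ i) A = 0" if "i < M" for i
  proof (rule coeff_eq_0)
    have "degree (?X ^ c * ?Q ^ i) \<le> degree (?X ^ c) + degree (?Q ^ i)" by (rule degree_mult_le)
    also have "degree (?X ^ c) = c" by (simp add: degree_linear_power)
    also have "degree (?Q ^ i) \<le> degree ?Q * i" by (rule degree_power_le)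
    also have "\<dots> \<le> (?p - 1) * i" using degQ by simp
    also have "c + (?p - 1) * i \<le> (?p - 1) * Suc i" using c by simp
    also have "\<dots> \<le> (?p - 1) * M" using that by (intro mult_le_mono2) simp
    also have "\<dots> < A" using m by (simp add: A_def)
    finally show "degree (?X ^ c * ?Q ^ i) < A" by simp
  qed
  have emb: "(of_int (coeff (?X ^ c * ?Q ^ i) n) :: 'p padic) = fps_nth (x ^ c * q ^ i) n" for i n
  proof -
    have X: "fps_of_poly (map_poly of_int ?X) = x"
      by (simp add: x_def fps_of_poly_pCons numeral_eq_Suc)
    have "fps_of_poly (map_poly of_int (?X ^ c * ?Q ^ i)) = x ^ c * q ^ i"
      by (simp only: of_int_poly_hom.hom_mult of_int_poly_hom.hom_sum of_int_poly_hom.hom_power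
          fps_of_poly_mult fps_of_poly_sum fps_of_poly_power X q_def)
    from arg_cong[OF this, of "\<lambda>f. fps_nth f n"] show ?thesis by (simp add: coeff_map_poly)
  qed
  have sum: "(\<Sum>k<I. frob_mat m c (of_nat M :: 'p padic) k k) = fps_nth (x ^ c * (\<Sum>i<M + I. q ^ i)) A" for I
  proof -
    have "fps_nth (x ^ c * (\<Sum>i<M + I. q ^ i)) A = (\<Sum>i<M + I. of_int (coeff (?X ^ c * ?Q ^ i) A))"
      by (simp add: sum_distrib_left fps_sum_nth emb)
    also have "\<dots> = (\<Sum>i\<in>{M..<M + I}. of_int (coeff (?X ^ c * ?Q ^ i) A))"
      by (rule sum.mono_neutral_right) (auto simp: small not_le)
    also have "\<dots> = (\<Sum>k<I. of_int (coeff (?X ^ c * ?Q ^ (M + k)) A))"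
      by (rule sum.reindex_bij_witness[of _ "\<lambda>k. M + k" "\<lambda>i. i - M"]) auto
    finally show ?thesis by (simp add: frob_mat_of_nat_diag[OF odd] A_def)
  qed
  have "(\<lambda>I. of_nat (?p - 1) * (\<Sum>k<I. frob_mat m c (of_nat M :: 'p padic) k k)) \<longlonglongrightarrow> J"
    unfolding padic_tendsto_iff
  proof (rule tendsto_sandwich[OF _ _ tendsto_const])
    have "(\<lambda>I. real ?p ^ A * (1 / real ?p ^ (I + M))) \<longlonglongrightarrow> real ?p ^ A * 0"
      by (intro tendsto_mult_left LIMSEQ_ignore_initial_segment inverse_card_power_tendsto_0)
    then show "(\<lambda>I. real ?p ^ A / real ?p ^ (M + I)) \<longlonglongrightarrow> 0" by (simp add: add.commute)
    show "\<forall>\<^sub>F I in sequentially. padic_abs (of_nat (?p - 1) *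
        (\<Sum>k<I. frob_mat m c (of_nat M :: 'p padic) k k) - J) \<le> real ?p ^ A / real ?p ^ (M + I)"
      unfolding sum J_def x_def q_def
      by (intro always_eventually allI frob_geometric_sum c) (use m in \<open>simp add: A_def\<close>)
  qed simp
  from tendsto_mult_left[OF this, of "inverse (of_nat (?p - 1))"]
  show ?thesis using p2 by (simp add: J_def A_def divide_inverse mult.commute flip: mult.assoc)
qed

section \<open>The eigenvalue of the Frobenius operator\<close>

text \<open>
  Tracing the operator over a space that splits into the line of constants and the image of a
  derivation \<open>D\<close> with \<open>\<alpha> D = p D \<alpha>\<close> gives \<open>tr \<alpha> = eigenvalue + p * tr \<alpha>\<close>; here this is a
  finite identity with a boundary term.
\<close>

lemma trace_telescope:
  fixes \<alpha> :: "nat \<Rightarrow> nat \<Rightarrow> 'a :: field"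
  defines "q \<equiv> \<lambda>h r l i. \<Prod>t\<in>{l..<i}. (of_nat t + h - r) / (of_nat t + h)"
  defines "\<Phi> \<equiv> \<lambda>h r i. \<Sum>l\<le>i. (of_nat i + h) / (of_nat l + h) * q h r (Suc l) (Suc i) * \<alpha> i l"
  assumes h: "\<And>t. of_nat t + h \<noteq> 0"
    and rec: "\<And>i l. (of_nat l + h) * \<alpha> (Suc i) (Suc l) - (of_nat l + h - r) * \<alpha> (Suc i) l =
      p * ((of_nat i + h) * \<alpha> i l - (of_nat (Suc i) + h - r) * \<alpha> (Suc i) l)"
  shows "(1 - p) * (\<Sum>i\<le>I. \<alpha> i i) - (\<Sum>i\<le>I. q h r 0 i * \<alpha> i 0) = - p * \<Phi> h r I"
proof (induction I)
  case 0
  show ?case using h[of 0] by (simp add: q_def \<Phi>_def algebra_simps)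
next
  case (Suc I)
  let ?q = "q h r" and ?i = "Suc I"
  define F where "F i l = (of_nat i + h) / (of_nat l + h) * ?q (Suc l) (Suc i) * \<alpha> i l" for i l
  have q_Suc: "?q l (Suc i) = ?q l i * ((of_nat i + h - r) / (of_nat i + h))" if "l \<le> i" for l i
    using that by (simp add: q_def prod.atLeastLessThan_Suc)
  have q_l: "?q l i = (of_nat l + h - r) / (of_nat l + h) * ?q (Suc l) i" if "l < i" for l i
    using that by (simp add: q_def prod.atLeast_Suc_lessThan)
  \<comment> \<open>The weights \<open>q\<close> turn the hypothesis into a difference in
    \<open>l\<close> on one side and a difference in \<open>i\<close> on the other. Summing over
    \<open>l\<close> then telescopes along the row and relates the boundary terms of consecutive
    rows.\<close>
  have step: "?q (Suc l) ?i * \<alpha> ?i (Suc l) - ?q l ?i * \<alpha> ?i l = p * (F I l - F ?i l)" if l: "l < ?i" for l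
  proof -
    define Q where "Q = ?q (Suc l) ?i"
    have FI: "F I l = Q / (of_nat l + h) * ((of_nat I + h) * \<alpha> I l)"
      by (simp add: F_def Q_def)
    have Fi: "F ?i l = Q / (of_nat l + h) * ((of_nat ?i + h - r) * \<alpha> ?i l)"
      using q_Suc[of "Suc l" ?i] l h[of ?i] by (simp add: F_def Q_def del: of_nat_Suc)
    have "?q (Suc l) ?i * \<alpha> ?i (Suc l) - ?q l ?i * \<alpha> ?i l =
        Q / (of_nat l + h) * ((of_nat l + h) * \<alpha> ?i (Suc l) - (of_nat l + h - r) * \<alpha> ?i l)"
      unfolding q_l[OF l] Q_def[symmetric] using h[of l] by (simp add: field_simps)
    also have "\<dots> = p * (F I l - F ?i l)" unfolding rec FI Fi by (simp add: right_diff_distrib mult_ac)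
    finally show ?thesis .
  qed
  have "?q ?i ?i * \<alpha> ?i ?i - ?q 0 ?i * \<alpha> ?i 0 = (\<Sum>l<?i. ?q (Suc l) ?i * \<alpha> ?i (Suc l) - ?q l ?i * \<alpha> ?i l)"
    using sum_lessThan_telescope[of "\<lambda>l. ?q l ?i * \<alpha> ?i l" ?i] by simp
  also have "\<dots> = (\<Sum>l<?i. p * (F I l - F ?i l))" by (intro sum.cong step) simp_all
  also have "\<dots> = p * ((\<Sum>l\<le>I. F I l) - (\<Sum>l\<le>I. F ?i l))"
    by (simp only: sum_distrib_left[symmetric] sum_subtractf lessThan_Suc_atMost)
  also have "(\<Sum>l\<le>I. F ?i l) = (\<Sum>l\<le>?i. F ?i l) - \<alpha> ?i ?i"
    using h[of ?i] by (simp add: F_def q_def del: of_nat_Suc)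
  finally have "\<alpha> ?i ?i - ?q 0 ?i * \<alpha> ?i 0 = p * (\<Phi> h r I - (\<Phi> h r ?i - \<alpha> ?i ?i))"
    by (simp add: F_def \<Phi>_def q_def)
  then have "(1 - p) * \<alpha> ?i ?i - ?q 0 ?i * \<alpha> ?i 0 = p * \<Phi> h r I - p * \<Phi> h r ?i"
    by (simp add: algebra_simps)
  moreover have "(1 - p) * (S + a) - (B + b) = - p * Y"
    if "(1 - p) * S - B = - p * X" "(1 - p) * a - b = p * X - p * Y" for S B a b X Y
  proof -
    have "(1 - p) * (S + a) - (B + b) = ((1 - p) * S - B) + ((1 - p) * a - b)"
      by (simp add: algebra_simps)
    then show ?thesis unfolding that by simp
  qed
  ultimately show ?case unfolding sum.atMost_Suc using Suc by blast
qed

text \<open>The entries of Leibniz' harmonic triangle are integral combinations of \<open>1 / i\<close> with \<open>i \<le> n\<close>.\<close>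

lemma padic_abs_leibniz_triangle_le:
  assumes "1 \<le> k" "k \<le> n"
  shows "padic_abs (inverse (of_nat (k * (n choose k))) :: 'p :: prime_card padic) \<le> real n"
  using assms
proof (induction k arbitrary: n rule: nat_induct_at_least)
  case base
  then show ?case using padic_abs_inverse_of_nat_le[of n, where 'p = 'p] by simp
next
  case (Suc k)
  then have n: "n > k" by simp
  define c where "c = (of_nat (n choose k) :: 'p padic)"
  have k: "(of_nat k :: 'p padic) \<noteq> 0" and nk: "(of_nat (n - k) :: 'p padic) \<noteq> 0"
    and nn: "(of_nat n :: 'p padic) \<noteq> 0" and c: "c \<noteq> 0"
    using Suc.hyps n by (auto simp: c_def)
  have "Suc k * (n choose Suc k) = (n - k) * (n choose k)"
    by (simp only: binomial_absorption binomial_absorb_comp)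
  then have 1: "(of_nat (Suc k * (n choose Suc k)) :: 'p padic) = of_nat (n - k) * c"
    by (simp only: c_def of_nat_mult)
  have "(n - k) * (n choose k) = n * ((n - 1) choose k)" by (rule binomial_absorb_comp)
  then have "of_nat (n - k) * c = of_nat n * (of_nat ((n - 1) choose k) :: 'p padic)"
    by (simp only: c_def flip: of_nat_mult)
  then have 2: "(of_nat ((n - 1) choose k) :: 'p padic) = of_nat (n - k) * c / of_nat n"
    using nn by (simp add: field_simps)
  \<comment> \<open>The rule of the harmonic triangle, for \<open>a = k\<close>,
    \<open>d = n - k\<close>, \<open>b = n\<close>: an entry is its neighbour in the row above minus
    its left neighbour.\<close>
  have "inverse (d * c) = inverse (a * (d * c / b)) - inverse (a * c)"
    if "b = a + d" "a \<noteq> 0" "b \<noteq> 0" "d \<noteq> 0" for a b d :: "'p padic"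
    using that(2-4) c unfolding that(1) by (simp add: divide_simps)
  moreover have "(of_nat n :: 'p padic) = of_nat k + of_nat (n - k)"
    using n by (simp flip: of_nat_add)
  ultimately have "inverse (of_nat (n - k) * c) =
      inverse (of_nat k * (of_nat (n - k) * c / of_nat n)) - inverse (of_nat k * c)"
    using k nk nn by blast
  then have "inverse (of_nat (Suc k * (n choose Suc k)) :: 'p padic) =
      inverse (of_nat (k * ((n - 1) choose k))) - inverse (of_nat (k * (n choose k)))"
    unfolding 1 unfolding of_nat_mult 2 c_def[symmetric] .
  moreover have "padic_abs (inverse (of_nat (k * ((n - 1) choose k))) :: 'p padic) \<le> real n"
    by (rule order.trans[OF Suc.IH]) (use n in simp_all)
  moreover have "padic_abs (inverse (of_nat (k * (n choose k))) :: 'p padic) \<le> real n"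
    using Suc.IH[of n] n by simp
  ultimately show ?case by (simp only: padic_abs_diff_le)
qed

section \<open>Denominators of inverse binomial coefficients and Pochhammer symbols\<close>

lemma padic_abs_inverse_binomial_le:
  assumes "k \<le> n"
  shows "padic_abs (inverse (of_nat (n choose k)) :: 'p :: prime_card padic) \<le> real n + 1"
proof (cases "k = 0")
  case False
  have "(inverse (of_nat (n choose k)) :: 'p padic) = of_nat k * inverse (of_nat (k * (n choose k)))"
    using False assms by (simp add: field_simps)
  also have "padic_abs \<dots> \<le> 1 * real n"
    using False assms by (intro padic_abs_mult_le padic_abs_leibniz_triangle_le) auto
  finally show ?thesis by simp
qed simp

text \<open>The quotient is \<open>4 ^ i\<close> divided by the central binomial coefficient
  \<open>2 * i choose i\<close>, and 2 is a unit.\<close>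

lemma padic_abs_fact_div_pochhammer_half_le:
  assumes "odd CARD('p)"
  shows "padic_abs (fact i / pochhammer (1 / 2) i :: 'p :: prime_card padic) \<le> 2 * real i + 1"
proof -
  have "\<not> CARD('p) dvd 2"
  proof
    assume "CARD('p) dvd 2"
    then have "CARD('p) \<le> 2" by (rule dvd_imp_le) simp
    moreover have "CARD('p) \<ge> 2" using prime_ge_2_nat[OF prime_card] .
    ultimately have "CARD('p) = 2" by simp
    with assms show False by simp
  qed
  then have two: "padic_abs (2 :: 'p padic) = 1" using padic_abs_of_nat_unit[of 2, where 'p = 'p] by simp
  have "(of_nat (2 * i choose i) :: 'p padic) = fact (2 * i) / (fact i * fact i)"
    by (simp add: binomial_fact mult_2)
  also have "\<dots> = 2 ^ (2 * i) * (pochhammer (1 / 2) i / fact i)"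
    by (simp add: fact_double)
  finally have eq: "(of_nat (2 * i choose i) :: 'p padic) = 2 ^ (2 * i) * (pochhammer (1 / 2) i / fact i)" .
  have "(of_nat (2 * i choose i) :: 'p padic) \<noteq> 0" by simp
  then have "(pochhammer (1 / 2) i :: 'p padic) \<noteq> 0" unfolding eq by auto
  with eq have "fact i / pochhammer (1 / 2) i = 2 ^ (2 * i) * inverse (of_nat (2 * i choose i) :: 'p padic)"
    by (simp add: field_simps)
  also have "padic_abs \<dots> \<le> 1 * (real (2 * i) + 1)"
    by (intro padic_abs_mult_le padic_abs_inverse_binomial_le) (simp_all add: padic_abs_power two)
  finally show ?thesis by simp
qed

section \<open>Natural numbers approximating the parameters\<close>

text \<open>This describes the \<open>p\<close>-adic integers. It is the form in which integrality
  is used: estimates at natural numbers pass to the limit.\<close>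

definition padic_nat_limit :: "'p :: prime_card padic \<Rightarrow> bool" where
  "padic_nat_limit x \<longleftrightarrow> (\<exists>g. (\<lambda>n. of_nat (g n)) \<longlonglongrightarrow> x)"

lemma padic_nat_limit_add_of_nat: "padic_nat_limit x \<Longrightarrow> padic_nat_limit (x + of_nat k)"
  unfolding padic_nat_limit_def
proof (elim exE)
  fix g assume "(\<lambda>n. of_nat (g n)) \<longlonglongrightarrow> x"
  from tendsto_add[OF this tendsto_const[of "of_nat k"]]
  show "\<exists>g. (\<lambda>n. of_nat (g n)) \<longlonglongrightarrow> x + of_nat k"
    by (intro exI[of _ "\<lambda>n. g n + k"]) simp
qed

lemma padic_abs_pochhammer_le:
  assumes "padic_nat_limit (x :: 'p :: prime_card padic)"
  shows "padic_abs (pochhammer x n) \<le> padic_abs (fact n :: 'p padic)"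
proof (cases n)
  case (Suc n')
  have "pochhammer x n = fact n * ((x + of_nat n') gchoose n)"
  proof -
    have "x + of_nat n' - of_nat n + 1 = x" by (simp add: Suc)
    then show ?thesis unfolding gbinomial_pochhammer' by (simp only:) simp
  qed
  moreover obtain g where "(\<lambda>n. of_nat (g n)) \<longlonglongrightarrow> x + of_nat n'"
    using padic_nat_limit_add_of_nat[OF assms] by (auto simp: padic_nat_limit_def)
  then have "padic_abs ((x + of_nat n') gchoose n) \<le> 1" by (rule padic_abs_gbinomial_le_1)
  ultimately show ?thesis
    using mult_left_mono[of "padic_abs ((x + of_nat n') gchoose n)" 1 "padic_abs (fact n :: 'p padic)"]
    by (simp add: padic_abs_mult)
qed simp

text \<open>The base-\<open>p\<close> number with \<open>f\<close> digits 1. In the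
  \<open>p\<close>-adic limit it becomes \<open>- 1 / (p - 1)\<close>, and its multiples approximate
  the parameters \<open>- e / (p - 1)\<close>.\<close>

definition geo :: "nat \<Rightarrow> nat \<Rightarrow> nat" where
  "geo p f = (\<Sum>i<f. p ^ i)"

lemma geo_Suc: "geo p (Suc f) = Suc (p * geo p f)"
  unfolding geo_def by (subst sum.lessThan_Suc_shift) (simp add: sum_distrib_left)

lemma geo_eq: "p \<ge> 1 \<Longrightarrow> (p - 1) * geo p f + 1 = p ^ f"
proof (induction f)
  case (Suc f)
  have "(p - 1) * geo p (Suc f) + 1 = p * ((p - 1) * geo p f + 1)"
    using Suc.prems by (cases p) (simp_all add: geo_Suc algebra_simps)
  then show ?case by (simp only: Suc.IH[OF Suc.prems] power_Suc)
qed (simp add: geo_def)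

lemma of_nat_card_minus_1: "(of_nat (CARD('p) - 1) :: 'p :: prime_card padic) = of_nat CARD('p) - 1"
  using prime_ge_1_nat[OF prime_card[where 'a = 'p]] by (simp add: of_nat_diff)

lemma card_minus_1_neq_0 [simp]: "(of_nat CARD('p) - 1 :: 'p :: prime_card padic) \<noteq> 0"
  using prime_gt_1_nat[OF prime_card[where 'a = 'p]]
  unfolding of_nat_card_minus_1[symmetric] of_nat_eq_0_iff by linarith

lemma tendsto_geo:
  "(\<lambda>f. of_nat (geo CARD('p) f) :: 'p :: prime_card padic) \<longlonglongrightarrow> - 1 / (of_nat CARD('p) - 1)"
proof -
  have "(of_nat (geo CARD('p) f) :: 'p padic) = (of_nat CARD('p) ^ f - 1) / (of_nat CARD('p) - 1)" for f
  proof -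
    have "(of_nat ((CARD('p) - 1) * geo CARD('p) f + 1) :: 'p padic) = of_nat (CARD('p) ^ f)"
      by (rule arg_cong[OF geo_eq[OF prime_ge_1_nat[OF prime_card]]])
    then have "(of_nat CARD('p) - 1) * of_nat (geo CARD('p) f) + 1 = (of_nat CARD('p) ^ f :: 'p padic)"
      by (simp only: of_nat_add of_nat_mult of_nat_power of_nat_1 of_nat_card_minus_1)
    then have "of_nat (geo CARD('p) f) * (of_nat CARD('p) - 1) = (of_nat CARD('p) ^ f - 1 :: 'p padic)"
      by (metis add_diff_cancel_right' mult.commute)
    then show ?thesis unfolding nonzero_eq_divide_eq[OF card_minus_1_neq_0] .
  qed
  moreover have "(\<lambda>f. (of_nat CARD('p) ^ f - 1) / (of_nat CARD('p) - 1) :: 'p padic) \<longlonglongrightarrow>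
      (0 - 1) / (of_nat CARD('p) - 1)"
    by (intro tendsto_divide_padic tendsto_diff tendsto_card_power tendsto_const card_minus_1_neq_0)
  ultimately show ?thesis by (simp only: diff_0)
qed

lemma padic_nat_limit_div_card_minus_1:
  "padic_nat_limit (of_int a / (of_nat CARD('p) - 1) :: 'p :: prime_card padic)"
proof (cases a rule: int_cases2)
  case (nonneg n)
  let ?p = "CARD('p)"
  have 2: "(of_nat (?p - 2) :: 'p padic) = of_nat ?p - 2"
    using prime_ge_2_nat[OF prime_card[where 'a = 'p]] by (simp add: of_nat_diff)
  \<comment> \<open>For a positive numerator the sign is corrected by
    \<open>1 / (p - 1) = 1 + (p - 2) * (- 1 / (p - 1))\<close>.\<close>
  have "(\<lambda>f. of_nat n * (1 + of_nat (?p - 2) * of_nat (geo ?p f))) \<longlonglongrightarrow>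
      of_nat n * (1 + of_nat (?p - 2) * (- 1 / (of_nat ?p - 1)) :: 'p padic)"
    by (intro tendsto_mult tendsto_add tendsto_const tendsto_geo)
  also have "of_nat n * (1 + of_nat (?p - 2) * (- 1 / (of_nat ?p - 1)) :: 'p padic) =
      of_nat n / (of_nat ?p - 1)"
  proof -
    have "1 + (b - 2) * (- 1 / (b - 1)) = 1 / (b - 1)" if "b - 1 \<noteq> 0" for b :: "'p padic"
      using that by (simp add: divide_simps)
    from this[OF card_minus_1_neq_0] show ?thesis unfolding 2 by (simp only: times_divide_eq_right mult_1_right)
  qed
  finally have "(\<lambda>f. of_nat (n * (1 + (?p - 2) * geo ?p f))) \<longlonglongrightarrow> (of_nat n / (of_nat ?p - 1) :: 'p padic)"
    by (simp only: of_nat_mult of_nat_add of_nat_1)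
  then show ?thesis unfolding padic_nat_limit_def nonneg of_int_of_nat_eq
    by (rule exI[where x = "\<lambda>f. n * (1 + (?p - 2) * geo ?p f)"])
next
  case (nonpos n)
  have "(\<lambda>f. of_nat n * of_nat (geo CARD('p) f)) \<longlonglongrightarrow> of_nat n * (- 1 / (of_nat CARD('p) - 1) :: 'p padic)"
    by (intro tendsto_mult tendsto_const tendsto_geo)
  then have "(\<lambda>f. of_nat (n * geo CARD('p) f)) \<longlonglongrightarrow> of_int (- int n) / (of_nat CARD('p) - 1 :: 'p padic)"
    by simp
  then show ?thesis unfolding padic_nat_limit_def nonpos
    by (rule exI[where x = "\<lambda>f. n * geo CARD('p) f"])
qed

lemma half_add_of_nat_neq_0 [simp]: "of_nat t + 1 / 2 \<noteq> (0 :: 'a :: field_char_0)"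
proof
  assume "of_nat t + 1 / 2 = (0 :: 'a)"
  then have "of_nat (2 * t + 1) = (0 :: 'a)" by (simp add: field_simps)
  then show False by (simp only: of_nat_eq_0_iff)
qed

lemma odd_card_halves:
  assumes "odd CARD('p)"
  defines "m \<equiv> (CARD('p) - 1) div 2"
  shows "CARD('p) = 2 * m + 1" "m > 0"
    "(of_nat CARD('p) :: 'p :: prime_card padic) = 2 * of_nat m + 1"
    "of_nat m / (of_nat CARD('p) - 1) = (1 / 2 :: 'p padic)"
proof -
  show 1: "CARD('p) = 2 * m + 1" using assms by (simp add: m_def)
  then show 2: "m > 0" using prime_gt_1_nat[OF prime_card[where 'a = 'p]] by simp
  have "(of_nat CARD('p) :: 'p padic) = of_nat (2 * m + 1)" by (simp only: 1[symmetric])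
  then show 3: "(of_nat CARD('p) :: 'p padic) = 2 * of_nat m + 1" by simp
  show "of_nat m / (of_nat CARD('p) - 1) = (1 / 2 :: 'p padic)" unfolding 3 using 2 by simp
qed

lemma tendsto_mult_geo:
  "(\<lambda>f. of_nat (e * geo CARD('p) f) :: 'p :: prime_card padic) \<longlonglongrightarrow> - (of_nat e / (of_nat CARD('p) - 1))"
proof -
  have "(\<lambda>f. of_nat e * of_nat (geo CARD('p) f) :: 'p padic) \<longlonglongrightarrow> of_nat e * (- 1 / (of_nat CARD('p) - 1))"
    by (intro tendsto_mult tendsto_const tendsto_geo)
  then show ?thesis
    by (simp only: of_nat_mult times_divide_eq_right mult_minus_right mult_1_right minus_divide_left[symmetric])
qed

lemma tendsto_half_card_geo:
  assumes "odd CARD('p)"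
  shows "(\<lambda>f. of_nat ((CARD('p) - 1) div 2 * geo CARD('p) f) :: 'p :: prime_card padic) \<longlonglongrightarrow> - 1 / 2"
  using tendsto_mult_geo[of "(CARD('p) - 1) div 2", where 'p = 'p]
  by (simp only: odd_card_halves(4)[OF assms] minus_divide_left)

lemma padic_nat_limit_half:
  assumes "odd CARD('p)"
  shows "padic_nat_limit (1 / 2 :: 'p :: prime_card padic)" "padic_nat_limit (- 1 / 2 :: 'p padic)"
proof -
  let ?m = "(CARD('p) - 1) div 2"
  have 1: "of_int (int ?m) / (of_nat CARD('p) - 1) = (1 / 2 :: 'p padic)"
    unfolding of_int_of_nat_eq by (rule odd_card_halves(4)[OF assms])
  have 2: "of_int (- int ?m) / (of_nat CARD('p) - 1) = (- 1 / 2 :: 'p padic)"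
    unfolding of_int_minus minus_divide_left[symmetric] 1 ..
  show "padic_nat_limit (1 / 2 :: 'p padic)"
    unfolding 1[symmetric] by (rule padic_nat_limit_div_card_minus_1)
  show "padic_nat_limit (- 1 / 2 :: 'p padic)"
    unfolding 2[symmetric] by (rule padic_nat_limit_div_card_minus_1)
qed

section \<open>The derivation at \<open>-1/2\<close> and its boundary term\<close>

text \<open>By \<open>m + p * (-1/2) = -1/2\<close> rows and columns receive the same shift
  \<open>1/2\<close>. The twist \<open>c = (p - 1) * (1 - r)\<close> splits into a part with factor
  \<open>p\<close>, moved to the right, and a part without it, kept on the left.\<close>

lemma frob_mat_minus_half_rec:
  fixes j :: nat
  assumes odd: "odd CARD('p)" and j: "j < CARD('p)"
  defines "m \<equiv> (CARD('p) - 1) div 2" and "r \<equiv> of_nat j / (of_nat CARD('p) - 1) :: 'p :: prime_card padic"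
  defines "\<alpha> \<equiv> frob_mat m (CARD('p) - 1 - j) (- 1 / 2 :: 'p padic)"
  shows "(of_nat l + 1 / 2) * \<alpha> (Suc i) (Suc l) - (of_nat l + 1 / 2 - r) * \<alpha> (Suc i) l =
    of_nat CARD('p) * ((of_nat i + 1 / 2) * \<alpha> i l - (of_nat (Suc i) + 1 / 2 - r) * \<alpha> (Suc i) l)"
proof -
  define P where "P = (of_nat CARD('p) :: 'p padic)"
  obtain g where g: "(\<lambda>n. of_nat (g n)) \<longlonglongrightarrow> (- 1 / 2 :: 'p padic)"
    using padic_nat_limit_half(2)[OF odd] by (auto simp: padic_nat_limit_def)
  have alg: "(L + h) * A - (L + h - r) * B = P * ((I + h) * C - (1 + I + h - r) * B)"
    if "(u + L + 1) * A - (u + L) * B = (- h + (1 + I)) * P * (C - B) - d * B"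
      "u = - h" "d = (P - 1) - (P - 1) * r" "h + h = 1" for A B C L I u d h :: "'p padic"
  proof -
    have "(L + h) * A - (L + h - r) * B = ((u + L + 1) * A - (u + L) * B) +
        ((2 * h - 1) * A) - (2 * h - r) * B"
      unfolding that(2) by (simp add: algebra_simps)
    also have "\<dots> = (1 - h + I) * P * (C - B) - ((P - 1) - (P - 1) * r) * B - (1 - r) * B"
      unfolding that(1) that(3) mult_2 that(4) by (simp add: algebra_simps)
    also have "1 - h = h" using that(4) by (simp add: diff_eq_eq)
    also have "(h + I) * P * (C - B) - ((P - 1) - (P - 1) * r) * B - (1 - r) * B =
        P * ((I + h) * C - (1 + I + h - r) * B)"
      by (simp add: algebra_simps)
    finally show ?thesis .
  qed
  have Pr: "(P - 1) * r = of_nat j"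
    unfolding r_def P_def times_divide_eq_right
    by (rule nonzero_mult_div_cancel_left[OF card_minus_1_neq_0])
  show ?thesis
    unfolding P_def[symmetric] of_nat_Suc
  proof (rule alg)
    show "(of_nat m + P * (- 1 / 2) + of_nat l + 1) * \<alpha> (Suc i) (Suc l) -
        (of_nat m + P * (- 1 / 2) + of_nat l) * \<alpha> (Suc i) l =
      (- (1 / 2) + (1 + of_nat i)) * P * (\<alpha> i l - \<alpha> (Suc i) l) - of_nat (CARD('p) - 1 - j) * \<alpha> (Suc i) l"
      using frob_mat_rec[OF odd g, of m l "CARD('p) - 1 - j" i]
      unfolding \<alpha>_def P_def of_nat_Suc minus_divide_left[symmetric] .
    show "of_nat m + P * (- 1 / 2) = - (1 / 2 :: 'p padic)"
      unfolding P_def odd_card_halves(3)[OF odd, folded m_def] by (simp add: field_simps)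
    show "of_nat (CARD('p) - 1 - j) = (P - 1) - (P - 1) * r"
      unfolding Pr using j by (simp add: of_nat_diff P_def)
  qed simp
qed

text \<open>
  For \<open>x = -1/2\<close> and \<open>y = j / (p - 1) - 1/2\<close>, the functional sending \<open>(1 / (1 - X)) ^ k\<close> to
  \<open>eig_coeff x y k\<close> vanishes on the image of the derivation.
\<close>

definition eig_coeff :: "'a :: field \<Rightarrow> 'a \<Rightarrow> nat \<Rightarrow> 'a" where
  "eig_coeff x y k = (\<Prod>i<k. (of_nat i - y) / (of_nat i + (x + 1)))"

text \<open>In this form the only denominator is one Pochhammer symbol, which can be compared with a
  factorial; bounding the factors of the product one by one would be too weak.\<close>

lemma boundary_coeff_eq:
  fixes h r :: "'a :: field_char_0"
  assumes h: "\<And>t. of_nat t + h \<noteq> 0" and "l \<le> i"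
  shows "(of_nat i + h) / (of_nat l + h) * (\<Prod>t\<in>{Suc l..<Suc i}. (of_nat t + h - r) / (of_nat t + h)) =
    pochhammer (h - r + of_nat (Suc l)) (i - l) * pochhammer h l / pochhammer h i"
  using \<open>l \<le> i\<close>
proof (induction i rule: dec_induct)
  case base
  have "pochhammer h l \<noteq> 0"
    using h by (auto simp: pochhammer_prod add.commute)
  then show ?case using h[of l] by simp
next
  case (step i)
  have S: "{Suc l..<Suc (Suc i)} = insert (Suc i) {Suc l..<Suc i}" using step by auto
  have "(of_nat (Suc i) + h) / (of_nat l + h) * (\<Prod>t\<in>{Suc l..<Suc (Suc i)}. (of_nat t + h - r) / (of_nat t + h)) =
      ((of_nat i + h) / (of_nat l + h) * (\<Prod>t\<in>{Suc l..<Suc i}. (of_nat t + h - r) / (of_nat t + h))) *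
      ((of_nat (Suc i) + h - r) / (of_nat i + h))"
    unfolding S using h[of i] h[of "Suc i"] h[of l] by (simp add: divide_simps del: of_nat_Suc)
  also have "\<dots> = pochhammer (h - r + of_nat (Suc l)) (i - l) * (of_nat (Suc i) + h - r) *
      pochhammer h l / (pochhammer h i * (h + of_nat i))"
    unfolding step.IH by (simp add: add.commute)
  also have "pochhammer (h - r + of_nat (Suc l)) (i - l) * (of_nat (Suc i) + h - r) =
      pochhammer (h - r + of_nat (Suc l)) (Suc (i - l))"
  proof -
    have "h - r + of_nat (Suc l) + of_nat (i - l) = of_nat (Suc i) + h - r"
      using step by (simp add: of_nat_diff)
    then show ?thesis unfolding pochhammer_Suc by simp
  qed
  also have "Suc (i - l) = Suc i - l" using step by simp
  finally show ?case by (simp add: pochhammer_Suc)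
qed

text \<open>The numerators are bounded by \<open>fact (i - l)\<close> and \<open>fact l\<close>.
  What remains is an inverse binomial coefficient times
  \<open>fact i / pochhammer (1 / 2) i\<close>, each of at most linear size.\<close>

lemma padic_abs_boundary_coeff_le:
  fixes j :: nat
  assumes odd: "odd CARD('p)" and l: "l \<le> i"
  defines "r \<equiv> of_nat j / (of_nat CARD('p) - 1) :: 'p :: prime_card padic"
  shows "padic_abs (pochhammer (1 / 2 - r + of_nat (Suc l)) (i - l) * pochhammer (1 / 2) l /
    pochhammer (1 / 2) i) \<le> (real i + 1) * (2 * real i + 1)"
proof -
  let ?h = "1 / 2 :: 'p padic"
  have "?h - r = of_int (int ((CARD('p) - 1) div 2) - int j) / (of_nat CARD('p) - 1)"
    using odd_card_halves(4)[OF odd] by (simp add: r_def diff_divide_distrib)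
  then have "padic_nat_limit (?h - r)" by (simp only: padic_nat_limit_div_card_minus_1)
  then have "padic_nat_limit (?h - r + of_nat (Suc l))" by (rule padic_nat_limit_add_of_nat)
  then have 1: "padic_abs (pochhammer (?h - r + of_nat (Suc l)) (i - l)) \<le> padic_abs (fact (i - l) :: 'p padic)"
    by (rule padic_abs_pochhammer_le)
  have 2: "padic_abs (pochhammer ?h l) \<le> padic_abs (fact l :: 'p padic)"
    by (intro padic_abs_pochhammer_le padic_nat_limit_half odd)
  have "padic_abs (pochhammer (?h - r + of_nat (Suc l)) (i - l) * pochhammer ?h l / pochhammer ?h i) \<le>
      padic_abs (fact (i - l) :: 'p padic) * padic_abs (fact l :: 'p padic) / padic_abs (pochhammer ?h i)"
    unfolding padic_abs_divide padic_abs_mult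
    by (intro divide_right_mono mult_mono 1 2) simp_all
  also have "\<dots> = padic_abs (inverse (of_nat (i choose l)) * (fact i / pochhammer ?h i))"
    using l by (simp add: binomial_fact padic_abs_mult padic_abs_divide padic_abs_inverse field_simps)
  also have "\<dots> \<le> (real i + 1) * (2 * real i + 1)"
    by (intro padic_abs_mult_le padic_abs_inverse_binomial_le padic_abs_fact_div_pochhammer_half_le odd l)
  finally show ?thesis .
qed

lemma poly_div_card_power_tendsto_0:
  assumes "odd CARD('p :: prime_card)"
  shows "(\<lambda>n. (real n + 1) * (2 * real n + 1) / real CARD('p) ^ n) \<longlonglongrightarrow> 0"
proof (rule tendsto_sandwich[OF _ _ tendsto_const])
  show "(\<lambda>n. (real n + 1) * (2 * real n + 1) / 3 ^ n) \<longlonglongrightarrow> 0" by real_asymp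
  have "CARD('p) \<ge> 3" using odd_card_halves[OF assms] by simp
  then show "\<forall>\<^sub>F n in sequentially. (real n + 1) * (2 * real n + 1) / real CARD('p) ^ n \<le>
      (real n + 1) * (2 * real n + 1) / 3 ^ n"
    by (intro always_eventually allI divide_left_mono power_mono) auto
qed simp

text \<open>The boundary weights grow at most quadratically, while the entries of row
  \<open>i\<close> up to the diagonal decay like \<open>1 / p ^ i\<close>.\<close>

lemma trace_eq_eigenvalue:
  fixes j :: nat
  assumes odd: "odd CARD('p)" and j: "j < CARD('p)"
  defines "m \<equiv> (CARD('p) - 1) div 2" and "r \<equiv> of_nat j / (of_nat CARD('p) - 1) :: 'p :: prime_card padic"
  defines "\<alpha> \<equiv> frob_mat m (CARD('p) - 1 - j) (- 1 / 2 :: 'p padic)"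
  shows "(\<lambda>I. (1 - of_nat CARD('p)) * (\<Sum>i\<le>I. \<alpha> i i) -
    (\<Sum>i\<le>I. eig_coeff (- 1 / 2) (r - 1 / 2) i * \<alpha> i 0)) \<longlonglongrightarrow> 0"
proof -
  let ?h = "1 / 2 :: 'p padic" and ?p = "of_nat CARD('p) :: 'p padic"
  let ?q = "\<lambda>l i. \<Prod>t\<in>{l..<i}. (of_nat t + ?h - r) / (of_nat t + ?h)"
  let ?\<Phi> = "\<lambda>i. \<Sum>l\<le>i. (of_nat i + ?h) / (of_nat l + ?h) * ?q (Suc l) (Suc i) * \<alpha> i l"
  have eig: "eig_coeff (- 1 / 2) (r - 1 / 2) i = ?q 0 i" for i
    unfolding eig_coeff_def lessThan_atLeast0 by (intro prod.cong) (simp_all add: algebra_simps)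
  have "(1 - ?p) * (\<Sum>i\<le>I. \<alpha> i i) - (\<Sum>i\<le>I. ?q 0 i * \<alpha> i 0) = - ?p * ?\<Phi> I" for I
    by (rule trace_telescope)
      (use frob_mat_minus_half_rec[OF odd j] in \<open>simp_all only: half_add_of_nat_neq_0 not_False_eq_True \<alpha>_def m_def r_def\<close>)
  moreover have "(\<lambda>I. - ?p * ?\<Phi> I) \<longlonglongrightarrow> - ?p * 0"
  proof (rule tendsto_mult_left)
    obtain g where g: "(\<lambda>n. of_nat (g n)) \<longlonglongrightarrow> (- 1 / 2 :: 'p padic)"
      using padic_nat_limit_half(2)[OF odd] by (auto simp: padic_nat_limit_def)
    have "padic_abs (?\<Phi> i) \<le> (real i + 1) * (2 * real i + 1) * (1 / real CARD('p) ^ i)" for i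
    proof (rule padic_abs_sum_le)
      fix l assume l: "l \<in> {..i}"
      have "(of_nat i + ?h) / (of_nat l + ?h) * ?q (Suc l) (Suc i) =
          pochhammer (?h - r + of_nat (Suc l)) (i - l) * pochhammer ?h l / pochhammer ?h i"
        using l by (intro boundary_coeff_eq) simp_all
      moreover have "padic_abs (pochhammer (?h - r + of_nat (Suc l)) (i - l) * pochhammer ?h l /
          pochhammer ?h i) \<le> (real i + 1) * (2 * real i + 1)"
        unfolding r_def using l by (intro padic_abs_boundary_coeff_le odd) simp
      ultimately have "padic_abs ((of_nat i + ?h) / (of_nat l + ?h) * ?q (Suc l) (Suc i)) \<le>
          (real i + 1) * (2 * real i + 1)" by (simp only:)
      moreover have "padic_abs (\<alpha> i l) \<le> 1 / real CARD('p) ^ i"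
        unfolding \<alpha>_def using l by (intro padic_abs_frob_mat_le[OF odd g]) (simp_all add: m_def)
      ultimately show "padic_abs ((of_nat i + ?h) / (of_nat l + ?h) * ?q (Suc l) (Suc i) * \<alpha> i l) \<le>
          (real i + 1) * (2 * real i + 1) * (1 / real CARD('p) ^ i)"
        by (rule padic_abs_mult_le)
    qed simp
    then show "?\<Phi> \<longlonglongrightarrow> 0"
      unfolding padic_tendsto_iff diff_0_right
      by (intro tendsto_sandwich[OF _ _ tendsto_const poly_div_card_power_tendsto_0[OF odd]]
          always_eventually allI) simp_all
  qed
  ultimately show ?thesis unfolding eig by simp
qed

section \<open>The trace at \<open>-1/2\<close> as a Jacobi sum\<close>

lemma frob_trace_limit:
  fixes c :: nat
  assumes odd: "odd CARD('p)" and c: "0 < c" "c < CARD('p)"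
  defines "m \<equiv> (CARD('p) - 1) div 2"
  shows "(\<lambda>I. \<Sum>k<I. frob_mat m c (- 1 / 2 :: 'p :: prime_card padic) k k) \<longlonglongrightarrow>
    (\<Sum>t\<in>- {0, 1}. teichmuller (t :: 'p mod_ring) ^ c * inverse (teichmuller (1 - t)) ^ m) /
    (of_nat CARD('p) - 1)"
proof -
  let ?p = "CARD('p)"
  define M where "M f = m * geo ?p f" for f
  define A where "A f = m + (?p - 1) * M f" for f
  define L where "L f = (\<Sum>t\<in>- {0, 1}. teichmuller (t :: 'p mod_ring) ^ c *
    inverse (1 - teichmuller t) ^ A f) / of_nat (?p - 1)" for f
  \<comment> \<open>With \<open>M f = m * geo p f\<close> the exponent is exactly
    \<open>p ^ f * m\<close>; the powers of \<open>1 - teichmuller t\<close> therefore converge to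
    values of the character.\<close>
  have A: "A f = ?p ^ f * m" for f
  proof -
    have "A f = m * ((?p - 1) * geo ?p f + 1)" by (simp add: A_def M_def algebra_simps)
    also have "\<dots> = ?p ^ f * m"
      unfolding geo_eq[OF prime_ge_1_nat[OF prime_card[where 'a = 'p]]] by (rule mult.commute)
    finally show ?thesis .
  qed
  have M: "(\<lambda>f. of_nat (M f)) \<longlonglongrightarrow> (- 1 / 2 :: 'p padic)"
    unfolding M_def m_def by (rule tendsto_half_card_geo[OF odd])
  have L: "L \<longlonglongrightarrow> (\<Sum>t\<in>- {0, 1}. teichmuller (t :: 'p mod_ring) ^ c * inverse (teichmuller (1 - t)) ^ m) /
      (of_nat ?p - 1)" (is "_ \<longlonglongrightarrow> ?J")
    unfolding L_def A of_nat_card_minus_1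
  proof (intro tendsto_divide_padic tendsto_sum tendsto_mult tendsto_const card_minus_1_neq_0)
    fix t :: "'p mod_ring" assume t: "t \<in> - {0, 1}"
    then have "teichmuller (1 - t) \<noteq> 0" by simp
    then have "(\<lambda>f. inverse ((1 - teichmuller t) ^ (?p ^ f)) ^ m) \<longlonglongrightarrow> inverse (teichmuller (1 - t)) ^ m"
      by (intro tendsto_power_strong tendsto_const tendsto_inverse_padic tendsto_one_minus_teichmuller)
    then show "(\<lambda>f. inverse (1 - teichmuller t) ^ (?p ^ f * m)) \<longlonglongrightarrow> inverse (teichmuller (1 - t)) ^ m"
      by (simp add: power_inverse power_mult)
  qed
  \<comment> \<open>The tail after \<open>I\<close> terms is bounded by \<open>1 / p ^ I\<close>
    uniformly in \<open>f\<close>, so the estimate survives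
    \<open>f \<rightarrow> \<infinity>\<close>.\<close>
  have le: "padic_abs ((\<Sum>k<I. frob_mat m c (- 1 / 2 :: 'p padic) k k) - ?J) \<le> 1 / real ?p ^ I" for I
  proof (rule Lim_bounded)
    show "(\<lambda>f. padic_abs ((\<Sum>k<I. frob_mat m c (of_nat (M f)) k k) - L f)) \<longlonglongrightarrow>
        padic_abs ((\<Sum>k<I. frob_mat m c (- 1 / 2 :: 'p padic) k k) - ?J)"
      by (intro tendsto_padic_abs tendsto_diff L tendsto_sum tendsto_frob_mat M)
    show "\<forall>f\<ge>0. padic_abs ((\<Sum>k<I. frob_mat m c (of_nat (M f)) k k) - L f) \<le> 1 / real ?p ^ I"
    proof (intro allI impI padic_abs_partial_sum_le)
      fix f
      show "(\<lambda>n. \<Sum>k<n. frob_mat m c (of_nat (M f) :: 'p padic) k k) \<longlonglongrightarrow> L f"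
        unfolding L_def A_def using odd_card_halves(2)[OF odd] c
        by (intro frob_trace_tendsto odd) (simp_all add: m_def)
      fix k assume "I \<le> k"
      have "padic_abs (frob_mat m c (of_nat (M f) :: 'p padic) k k) \<le> 1 / real ?p ^ k"
        by (rule padic_abs_frob_mat_le[OF odd tendsto_const]) (simp_all add: m_def)
      also have "\<dots> \<le> 1 / real ?p ^ I"
        using \<open>I \<le> k\<close> card_gt_1[where 'p = 'p] by (simp add: divide_left_mono power_increasing)
      finally show "padic_abs (frob_mat m c (of_nat (M f) :: 'p padic) k k) \<le> 1 / real ?p ^ I" .
    qed simp
  qed
  show ?thesis
    unfolding padic_tendsto_iff
    by (rule tendsto_sandwich[OF _ _ tendsto_const inverse_card_power_tendsto_0[where 'p = 'p]])
      (use le in \<open>simp_all add: always_eventually\<close>)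
qed

section \<open>The eigenvalue as a limit of quotients of binomial coefficients\<close>

text \<open>With \<open>n = M + T\<close>, expanding
  \<open>x ^ (p * n) = (1 - (1 - x ^ p)) ^ n\<close> and multiplying by \<open>x ^ c\<close> gives
  \<open>x ^ (c + p * n)\<close> as a combination of the \<open>frob_poly\<close>. Those with
  exponent below \<open>M\<close> do not reach the index in question.\<close>

lemma eigenvector_sum_nat:
  assumes "c < p"
  shows "(\<Sum>k\<le>T. (-1) ^ k * int ((M + T) choose (M + k)) * coeff (frob_poly p c (M + k)) (m + p * M)) =
    (-1) ^ (M + (m + p * M)) * int ((c + p * (M + T)) choose (m + p * M))"
proof -
  let ?X = "[:1, -1 :: int:]" and ?n = "M + T" and ?N = "m + p * M"
  have "(\<Sum>i\<le>?n. of_nat (?n choose i) * (- (1 - ?X ^ p)) ^ i * 1 ^ (?n - i)) = (- (1 - ?X ^ p) + 1) ^ ?n"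
    by (rule binomial_ring[symmetric])
  then have "?X ^ c * (\<Sum>i\<le>?n. of_nat (?n choose i) * (- (1 - ?X ^ p)) ^ i) = ?X ^ (c + p * ?n)"
    by (simp add: power_add power_mult)
  moreover have "of_nat (?n choose i) * (- (1 - ?X ^ p)) ^ i * ?X ^ c =
      smult ((-1) ^ i * int (?n choose i)) (frob_poly p c i)" for i
  proof -
    have "(- (1 - ?X ^ p)) ^ i = smult ((-1) ^ i) ((1 - ?X ^ p) ^ i)"
      by (subst power_minus) (simp add: minus_one_power_iff)
    then show ?thesis by (simp add: frob_poly_def of_nat_poly mult_ac)
  qed
  ultimately have eq: "(\<Sum>i\<le>?n. smult ((-1) ^ i * int (?n choose i)) (frob_poly p c i)) = ?X ^ (c + p * ?n)"
    by (simp only: sum_distrib_left mult.commute[of "?X ^ c"])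
  have small: "coeff (frob_poly p c i) ?N = 0" if "i < M" for i
  proof (rule coeff_eq_0)
    have "degree (1 - ?X ^ p) \<le> p"
      by (intro degree_diff_le) (simp_all add: degree_linear_power)
    then have "degree ((1 - ?X ^ p) ^ i) \<le> p * i"
      by (intro order.trans[OF degree_power_le] mult_le_mono1)
    then have "degree (frob_poly p c i) \<le> c + p * i"
      unfolding frob_poly_def
      by (intro order.trans[OF degree_mult_le] add_mono) (simp_all add: degree_linear_power)
    also have "\<dots> < p * Suc i" using assms by simp
    also have "\<dots> \<le> p * M" using that by (intro mult_le_mono2) simp
    finally show "degree (frob_poly p c i) < ?N" by simp
  qed
  have "(\<Sum>i\<le>?n. (-1) ^ i * int (?n choose i) * coeff (frob_poly p c i) ?N) = coeff (?X ^ (c + p * ?n)) ?N"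
    unfolding eq[symmetric] coeff_sum by simp
  also have "\<dots> = (-1) ^ ?N * int ((c + p * ?n) choose ?N)"
  proof (cases "?N \<le> c + p * ?n")
    case False
    then show ?thesis by (simp add: coeff_eq_0 degree_linear_power)
  qed (simp add: coeff_linear_poly_power)
  also have "(\<Sum>i\<le>?n. (-1) ^ i * int (?n choose i) * coeff (frob_poly p c i) ?N) =
      (\<Sum>i\<in>{M..?n}. (-1) ^ i * int (?n choose i) * coeff (frob_poly p c i) ?N)"
    by (rule sum.mono_neutral_right) (auto simp: small not_le)
  also have "\<dots> = (\<Sum>k\<le>T. (-1) ^ (M + k) * int (?n choose (M + k)) * coeff (frob_poly p c (M + k)) ?N)"
    by (rule sum.reindex_bij_witness[of _ "\<lambda>k. M + k" "\<lambda>i. i - M"]) auto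
  also have "\<dots> = (-1) ^ M * (\<Sum>k\<le>T. (-1) ^ k * int (?n choose (M + k)) * coeff (frob_poly p c (M + k)) ?N)"
    by (simp add: sum_distrib_left power_add mult.assoc)
  finally have "(-1) ^ M * (\<Sum>k\<le>T. (-1) ^ k * int (?n choose (M + k)) * coeff (frob_poly p c (M + k)) ?N) =
      (-1) ^ ?N * int ((c + p * ?n) choose ?N)" .
  then have "(-1) ^ M * ((-1) ^ M * (\<Sum>k\<le>T. (-1) ^ k * int (?n choose (M + k)) * coeff (frob_poly p c (M + k)) ?N)) =
      (-1) ^ M * ((-1) ^ ?N * int ((c + p * ?n) choose ?N))" by (rule arg_cong)
  moreover have "(-1) ^ M * ((-1) ^ M * x) = x" for x :: int
    by (simp flip: mult.assoc power_mult_distrib)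
  ultimately show ?thesis by (simp add: power_add mult.assoc)
qed

text \<open>Up to sign and normalisation these are the coefficients of
  \<open>(1 - x) ^ (M + k)\<close> in \<open>x ^ (M + T)\<close>. In particular they vanish for
  \<open>k > T\<close>, which makes the eigenvector finite.\<close>

lemma eig_coeff_of_nat:
  "eig_coeff (of_nat M) (of_nat T) k * of_nat ((M + T) choose M) =
     (-1) ^ k * (of_nat ((M + T) choose (M + k)) :: 'a :: field_char_0)"
proof (induction k)
  case (Suc k)
  have nz: "(of_nat k + (of_nat M + 1) :: 'a) \<noteq> 0"
  proof -
    have "(of_nat k + (of_nat M + 1) :: 'a) = of_nat (Suc (k + M))" by simp
    then show ?thesis by (simp only: of_nat_eq_0_iff)
  qed
  have "(of_nat T - of_nat k) * of_nat ((M + T) choose (M + k)) =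
      (of_nat k + (of_nat M + 1)) * (of_nat ((M + T) choose (M + Suc k)) :: 'a)"
  proof (cases "k \<le> T")
    case True
    have "Suc (M + k) * ((M + T) choose Suc (M + k)) = (M + T - (M + k)) * ((M + T) choose (M + k))"
      by (simp only: binomial_absorption binomial_absorb_comp)
    then have "(of_nat (Suc (M + k)) * of_nat ((M + T) choose Suc (M + k)) :: 'a) =
        of_nat (T - k) * of_nat ((M + T) choose (M + k))"
      by (simp only: add_diff_cancel_left of_nat_mult[symmetric])
    then show ?thesis using True by (simp add: of_nat_diff algebra_simps)
  qed (simp add: binomial_eq_0)
  moreover have "eig_coeff (of_nat M) (of_nat T) (Suc k) * (of_nat ((M + T) choose M) :: 'a) =
      - ((of_nat T - of_nat k) * (eig_coeff (of_nat M) (of_nat T) k * of_nat ((M + T) choose M))) /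
      (of_nat k + (of_nat M + 1))"
  proof -
    have "E * ((a - b) / d) * C = - ((b - a) * (E * C)) / d" for E C a b d :: 'a
    proof -
      have "E * (a - b) * C = - ((b - a) * (E * C))" by (simp add: algebra_simps)
      then show ?thesis by (simp only: times_divide_eq_right times_divide_eq_left)
    qed
    then show ?thesis by (simp only: eig_coeff_def prod.lessThan_Suc)
  qed
  ultimately show ?case unfolding Suc using nz
    by (simp add: mult.left_commute[of _ "(-1) ^ k"] nonzero_divide_eq_eq)
qed (simp add: eig_coeff_def)

lemma eigenvector_sum:
  assumes odd: "odd CARD('p)" and c: "c < CARD('p)" and I: "T \<le> I"
  shows "(\<Sum>k\<le>I. eig_coeff (of_nat M) (of_nat T) k * frob_mat m c (of_nat M :: 'p :: prime_card padic) k 0) *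
      of_nat ((M + T) choose M) =
    (-1) ^ (M + (m + CARD('p) * M)) * of_nat ((c + CARD('p) * (M + T)) choose (m + CARD('p) * M))"
proof -
  let ?p = "CARD('p)"
  have "(\<Sum>k\<le>I. eig_coeff (of_nat M) (of_nat T) k * frob_mat m c (of_nat M :: 'p padic) k 0) *
      of_nat ((M + T) choose M) =
      (\<Sum>k\<le>I. (eig_coeff (of_nat M) (of_nat T) k * of_nat ((M + T) choose M)) * frob_mat m c (of_nat M :: 'p padic) k 0)"
    unfolding sum_distrib_right by (intro sum.cong refl) (simp only: mult_ac)
  also have "\<dots> = (\<Sum>k\<le>I. (-1) ^ k * of_nat ((M + T) choose (M + k)) * frob_mat m c (of_nat M :: 'p padic) k 0)"
    by (simp only: eig_coeff_of_nat)
  also have "\<dots> = (\<Sum>k\<le>T. (-1) ^ k * of_nat ((M + T) choose (M + k)) * frob_mat m c (of_nat M :: 'p padic) k 0)"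
    using I by (intro sum.mono_neutral_right) (auto simp: not_le)
  also have "\<dots> = of_int (\<Sum>k\<le>T. (-1) ^ k * int ((M + T) choose (M + k)) *
      coeff (frob_poly ?p c (M + k)) (m + ?p * M))"
    by (simp add: frob_mat_of_nat[OF odd])
  also have "\<dots> = of_int ((-1) ^ (M + (m + ?p * M)) * int ((c + ?p * (M + T)) choose (m + ?p * M)))"
    by (simp only: eigenvector_sum_nat[OF c])
  finally show ?thesis by simp
qed

lemma padic_abs_add_eq:
  assumes "padic_abs x < padic_abs y"
  shows "padic_abs (x + y) = padic_abs y"
proof (rule antisym)
  show "padic_abs (x + y) \<le> padic_abs y" using assms by (intro padic_abs_add_le) auto
  show "padic_abs y \<le> padic_abs (x + y)"
    using padic_abs_ultrametric[of "x + y" "- x"] assms unfolding padic_abs_minus by simp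
qed

text \<open>By \<open>2 * M + 1 = p ^ f\<close> a denominator \<open>i + M + 1\<close> is half of
  \<open>p ^ f + (2 * i + 1)\<close>. As \<open>2 * i + 1 < p ^ f\<close>, the second summand
  dominates in absolute value, so the denominators are as large as those in
  \<open>pochhammer (1 / 2) k\<close>. The bound does not depend on \<open>f\<close>.\<close>

lemma padic_abs_eig_coeff_le:
  assumes odd: "odd CARD('p)" and M: "2 * M + 1 = CARD('p) ^ f" and T: "2 * T < CARD('p) ^ f" and k: "k \<le> T"
  shows "padic_abs (eig_coeff (of_nat M) (of_nat T) k :: 'p :: prime_card padic) \<le> 2 * real k + 1"
proof -
  let ?p = "CARD('p)"
  have half: "padic_abs (of_nat i + (of_nat M + 1) :: 'p padic) = padic_abs (1 / 2 + of_nat i :: 'p padic)" if "i < k" for i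
  proof -
    have "\<not> ?p ^ f dvd 2 * i + 1" using that k T by (intro nat_dvd_not_less) simp_all
    then have "\<not> int ?p ^ f dvd int (2 * i + 1)" by (simp only: int_dvd_int_iff flip: of_nat_power) simp
    then have "1 / real ?p ^ f < padic_abs (of_nat (2 * i + 1) :: 'p padic)"
      using padic_abs_of_int_le_power_iff[of "int (2 * i + 1)" f, where 'p = 'p]
      unfolding of_int_of_nat_eq by linarith
    then have "padic_abs (of_nat (?p ^ f) + of_nat (2 * i + 1) :: 'p padic) = padic_abs (of_nat (2 * i + 1) :: 'p padic)"
      by (intro padic_abs_add_eq) (simp add: padic_abs_power padic_abs_card power_divide)
    moreover have "(of_nat (?p ^ f) + of_nat (2 * i + 1) :: 'p padic) = 2 * (of_nat i + (of_nat M + 1))"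
      unfolding M[symmetric] by simp
    moreover have "(of_nat (2 * i + 1) :: 'p padic) = 2 * (1 / 2 + of_nat i)" by simp
    ultimately have "padic_abs (2 :: 'p padic) * padic_abs (of_nat i + (of_nat M + 1) :: 'p padic) =
        padic_abs (2 :: 'p padic) * padic_abs (1 / 2 + of_nat i :: 'p padic)"
      by (simp only: padic_abs_mult)
    moreover have "padic_abs (2 :: 'p padic) \<noteq> 0" by simp
    ultimately show ?thesis using mult_left_cancel by blast
  qed
  have num: "(\<Prod>i<k. of_nat i - of_nat T) = (-1) ^ k * (fact k * of_nat (T choose k) :: 'p padic)"
  proof -
    have "(\<Prod>i<k. of_nat i - of_nat T) = pochhammer (- of_nat T :: 'p padic) k"
      unfolding pochhammer_prod lessThan_atLeast0 by (intro prod.cong) simp_all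
    then show ?thesis
      by (simp add: binomial_gbinomial gbinomial_pochhammer flip: power_mult_distrib mult.assoc)
  qed
  have "padic_abs (eig_coeff (of_nat M) (of_nat T) k :: 'p padic) =
      padic_abs (\<Prod>i<k. of_nat i - of_nat T :: 'p padic) / padic_abs (\<Prod>i<k. of_nat i + (of_nat M + 1) :: 'p padic)"
    by (simp only: eig_coeff_def prod_dividef padic_abs_divide)
  also have "padic_abs (\<Prod>i<k. of_nat i + (of_nat M + 1) :: 'p padic) = padic_abs (pochhammer (1 / 2) k :: 'p padic)"
    unfolding pochhammer_prod lessThan_atLeast0[symmetric] padic_abs_prod by (intro prod.cong half) simp_all
  also have "padic_abs (\<Prod>i<k. of_nat i - of_nat T :: 'p padic) \<le> padic_abs (fact k :: 'p padic)"
    unfolding num by (simp add: padic_abs_mult padic_abs_power mult_left_le)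
  finally have "padic_abs (eig_coeff (of_nat M) (of_nat T) k :: 'p padic) \<le>
      padic_abs (fact k / pochhammer (1 / 2) k :: 'p padic)"
    by (simp add: padic_abs_divide divide_right_mono)
  also have "\<dots> \<le> 2 * real k + 1" by (rule padic_abs_fact_div_pochhammer_half_le[OF odd])
  finally show ?thesis .
qed

lemma tendsto_eig_coeff:
  assumes "(f \<longlongrightarrow> (x :: 'p :: prime_card padic)) F" "(g \<longlongrightarrow> y) F" "\<And>i. of_nat i + (x + 1) \<noteq> 0"
  shows "((\<lambda>n. eig_coeff (f n) (g n) k) \<longlongrightarrow> eig_coeff x y k) F"
  unfolding eig_coeff_def
  by (intro tendsto_prod' tendsto_divide_padic tendsto_diff tendsto_add tendsto_const assms)

lemma padic_tendstoI_le:
  assumes "\<And>e. e > 0 \<Longrightarrow> \<forall>\<^sub>F n in F. padic_abs (f n - L) \<le> e"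
  shows "(f \<longlongrightarrow> (L :: 'p :: prime_card padic)) F"
proof (rule tendstoI)
  fix e :: real assume "e > 0"
  then have "\<forall>\<^sub>F n in F. padic_abs (f n - L) \<le> e / 2" by (intro assms) simp
  then show "\<forall>\<^sub>F n in F. dist (f n) L < e"
    by eventually_elim (use \<open>e > 0\<close> in \<open>simp add: dist_padic_def\<close>)
qed

text \<open>For fixed \<open>f\<close> the sum ends at \<open>T f\<close> and equals the binomial
  quotient. The summands are bounded by a null sequence in \<open>k\<close> independent of
  \<open>f\<close>, so truncation at a large fixed \<open>I\<close> and termwise convergence
  suffice.\<close>

lemma eigenvalue_limit:
  fixes y L :: "'p :: prime_card padic" and c :: nat
  assumes odd: "odd CARD('p)" and c: "c < CARD('p)"
  defines "m \<equiv> (CARD('p) - 1) div 2"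
  assumes T: "(\<lambda>f. of_nat (T f)) \<longlonglongrightarrow> y" "\<And>f. T f \<le> CARD('p) ^ f"
  assumes L: "(\<lambda>I. \<Sum>i\<le>I. eig_coeff (- 1 / 2) y i * frob_mat m c (- 1 / 2) i 0) \<longlonglongrightarrow> L"
  defines "M \<equiv> \<lambda>f. m * geo CARD('p) (Suc f)"
  shows "(\<lambda>f. (-1) ^ (M f + (m + CARD('p) * M f)) *
      of_nat ((c + CARD('p) * (M f + T f)) choose (m + CARD('p) * M f)) /
      of_nat ((M f + T f) choose M f)) \<longlonglongrightarrow> L" (is "?G \<longlonglongrightarrow> L")
proof -
  let ?p = "CARD('p)"
  note halves = odd_card_halves[OF odd, folded m_def]
  define S where "S f I = (\<Sum>i\<le>I. eig_coeff (of_nat (M f)) (of_nat (T f)) i * frob_mat m c (of_nat (M f) :: 'p padic) i 0)" for f I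
  define S' where "S' I = (\<Sum>i\<le>I. eig_coeff (- 1 / 2) y i * frob_mat m c (- 1 / 2) i 0)" for I
  txt \<open>The index shift in \<open>M\<close> ensures \<open>2 * T f < 2 * M f + 1\<close>, which bounds the denominators of \<open>eig_coeff\<close>.\<close>
  have Mf: "2 * M f + 1 = ?p ^ Suc f" for f
  proof -
    have "2 * m = ?p - 1" using halves(1) by simp
    then have "2 * M f + 1 = (?p - 1) * geo ?p (Suc f) + 1" by (simp add: M_def flip: mult.assoc)
    then show ?thesis unfolding geo_eq[OF prime_ge_1_nat[OF prime_card[where 'a = 'p]]] .
  qed
  have M: "(\<lambda>f. of_nat (M f)) \<longlonglongrightarrow> (- 1 / 2 :: 'p padic)"
    unfolding M_def m_def by (rule LIMSEQ_Suc[OF tendsto_half_card_geo[OF odd]])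
  have G: "?G f = S f I" if "T f \<le> I" for f I
  proof -
    have "S f I * of_nat ((M f + T f) choose M f) = (-1) ^ (M f + (m + ?p * M f)) *
        of_nat ((c + ?p * (M f + T f)) choose (m + ?p * M f))"
      unfolding S_def by (rule eigenvector_sum[OF odd c that])
    moreover have "(of_nat ((M f + T f) choose M f) :: 'p padic) \<noteq> 0" by simp
    ultimately have "S f I = ?G f" by (simp only: nonzero_eq_divide_eq not_False_eq_True)
    then show ?thesis ..
  qed
  have summand: "padic_abs (eig_coeff (of_nat (M f)) (of_nat (T f)) k * frob_mat m c (of_nat (M f) :: 'p padic) k 0)
      \<le> (real k + 1) * (2 * real k + 1) / real ?p ^ k" if "k \<le> T f" for f k
  proof -
    have "?p \<ge> 3" using halves by simp
    then have "3 * ?p ^ f \<le> ?p ^ Suc f" by simp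
    moreover have "?p ^ f > 0" by simp
    ultimately have "2 * T f < ?p ^ Suc f" using T(2)[of f] by linarith
    then have "padic_abs (eig_coeff (of_nat (M f)) (of_nat (T f)) k :: 'p padic) \<le> 2 * real k + 1"
      by (rule padic_abs_eig_coeff_le[OF odd Mf _ that])
    moreover have "padic_abs (frob_mat m c (of_nat (M f) :: 'p padic) k 0) \<le> 1 / real ?p ^ k"
      by (rule padic_abs_frob_mat_le[OF odd tendsto_const]) (simp_all add: m_def)
    ultimately have "padic_abs (eig_coeff (of_nat (M f)) (of_nat (T f)) k * frob_mat m c (of_nat (M f) :: 'p padic) k 0)
        \<le> (2 * real k + 1) * (1 / real ?p ^ k)" by (rule padic_abs_mult_le)
    also have "\<dots> \<le> (real k + 1) * (2 * real k + 1) / real ?p ^ k"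
      by (simp add: divide_right_mono)
    finally show ?thesis .
  qed
  show ?thesis
  proof (rule padic_tendstoI_le)
    fix e :: real assume e: "e > 0"
    have "\<forall>\<^sub>F k in sequentially. (real k + 1) * (2 * real k + 1) / real ?p ^ k < e"
      by (rule order_tendstoD(2)[OF poly_div_card_power_tendsto_0[OF odd] e])
    moreover have "\<forall>\<^sub>F I in sequentially. dist (S' I) L < e"
      using L e unfolding S'_def by (rule tendstoD)
    ultimately have "\<forall>\<^sub>F I in sequentially. (real I + 1) * (2 * real I + 1) / real ?p ^ I < e \<and> dist (S' I) L < e"
      by (rule eventually_conj)
    then obtain I where I: "\<And>k. k \<ge> I \<Longrightarrow> (real k + 1) * (2 * real k + 1) / real ?p ^ k < e"
      and SI: "dist (S' I) L < e"
      by (auto simp: eventually_sequentially)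
    have "padic_abs (?G f - S f I) \<le> e" for f
    proof (cases "T f \<le> I")
      case True
      then show ?thesis using e by (simp add: G)
    next
      case False
      then have "S f (T f) - S f I = (\<Sum>k\<in>{Suc I..T f}. eig_coeff (of_nat (M f)) (of_nat (T f)) k *
          frob_mat m c (of_nat (M f) :: 'p padic) k 0)"
        unfolding S_def by (subst sum_diff[symmetric]) (auto intro!: sum.cong)
      moreover have "padic_abs \<dots> \<le> e"
        using I e by (intro padic_abs_sum_le) (auto intro!: order.trans[OF summand] less_imp_le[OF I])
      ultimately show ?thesis by (simp only: G[OF order_refl])
    qed
    moreover have "(\<lambda>f. S f I) \<longlonglongrightarrow> S' I"
      unfolding S_def S'_def
    proof (intro tendsto_sum tendsto_mult tendsto_eig_coeff tendsto_frob_mat M T)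
      fix i
      have "(- 1 / 2 + 1 :: 'p padic) = 1 / 2" by simp
      then show "of_nat i + (- 1 / 2 + 1 :: 'p padic) \<noteq> 0" by (simp only: half_add_of_nat_neq_0 not_False_eq_True)
    qed
    then have "\<forall>\<^sub>F f in sequentially. dist (S f I) (S' I) < e" using e by (rule tendstoD)
    ultimately show "\<forall>\<^sub>F f in sequentially. padic_abs (?G f - L) \<le> e"
    proof (elim eventually_mono)
      fix f
      assume "\<And>f. padic_abs (?G f - S f I) \<le> e" and "dist (S f I) (S' I) < e"
      then have "padic_abs ((?G f - S f I) + ((S f I - S' I) + (S' I - L))) \<le> e"
        using SI by (intro padic_abs_add_le) (simp_all add: dist_padic_def)
      then show "padic_abs (?G f - L) \<le> e" by simp
    qed
  qed
qed

section \<open>The Jacobi sum as a product of gamma values\<close>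

text \<open>The factor \<open>\<kappa>\<close> covers two cases at once: it is 1 when
  \<open>Y div p = T\<close>, and \<open>p * T\<close> when \<open>Y div p\<close> is one less than
  \<open>T\<close>.\<close>

lemma binomial_morita_nat:
  fixes N X Y M T :: nat
  assumes XN: "X = N + Y" and div: "X div CARD('p) = M + T" "N div CARD('p) = M"
    and Y: "\<kappa> * fact Y = (-1) ^ Suc Y * morita_nat (Suc Y) * of_nat CARD('p) ^ T * (fact T :: 'p :: prime_card padic)"
  shows "of_nat (X choose N) * morita_nat (Suc N) * morita_nat (Suc Y) =
    - (\<kappa> * of_nat ((M + T) choose M) * (morita_nat (Suc X) :: 'p padic))"
proof -
  let ?P = "of_nat CARD('p) :: 'p padic"
  define B where "B = (of_nat (X choose N) :: 'p padic)"
  define C where "C = (of_nat ((M + T) choose M) :: 'p padic)"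
  have X: "(fact X :: 'p padic) = B * fact N * fact Y"
    by (simp add: B_def binomial_fact XN)
  have MT: "(fact (M + T) :: 'p padic) = C * fact M * fact T"
    by (simp add: C_def binomial_fact)
  have "\<kappa> * fact X = (-1) ^ Suc X * morita_nat (Suc X) * ?P ^ (M + T) * (C * fact M * fact T) * \<kappa>"
    unfolding fact_padic[of X, where 'p = 'p] div MT by (simp only: mult_ac)
  moreover have "\<kappa> * fact X = B * ((-1) ^ Suc N * morita_nat (Suc N) * ?P ^ M * fact M) *
      ((-1) ^ Suc Y * morita_nat (Suc Y) * ?P ^ T * fact T)"
    unfolding X Y[symmetric] fact_padic[of N, where 'p = 'p] div by (simp only: mult_ac)
  ultimately have "(-1) ^ X * (?P ^ (M + T) * fact M * fact T) * (B * morita_nat (Suc N) * morita_nat (Suc Y)) =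
      (-1) ^ X * (?P ^ (M + T) * fact M * fact T) * (- (\<kappa> * C * morita_nat (Suc X)))"
    by (simp add: XN power_add mult_ac)
  moreover have "(-1) ^ X * (?P ^ (M + T) * fact M * fact T) \<noteq> 0" by simp
  ultimately have "B * morita_nat (Suc N) * morita_nat (Suc Y) = - (\<kappa> * C * morita_nat (Suc X))"
    using mult_left_cancel by blast
  then show ?thesis by (simp only: B_def C_def)
qed

lemma gamma_reflection:
  assumes odd: "odd CARD('p)" and e: "e < CARD('p) - 1"
  defines "x \<equiv> of_nat e / (of_nat CARD('p) - 1) :: 'p :: prime_card padic"
  shows "morita_Gamma x * morita_Gamma (1 - x) = - ((-1) ^ e)"
proof -
  let ?p = "CARD('p)"
  define t where "t f = e * geo ?p f" for f
  have t: "t f < ?p ^ f" for f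
  proof -
    have "t f \<le> (?p - 1) * geo ?p f" using e by (simp add: t_def)
    then show ?thesis using geo_eq[OF prime_ge_1_nat[OF prime_card[where 'a = 'p]], of f] by linarith
  qed
  have lim: "(\<lambda>f. of_nat (t f)) \<longlonglongrightarrow> - x" unfolding t_def x_def by (rule tendsto_mult_geo)
  have 1: "(\<lambda>f. morita_nat (?p ^ f - t f)) \<longlonglongrightarrow> morita_Gamma x"
  proof (rule tendsto_morita_nat[OF odd])
    have "(\<lambda>f. of_nat ?p ^ f - of_nat (t f)) \<longlonglongrightarrow> 0 - - x"
      by (intro tendsto_diff tendsto_card_power lim)
    then show "(\<lambda>f. of_nat (?p ^ f - t f)) \<longlonglongrightarrow> x"
      using less_imp_le[OF t] by (simp add: of_nat_diff)
  qed
  have 2: "(\<lambda>f. morita_nat (Suc (t f))) \<longlonglongrightarrow> morita_Gamma (1 - x)"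
  proof (rule tendsto_morita_nat[OF odd])
    have "(\<lambda>f. 1 + of_nat (t f)) \<longlonglongrightarrow> 1 + - x"
      by (intro tendsto_add tendsto_const lim)
    then show "(\<lambda>f. of_nat (Suc (t f))) \<longlonglongrightarrow> 1 - x" by simp
  qed
  \<comment> \<open>All \<open>f\<close> base-\<open>p\<close> digits of \<open>t f\<close> equal
    \<open>e\<close>. Dropping the last digit of \<open>t (Suc f)\<close> gives \<open>t f\<close>,
    and the difference \<open>e * p ^ f\<close> has the parity of \<open>e\<close>.\<close>
  have sign: "(-1 :: 'p padic) ^ (t (Suc f) - t (Suc f) div ?p) = (-1) ^ e" for f
  proof -
    have "t (Suc f) = e + ?p * t f" by (simp add: t_def geo_Suc algebra_simps)
    moreover have "e < ?p" using e by simp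
    ultimately have "t (Suc f) div ?p = t f" by simp
    moreover have "t (Suc f) = t f + e * ?p ^ f"
      unfolding t_def geo_def by (simp add: algebra_simps)
    ultimately have "t (Suc f) - t (Suc f) div ?p = e * ?p ^ f" by simp
    moreover have "even (e * ?p ^ f) \<longleftrightarrow> even e" using odd by simp
    ultimately show ?thesis by (simp only: minus_one_power_iff)
  qed
  have "(\<lambda>f. morita_nat (?p ^ Suc f - t (Suc f)) * morita_nat (Suc (t (Suc f))) + (-1) ^ e) \<longlonglongrightarrow> (0 :: 'p padic)"
    unfolding padic_tendsto_iff diff_0_right
  proof (rule tendsto_sandwich[OF _ _ tendsto_const LIMSEQ_Suc[OF inverse_card_power_tendsto_0[where 'p = 'p]]])
    have "padic_abs (morita_nat (?p ^ Suc f - t (Suc f)) * morita_nat (Suc (t (Suc f))) +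
        (-1) ^ e :: 'p padic) \<le> 1 / real ?p ^ Suc f" for f
      using morita_nat_reflection[OF odd t[of "Suc f"]] unfolding sign .
    then show "\<forall>\<^sub>F f in sequentially. padic_abs (morita_nat (?p ^ Suc f - t (Suc f)) * morita_nat (Suc (t (Suc f))) +
        (-1) ^ e :: 'p padic) \<le> 1 / real ?p ^ Suc f"
      by (intro always_eventually allI)
  qed simp
  moreover have "(\<lambda>f. morita_nat (?p ^ Suc f - t (Suc f)) * morita_nat (Suc (t (Suc f))) + (-1) ^ e) \<longlonglongrightarrow>
      morita_Gamma x * morita_Gamma (1 - x) + (-1) ^ e"
    by (intro tendsto_add tendsto_mult tendsto_const LIMSEQ_Suc[OF 1] LIMSEQ_Suc[OF 2])
  ultimately have "morita_Gamma x * morita_Gamma (1 - x) + (-1) ^ e = 0"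
    by (rule LIMSEQ_unique[symmetric])
  then show ?thesis by (simp only: eq_neg_iff_add_eq_0)
qed

text \<open>The trace is \<open>J / (p - 1)\<close>, hence the eigenvalue is \<open>- J\<close>. In
  the binomial coefficient \<open>X\<close> over \<open>N\<close>, \<open>Suc (N f)\<close> tends to
  \<open>1/2\<close> and \<open>Suc (X f)\<close> to \<open>r\<close>. The difference
  \<open>Y = X - N\<close> depends on how \<open>r - 1/2\<close> is approximated, so
  \<open>T\<close>, \<open>Y\<close> and \<open>\<kappa>\<close> are left open.\<close>

lemma jacobi_gamma_aux:
  fixes j :: nat and T :: "nat \<Rightarrow> nat" and r :: "'p :: prime_card padic"
  assumes odd: "odd CARD('p)" and j: "j < CARD('p) - 1"
  defines "m \<equiv> (CARD('p) - 1) div 2" and "r \<equiv> of_nat j / (of_nat CARD('p) - 1) :: 'p padic"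
  defines "J \<equiv> (\<Sum>t\<in>- {0, 1}. teichmuller (t :: 'p mod_ring) ^ (CARD('p) - 1 - j) * inverse (teichmuller (1 - t)) ^ m)"
  assumes T: "(\<lambda>f. of_nat (T f)) \<longlonglongrightarrow> r - 1 / 2" "\<And>f. T f \<le> CARD('p) ^ f"
    and Y: "\<And>f. Y f + j = m + CARD('p) * T f"
    and \<kappa>: "\<And>f. \<kappa> f * fact (Y f) = (-1) ^ Suc (Y f) * morita_nat (Suc (Y f)) * of_nat CARD('p) ^ T f * (fact (T f) :: 'p padic)"
      "\<kappa> \<longlonglongrightarrow> k"
    and Z: "(\<lambda>f. morita_nat (Suc (Y f))) \<longlonglongrightarrow> z"
  shows "J * morita_Gamma (1 / 2) * z = (-1) ^ m * k * morita_Gamma r"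
proof -
  let ?p = "CARD('p)"
  note halves = odd_card_halves[OF odd, folded m_def]
  define c where "c = ?p - 1 - j"
  define M where "M f = m * geo ?p (Suc f)" for f
  define N where "N f = m + ?p * M f" for f
  define X where "X f = c + ?p * (M f + T f)" for f
  have c: "0 < c" "c < ?p" using j by (simp_all add: c_def)
  have m: "m < ?p" using halves by simp
  have pr: "(of_nat ?p - 1) * r = of_nat j"
    unfolding r_def times_divide_eq_right by (rule nonzero_mult_div_cancel_left[OF card_minus_1_neq_0])
  let ?\<alpha> = "frob_mat m c (- 1 / 2 :: 'p padic)"
  have "(\<lambda>I. \<Sum>i\<le>I. eig_coeff (- 1 / 2) (r - 1 / 2) i * ?\<alpha> i 0) \<longlonglongrightarrow> - J"
  proof -
    have "(\<lambda>I. \<Sum>k<Suc I. ?\<alpha> k k) \<longlonglongrightarrow> J / (of_nat ?p - 1)"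
      unfolding J_def m_def c_def[symmetric] by (intro LIMSEQ_Suc[OF frob_trace_limit[OF odd c]])
    then have "(\<lambda>I. (1 - of_nat ?p) * (\<Sum>k\<le>I. ?\<alpha> k k)) \<longlonglongrightarrow> (1 - of_nat ?p) * (J / (of_nat ?p - 1))"
      unfolding lessThan_Suc_atMost by (rule tendsto_mult_left)
    moreover have "(1 - of_nat ?p) * (J / (of_nat ?p - 1)) = - J"
    proof -
      have "(1 - b) * (J / (b - 1)) = - J" if "b - 1 \<noteq> 0" for b
        using that by (simp add: field_simps)
      then show ?thesis using card_minus_1_neq_0 by blast
    qed
    ultimately have "(\<lambda>I. (1 - of_nat ?p) * (\<Sum>k\<le>I. ?\<alpha> k k)) \<longlonglongrightarrow> - J" by (simp only:)
    from tendsto_diff[OF this trace_eq_eigenvalue[OF odd, of j, folded m_def r_def c_def]]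
    show ?thesis using j by simp
  qed
  then have G: "(\<lambda>f. (-1) ^ (M f + N f) * of_nat (X f choose N f) / of_nat ((M f + T f) choose M f)) \<longlonglongrightarrow> - J"
    unfolding M_def N_def X_def m_def by (intro eigenvalue_limit[OF odd c(2) T]) (simp_all add: m_def)
  have M: "(\<lambda>f. of_nat (M f)) \<longlonglongrightarrow> (- 1 / 2 :: 'p padic)"
    unfolding M_def m_def by (rule LIMSEQ_Suc[OF tendsto_half_card_geo[OF odd]])
  have P: "(of_nat ?p :: 'p padic) = 2 * of_nat m + 1" by (rule halves(3))
  have N: "(\<lambda>f. morita_nat (Suc (N f))) \<longlonglongrightarrow> morita_Gamma (1 / 2 :: 'p padic)"
  proof (rule tendsto_morita_nat[OF odd])
    have "(\<lambda>f. of_nat m + of_nat ?p * of_nat (M f) + 1) \<longlonglongrightarrow> of_nat m + of_nat ?p * (- 1 / 2) + (1 :: 'p padic)"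
      by (intro tendsto_add tendsto_mult tendsto_const M)
    also have "of_nat m + of_nat ?p * (- 1 / 2) + (1 :: 'p padic) = 1 / 2" unfolding P by (simp add: field_simps)
    finally show "(\<lambda>f. of_nat (Suc (N f))) \<longlonglongrightarrow> (1 / 2 :: 'p padic)" by (simp add: N_def add_ac)
  qed
  have X: "(\<lambda>f. morita_nat (Suc (X f))) \<longlonglongrightarrow> morita_Gamma r"
  proof (rule tendsto_morita_nat[OF odd])
    have "(\<lambda>f. of_nat c + of_nat ?p * (of_nat (M f) + of_nat (T f)) + 1) \<longlonglongrightarrow>
        of_nat c + of_nat ?p * (- 1 / 2 + (r - 1 / 2)) + 1"
      by (intro tendsto_add tendsto_mult tendsto_const M T)
    also have "of_nat c + of_nat ?p * (- 1 / 2 + (r - 1 / 2)) + 1 = r"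
    proof -
      have "(of_nat (c + j + 1) :: 'p padic) = of_nat ?p" using j by (simp add: c_def)
      then have "(of_nat c :: 'p padic) = of_nat ?p - 1 - of_nat j" by (simp add: algebra_simps)
      moreover have "- 1 / 2 + (r - 1 / 2) = r - 1" by simp
      ultimately show ?thesis using pr by (simp add: algebra_simps)
    qed
    finally show "(\<lambda>f. of_nat (Suc (X f))) \<longlonglongrightarrow> r" by (simp add: X_def add_ac)
  qed
  have eq: "((-1) ^ (M f + N f) * of_nat (X f choose N f) / of_nat ((M f + T f) choose M f)) *
      morita_nat (Suc (N f)) * morita_nat (Suc (Y f)) =
      (-1) ^ Suc m * \<kappa> f * (morita_nat (Suc (X f)) :: 'p padic)" for f
  proof -
    have XN: "X f = N f + Y f"
      using Y[of f] j halves(1) by (simp add: X_def N_def c_def algebra_simps)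
    have div: "X f div ?p = M f + T f" "N f div ?p = M f"
      using c m by (simp_all add: X_def N_def)
    have "even (M f + N f) \<longleftrightarrow> even m" using odd by (auto simp: N_def)
    then have sign: "(-1 :: 'p padic) ^ (M f + N f) = (-1) ^ m" by (simp only: minus_one_power_iff)
    have nz: "(of_nat ((M f + T f) choose M f) :: 'p padic) \<noteq> 0" by simp
    have "((-1) ^ (M f + N f) * of_nat (X f choose N f) / of_nat ((M f + T f) choose M f)) *
        morita_nat (Suc (N f)) * morita_nat (Suc (Y f)) =
        (-1) ^ m * (of_nat (X f choose N f) * morita_nat (Suc (N f)) * morita_nat (Suc (Y f))) /
        (of_nat ((M f + T f) choose M f) :: 'p padic)"
      unfolding sign by (simp only: times_divide_eq_left times_divide_eq_right mult_ac)
    also have "\<dots> = (-1) ^ m * - (\<kappa> f * morita_nat (Suc (X f)))"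
      unfolding binomial_morita_nat[OF XN div \<kappa>(1)] using nz by simp
    finally show ?thesis by simp
  qed
  have "(\<lambda>f. ((-1) ^ (M f + N f) * of_nat (X f choose N f) / of_nat ((M f + T f) choose M f)) *
      morita_nat (Suc (N f)) * morita_nat (Suc (Y f))) \<longlonglongrightarrow> - J * morita_Gamma (1 / 2) * z"
    by (intro tendsto_mult G N Z)
  moreover have "(\<lambda>f. (-1) ^ Suc m * \<kappa> f * morita_nat (Suc (X f))) \<longlonglongrightarrow> (-1) ^ Suc m * k * morita_Gamma r"
    by (intro tendsto_mult tendsto_const \<kappa>(2) X)
  ultimately have "- J * morita_Gamma (1 / 2) * z = (-1) ^ Suc m * k * morita_Gamma r"
    unfolding eq by (rule LIMSEQ_unique)
  then show ?thesis by simp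
qed

text \<open>Naturals must approach \<open>r - 1/2 = (j - m) / (p - 1)\<close>. For
  \<open>j \<le> m\<close> multiples of \<open>geo\<close> do so directly; for \<open>j > m\<close>
  they are subtracted from \<open>p ^ f\<close>, and the borrow creates the factor \<open>p\<close>.
  Both choices satisfy \<open>Y f = T (Suc f)\<close>, and reflection moves the gamma value of
  \<open>Y\<close> to the other side.\<close>

lemma jacobi_gamma:
  fixes j :: nat and r :: "'p :: prime_card padic"
  assumes odd: "odd CARD('p)" and j: "j < CARD('p) - 1"
  defines "m \<equiv> (CARD('p) - 1) div 2" and "r \<equiv> of_nat j / (of_nat CARD('p) - 1) :: 'p padic"
  defines "J \<equiv> (\<Sum>t\<in>- {0, 1}. teichmuller (t :: 'p mod_ring) ^ (CARD('p) - 1 - j) * inverse (teichmuller (1 - t)) ^ m)"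
  shows "J * morita_Gamma (1 / 2) = (-1) ^ Suc j *
    (if j \<le> m then morita_Gamma (1 / 2 - r) * morita_Gamma r
     else - of_nat CARD('p) * (morita_Gamma (3 / 2 - r) * morita_Gamma r))"
proof -
  let ?p = "CARD('p)"
  note halves = odd_card_halves[OF odd, folded m_def]
  have ge1: "?p \<ge> 1" using prime_ge_1_nat[OF prime_card] .
  have sq: "(-1) ^ n * ((-1) ^ n * x) = x" for n and x :: "'p padic"
    by (simp flip: mult.assoc power_mult_distrib)
  show ?thesis
  proof (cases "j \<le> m")
    case True
    define e where "e = m - j"
    have m: "m = e + j" using True by (simp add: e_def)
    have e1: "e < ?p - 1" using halves(1,2) by (simp add: e_def)
    define T where "T f = e * geo ?p f" for f
    define Y where "Y f = e + ?p * T f" for f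
    have x: "of_nat e / (of_nat ?p - 1) = 1 / 2 - r"
      using halves(4) True by (simp add: e_def of_nat_diff diff_divide_distrib r_def)
    have T: "(\<lambda>f. of_nat (T f)) \<longlonglongrightarrow> r - 1 / 2"
      using tendsto_mult_geo[of e, where 'p = 'p] unfolding T_def x by simp
    have Tle: "T f \<le> ?p ^ f" for f
    proof -
      have "T f \<le> (?p - 1) * geo ?p f" using e1 by (simp add: T_def)
      then show ?thesis using geo_eq[OF ge1, of f] by linarith
    qed
    have Z: "(\<lambda>f. morita_nat (Suc (Y f))) \<longlonglongrightarrow> morita_Gamma (1 - (1 / 2 - r))"
    proof (rule tendsto_morita_nat[OF odd])
      have "Y f = T (Suc f)" for f by (simp add: Y_def T_def geo_Suc algebra_simps)
      moreover have "(\<lambda>f. 1 + of_nat (T (Suc f))) \<longlonglongrightarrow> 1 + (r - 1 / 2)"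
        by (intro tendsto_add tendsto_const LIMSEQ_Suc[OF T])
      moreover have "1 + (r - 1 / 2) = 1 - (1 / 2 - r)" by simp
      ultimately show "(\<lambda>f. of_nat (Suc (Y f))) \<longlonglongrightarrow> 1 - (1 / 2 - r)"
        by (simp only: of_nat_Suc)
    qed
    have "J * morita_Gamma (1 / 2) * morita_Gamma (1 - (1 / 2 - r)) = (-1) ^ m * 1 * morita_Gamma r"
      unfolding J_def m_def r_def
    proof (rule jacobi_gamma_aux[OF odd j T[unfolded r_def] Tle, of Y "\<lambda>_. 1"])
      show "Y f + j = (?p - 1) div 2 + ?p * T f" for f
        unfolding m_def[symmetric] by (simp add: Y_def m)
      show "1 * fact (Y f) = (-1) ^ Suc (Y f) * morita_nat (Suc (Y f)) * of_nat ?p ^ T f * (fact (T f) :: 'p padic)" for f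
      proof -
        have "Y f div ?p = T f" using e1 by (simp add: Y_def)
        then show ?thesis using fact_padic[of "Y f", where 'p = 'p] by simp
      qed
    qed (use Z in \<open>simp_all only: tendsto_const r_def\<close>)
    note K = this
    have "J * morita_Gamma (1 / 2) * - ((-1) ^ e) =
        J * morita_Gamma (1 / 2) * (morita_Gamma (1 / 2 - r) * morita_Gamma (1 - (1 / 2 - r)))"
      using gamma_reflection[OF odd e1] unfolding x by (simp only:)
    also have "\<dots> = morita_Gamma (1 / 2 - r) *
        (J * morita_Gamma (1 / 2) * morita_Gamma (1 - (1 / 2 - r)))"
      by (simp only: mult_ac)
    also have "\<dots> = (-1) ^ e * ((-1) ^ j * (morita_Gamma (1 / 2 - r) * morita_Gamma r))"
      unfolding K by (simp add: m power_add mult_ac)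
    finally have eq: "J * morita_Gamma (1 / 2) * - ((-1) ^ e) =
        (-1) ^ e * ((-1) ^ j * (morita_Gamma (1 / 2 - r) * morita_Gamma r))" .
    have "(-1) ^ e * (J * morita_Gamma (1 / 2)) = - (J * morita_Gamma (1 / 2) * - ((-1) ^ e))"
      by (simp add: mult_ac)
    also have "\<dots> = (-1) ^ e * ((-1) ^ Suc j * (morita_Gamma (1 / 2 - r) * morita_Gamma r))"
      unfolding eq by simp
    finally have "(-1) ^ e * (J * morita_Gamma (1 / 2)) =
        (-1) ^ e * ((-1) ^ Suc j * (morita_Gamma (1 / 2 - r) * morita_Gamma r))" .
    moreover have "(-1) ^ e \<noteq> (0 :: 'p padic)" by simp
    ultimately have Jg: "J * morita_Gamma (1 / 2) = (-1) ^ Suc j * (morita_Gamma (1 / 2 - r) * morita_Gamma r)"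
      using mult_left_cancel by blast
    show ?thesis unfolding Jg if_P[OF True] ..
  next
    case False
    define e where "e = j - m"
    have je: "j = m + e" using False by (simp add: e_def)
    have e0: "0 < e" using False by (simp add: e_def)
    have e1: "e < ?p - 1" using j by (simp add: e_def)
    define t where "t f = e * geo ?p f" for f
    define T where "T f = ?p ^ f - t f" for f
    define Y where "Y f = T (Suc f)" for f
    have x: "of_nat e / (of_nat ?p - 1) = r - 1 / 2"
      using halves(4) False by (simp add: e_def of_nat_diff diff_divide_distrib r_def)
    have t: "t f < ?p ^ f" for f
    proof -
      have "t f \<le> (?p - 1) * geo ?p f" using e1 by (simp add: t_def)
      then show ?thesis using geo_eq[OF ge1, of f] by linarith
    qed
    have lt: "(\<lambda>f. of_nat (t f)) \<longlonglongrightarrow> - (r - 1 / 2)"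
      using tendsto_mult_geo[of e, where 'p = 'p] unfolding t_def x .
    have T: "(\<lambda>f. of_nat (T f)) \<longlonglongrightarrow> r - 1 / 2"
    proof -
      have "(\<lambda>f. of_nat ?p ^ f - of_nat (t f)) \<longlonglongrightarrow> 0 - - (r - 1 / 2)"
        by (intro tendsto_diff tendsto_card_power lt)
      then show ?thesis using less_imp_le[OF t] by (simp add: T_def of_nat_diff)
    qed
    have Tpos: "T f > 0" for f using t[of f] by (simp add: T_def)
    have Ye: "Y f + e = ?p * T f" for f
    proof -
      have "t (Suc f) = e + ?p * t f" by (simp add: t_def geo_Suc algebra_simps)
      moreover have "?p * T f + ?p * t f = ?p * ?p ^ f"
        using t[of f] by (simp add: T_def flip: distrib_left)
      ultimately show ?thesis using t[of "Suc f"] by (simp add: Y_def T_def)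
    qed
    have nd: "\<not> ?p dvd Y f" for f
    proof
      assume "?p dvd Y f"
      moreover have "?p dvd Y f + e" unfolding Ye by simp
      ultimately have "?p dvd e" by (simp only: dvd_add_right_iff)
      then have "?p \<le> e" using e0 by (rule dvd_imp_le)
      then show False using e1 by simp
    qed
    \<comment> \<open>\<open>Y f\<close> is prime to \<open>p\<close>, so one factor can be split
      off the product. Its limit \<open>- (r - 1/2)\<close> later cancels against the limit
      \<open>p * (r - 1/2)\<close> of \<open>\<kappa>\<close>, leaving only
      \<open>p\<close>.\<close>
    have Z: "(\<lambda>f. morita_nat (Suc (Y f))) \<longlonglongrightarrow> - (r - 1 / 2) * morita_Gamma (r - 1 / 2)"
    proof -
      have "(\<lambda>f. - of_nat (T (Suc f)) * morita_nat (T (Suc f))) \<longlonglongrightarrow> - (r - 1 / 2) * morita_Gamma (r - 1 / 2)"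
        by (intro tendsto_mult tendsto_minus LIMSEQ_Suc[OF T] LIMSEQ_Suc[OF tendsto_morita_nat[OF odd T]])
      moreover have "morita_nat (Suc (Y f)) = - of_nat (T (Suc f)) * (morita_nat (T (Suc f)) :: 'p padic)" for f
        using nd[of f] unfolding morita_nat_Suc Y_def by (simp only: if_False)
      ultimately show ?thesis by (simp only:)
    qed
    have "J * morita_Gamma (1 / 2) * (- (r - 1 / 2) * morita_Gamma (r - 1 / 2)) =
        (-1) ^ m * (of_nat ?p * (r - 1 / 2)) * morita_Gamma r"
      unfolding J_def m_def r_def
    proof (rule jacobi_gamma_aux[OF odd j T[unfolded r_def], of Y "\<lambda>f. of_nat ?p * of_nat (T f)"])
      show "T f \<le> ?p ^ f" for f by (simp add: T_def)
      show "Y f + j = (?p - 1) div 2 + ?p * T f" for f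
        unfolding m_def[symmetric] using Ye[of f] by (simp add: je)
      show "of_nat ?p * of_nat (T f) * fact (Y f) = (-1) ^ Suc (Y f) * morita_nat (Suc (Y f)) * of_nat ?p ^ T f *
          (fact (T f) :: 'p padic)" for f
      proof -
        \<comment> \<open>As \<open>0 < e < p\<close>, \<open>Y f = p * T f - e\<close> has quotient
          \<open>T f - 1\<close>; the missing factor \<open>p * T f\<close> is the chosen
          \<open>\<kappa>\<close>.\<close>
        obtain T' where T': "T f = Suc T'" using Tpos[of f] by (cases "T f") auto
        have "Y f = (?p - e) + ?p * T'" using Ye[of f] e1 by (simp add: T')
        moreover have "(d + ?p * T') div ?p = T'" if "d < ?p" for d using that by simp
        moreover have "?p - e < ?p" using e0 e1 by simp
        ultimately have "Y f div ?p = T'" by (simp only:)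
        then show ?thesis
          unfolding T' fact_Suc power_Suc[of "of_nat ?p :: 'p padic"] using fact_padic[of "Y f", where 'p = 'p]
          by (simp only: mult_ac)
      qed
      show "(\<lambda>f. of_nat ?p * of_nat (T f)) \<longlonglongrightarrow> of_nat ?p * (of_nat j / (of_nat ?p - 1) - 1 / 2 :: 'p padic)"
        by (intro tendsto_mult tendsto_const T[unfolded r_def])
    qed (use Z in \<open>simp only: r_def\<close>)
    then have "(r - 1 / 2) * (J * morita_Gamma (1 / 2) * - morita_Gamma (r - 1 / 2)) =
        (r - 1 / 2) * ((-1) ^ m * of_nat ?p * morita_Gamma r)"
      by (simp only: mult_ac mult_minus_left mult_minus_right)
    moreover have "r - 1 / 2 \<noteq> 0"
      unfolding x[symmetric] using e0 card_minus_1_neq_0[where 'p = 'p] by (simp only: divide_eq_0_iff of_nat_eq_0_iff) simp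
    ultimately have "J * morita_Gamma (1 / 2) * - morita_Gamma (r - 1 / 2) = (-1) ^ m * of_nat ?p * morita_Gamma r"
      using mult_left_cancel by blast
    then have "J * morita_Gamma (1 / 2) * - morita_Gamma (r - 1 / 2) * morita_Gamma (1 - (r - 1 / 2)) =
        (-1) ^ m * of_nat ?p * morita_Gamma r * morita_Gamma (1 - (r - 1 / 2))" by (rule arg_cong)
    moreover have "J * morita_Gamma (1 / 2) * - morita_Gamma (r - 1 / 2) * morita_Gamma (1 - (r - 1 / 2)) =
        - (J * morita_Gamma (1 / 2) * (morita_Gamma (r - 1 / 2) * morita_Gamma (1 - (r - 1 / 2))))"
      by (simp only: mult.assoc mult_minus_left mult_minus_right)
    ultimately have "(-1) ^ e * (J * morita_Gamma (1 / 2)) =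
        (-1) ^ m * of_nat ?p * morita_Gamma r * morita_Gamma (1 - (r - 1 / 2))"
      using gamma_reflection[OF odd e1] unfolding x by (simp add: mult.commute[of _ "(-1) ^ e"])
    moreover have "1 - (r - 1 / 2) = 3 / 2 - r" by simp
    ultimately have "(-1) ^ e * ((-1) ^ e * (J * morita_Gamma (1 / 2))) =
        (-1) ^ e * ((-1) ^ m * of_nat ?p * morita_Gamma r * morita_Gamma (3 / 2 - r))" by (simp only:)
    then have Jg: "J * morita_Gamma (1 / 2) =
        (-1) ^ e * ((-1) ^ m * of_nat ?p * morita_Gamma r * morita_Gamma (3 / 2 - r))"
      unfolding sq .
    have "(-1) ^ Suc j * (- of_nat ?p * (morita_Gamma (3 / 2 - r) * morita_Gamma r)) =
        (-1) ^ e * ((-1) ^ m * of_nat ?p * morita_Gamma r * morita_Gamma (3 / 2 - r))"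
      unfolding je power_Suc power_add by (simp add: mult_ac)
    then show ?thesis unfolding Jg if_not_P[OF False] by (rule sym)
  qed
qed

section \<open>The recursion for the hypergeometric function\<close>

lemma bij_betw_of_nat_mod_ring:
  "bij_betw of_nat {2..CARD('p) - 1} (- {0, 1 :: 'p :: prime_card mod_ring})"
proof -
  let ?p = "CARD('p)"
  have inj: "inj_on (of_nat :: nat \<Rightarrow> 'p mod_ring) {..<?p}"
  proof (rule linorder_inj_onI)
    fix a b :: nat assume ab: "a < b" "a \<in> {..<?p}" "b \<in> {..<?p}"
    show "(of_nat a :: 'p mod_ring) \<noteq> of_nat b"
    proof
      assume "(of_nat a :: 'p mod_ring) = of_nat b"
      then have "(of_nat (b - a) :: 'p mod_ring) = 0" using ab by (simp add: of_nat_diff)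
      then have "?p dvd b - a" by (rule of_nat_0_mod_ring_dvd)
      then have "?p \<le> b - a" using ab by (intro dvd_imp_le) simp_all
      then show False using ab by simp
    qed
  qed auto
  have p: "?p \<ge> 2" using prime_ge_2_nat[OF prime_card] .
  have img: "of_nat ` {..<?p} = (UNIV :: 'p mod_ring set)"
    using surj_of_nat_mod_ring[where 'a = 'p] by auto
  have "{2..?p - 1} = {..<?p} - {0, 1}" using p by auto
  moreover have "of_nat ` ({..<?p} - {0, 1}) = (of_nat ` {..<?p} - of_nat ` {0, 1} :: 'p mod_ring set)"
    using p by (intro inj_on_image_set_diff[OF inj]) auto
  ultimately have "of_nat ` {2..?p - 1} = (- {0, 1} :: 'p mod_ring set)"
    unfolding img by auto
  moreover have "inj_on (of_nat :: nat \<Rightarrow> 'p mod_ring) {2..?p - 1}"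
    using inj by (rule inj_on_subset) auto
  ultimately show ?thesis by (simp add: bij_betw_def)
qed

lemma char_pow_mult:
  "char_pow (char_inv teichmuller) j (x * y) =
     char_pow (char_inv teichmuller) j x * char_pow (char_inv teichmuller) j (y :: 'p :: prime_card mod_ring)"
  by (simp add: char_pow_def char_inv_def teichmuller_mult power_mult_distrib)

lemma morita_Gamma_0 [simp]: "morita_Gamma 0 = 1"
  by (simp add: morita_Gamma_def)

lemma padic_abs_morita_Gamma:
  fixes x :: "'p :: prime_card padic"
  assumes "odd CARD('p)" "padic_nat_limit x"
  shows "padic_abs (morita_Gamma x) = 1"
proof -
  obtain g where "(\<lambda>n. of_nat (g n)) \<longlonglongrightarrow> x" using assms(2) by (auto simp: padic_nat_limit_def)
  from tendsto_padic_abs[OF tendsto_morita_nat[OF assms(1) this]]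
  show ?thesis by (simp add: LIMSEQ_const_iff)
qed

section \<open>The gamma factor of the additional parameter\<close>

text \<open>The factor that the parameters \<open>1/2\<close> and \<open>1\<close> add to the
  \<open>j\<close>-th summand of \<open>padic_G\<close>.\<close>

definition half_factor :: "nat \<Rightarrow> 'p :: prime_card padic" where
  "half_factor j =
     (let r = of_nat j / of_nat (CARD('p) - 1) :: rat;
          \<Gamma> = \<lambda>x. morita_Gamma (of_rat x :: 'p padic)
      in \<Gamma> (frac (1 / 2 - r)) / \<Gamma> (frac (1 / 2)) *
         (\<Gamma> (frac (- 1 + r)) / \<Gamma> (frac (- 1))) *
         (- of_nat CARD('p)) powi (- \<lfloor>frac (1 / 2) - r\<rfloor> - \<lfloor>frac (- 1) + r\<rfloor>))"

lemma half_factor_eq: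
  fixes j :: nat
  assumes odd: "odd CARD('p)" and j: "j < CARD('p) - 1"
  defines "m \<equiv> (CARD('p) - 1) div 2" and "r \<equiv> of_nat j / (of_nat CARD('p) - 1) :: 'p :: prime_card padic"
  shows "half_factor j = (if j \<le> m then morita_Gamma (1 / 2 - r) * morita_Gamma r
     else - of_nat CARD('p) * (morita_Gamma (3 / 2 - r) * morita_Gamma r)) / morita_Gamma (1 / 2)"
proof -
  let ?p = "CARD('p)"
  define R where "R = (of_nat j / of_nat (?p - 1) :: rat)"
  note halves = odd_card_halves[OF odd, folded m_def]
  have q: "?p - 1 = 2 * m" using halves(1) by simp
  have R: "0 \<le> R" "R < 1" using j by (simp_all add: R_def)
  have Rm: "R \<le> 1 / 2 \<longleftrightarrow> j \<le> m"
  proof -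
    have "R \<le> 1 / 2 \<longleftrightarrow> (of_nat j :: rat) \<le> of_nat m"
      using halves(2) unfolding R_def q by (simp add: field_simps)
    then show ?thesis by simp
  qed
  have ofR: "of_rat R = r"
    by (simp add: R_def r_def of_rat_divide of_nat_card_minus_1[symmetric] del: of_nat_diff)
  have fR: "\<lfloor>R\<rfloor> = 0" using R by (intro floor_unique) simp_all
  have f1: "frac (- 1 + R) = R"
  proof -
    have "\<lfloor>- 1 + R\<rfloor> = - 1" using R by (intro floor_unique) simp_all
    then show ?thesis by (simp add: frac_def)
  qed
  have f0: "frac (- 1 :: rat) = 0" by (simp add: frac_def)
  have f2: "frac (1 / 2 :: rat) = 1 / 2" by (simp add: frac_eq)
  have h: "of_rat (1 / 2) = (1 / 2 :: 'p padic)" "of_rat (3 / 2) = (3 / 2 :: 'p padic)"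
    by (simp_all add: of_rat_divide)
  have eq: "half_factor j = morita_Gamma (of_rat (frac (1 / 2 - R))) / morita_Gamma (1 / 2) * morita_Gamma r *
      (- of_nat ?p) powi (- \<lfloor>1 / 2 - R\<rfloor> :: int)"
    unfolding half_factor_def Let_def R_def[symmetric] f0 f1 f2 h ofR by (simp add: fR)
  show ?thesis
  proof (cases "j \<le> m")
    case True
    then have "\<lfloor>1 / 2 - R\<rfloor> = 0" using R Rm by (intro floor_unique) simp_all
    moreover from this have "frac (1 / 2 - R) = 1 / 2 - R" by (simp add: frac_def)
    ultimately show ?thesis using True unfolding eq by (simp add: of_rat_diff h ofR)
  next
    case False
    \<comment> \<open>\<open>j > m\<close> is the range where \<open>1/2 - R\<close> is negative:
      the fractional part becomes \<open>3/2 - R\<close>, and the exponent of \<open>- p\<close>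
      becomes 1. This matches the borrow in \<open>jacobi_gamma\<close>.\<close>
    then have "\<lfloor>1 / 2 - R\<rfloor> = - 1" using R Rm by (intro floor_unique) simp_all
    moreover from this have "frac (1 / 2 - R) = 3 / 2 - R" by (simp add: frac_def)
    ultimately show ?thesis using False unfolding eq by (simp add: of_rat_diff h ofR)
  qed
qed

text \<open>On nonzero residues the quadratic character is its own inverse, and the
  \<open>j\<close>-th power of the inverse character equals the power \<open>p - 1 - j\<close>; the
  sum is thus the \<open>J\<close> of \<open>jacobi_gamma\<close>.\<close>

lemma half_factor_eq_jacobi_sum:
  assumes odd: "odd CARD('p)" and j: "j < CARD('p) - 1"
  shows "(-1) ^ j * half_factor j =
    - (\<Sum>t = 2..CARD('p) - 1. char_pow (char_inv teichmuller) j (of_nat t :: 'p :: prime_card mod_ring) *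
        char_pow teichmuller ((CARD('p) - 1) div 2) (1 - of_nat t))"
proof -
  let ?p = "CARD('p)" and ?T = "teichmuller :: 'p mod_ring \<Rightarrow> 'p padic"
  define m where "m = (?p - 1) div 2"
  define J where "J = (\<Sum>t\<in>- {0, 1}. ?T t ^ (?p - 1 - j) * inverse (?T (1 - t)) ^ m)"
  have q: "?p - 1 = m + m" using odd_card_halves(1)[OF odd] by (simp add: m_def)
  have "(\<Sum>t = 2..?p - 1. char_pow (char_inv teichmuller) j (of_nat t :: 'p mod_ring) *
        char_pow teichmuller m (1 - of_nat t)) =
      (\<Sum>t\<in>- {0, 1 :: 'p mod_ring}. char_pow (char_inv teichmuller) j t * char_pow teichmuller m (1 - t))"
    by (rule sum.reindex_bij_betw[OF bij_betw_of_nat_mod_ring])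
  also have "\<dots> = J"
    unfolding J_def
  proof (rule sum.cong)
    fix t :: "'p mod_ring" assume "t \<in> - {0, 1}"
    then have t: "t \<noteq> 0" "1 - t \<noteq> 0" by auto
    have "?T t ^ (?p - 1 - j) * ?T t ^ j = 1"
      using teichmuller_power_card_minus_1[OF t(1)] j by (simp flip: power_add)
    then have 1: "inverse (?T t) ^ j = ?T t ^ (?p - 1 - j)"
      unfolding power_inverse by (metis inverse_unique mult.commute)
    have "?T (1 - t) ^ m * ?T (1 - t) ^ m = 1"
      using teichmuller_power_card_minus_1[OF t(2)] unfolding q power_add .
    then have 2: "?T (1 - t) ^ m = inverse (?T (1 - t)) ^ m"
      unfolding power_inverse by (metis inverse_unique)
    show "char_pow (char_inv teichmuller) j t * char_pow teichmuller m (1 - t) =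
        ?T t ^ (?p - 1 - j) * inverse (?T (1 - t)) ^ m"
      using t unfolding char_pow_def char_inv_def 1 2[symmetric] by simp
  qed simp
  finally have sum: "(\<Sum>t = 2..?p - 1. char_pow (char_inv teichmuller) j (of_nat t :: 'p mod_ring) *
        char_pow teichmuller m (1 - of_nat t)) = J" .
  have "padic_abs (morita_Gamma (1 / 2 :: 'p padic)) = 1"
    by (intro padic_abs_morita_Gamma odd padic_nat_limit_half)
  then have nz: "morita_Gamma (1 / 2 :: 'p padic) \<noteq> 0" by auto
  then have "J = (-1) ^ Suc j * half_factor j"
    using jacobi_gamma[OF odd j, folded m_def, folded J_def]
    unfolding half_factor_eq[OF odd j, folded m_def] by (simp only: times_divide_eq_right nonzero_eq_divide_eq not_False_eq_True)
  then show ?thesis unfolding m_def[symmetric] sum by simp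
qed

theorem theorem2p6:
  fixes s :: "'p :: prime_card mod_ring" and a :: "nat \<Rightarrow> rat" and n :: nat
  assumes "odd CARD('p)"
    and "n \<ge> 1"
    and "\<And>i. i \<in> {1..n} \<Longrightarrow> (of_rat (a i) :: 'p padic) \<in> padic_ints"
  shows "padic_G (n + 1) (a(n + 1 := 1 / 2)) (\<lambda>_. 1) s =
         - (\<Sum>t = 2..CARD('p) - 1.
              padic_G n a (\<lambda>_. 1) (s * of_nat t) *
              char_pow teichmuller ((CARD('p) - 1) div 2) (1 - of_nat t))"
proof -
  let ?p = "CARD('p)" and ?\<chi> = "char_pow (char_inv teichmuller) :: nat \<Rightarrow> 'p mod_ring \<Rightarrow> 'p padic"
  let ?\<phi> = "char_pow teichmuller ((?p - 1) div 2) :: 'p mod_ring \<Rightarrow> 'p padic"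
  define F :: "nat \<Rightarrow> rat \<Rightarrow> 'p padic" where "F j x =
     (let r = of_nat j / of_nat (?p - 1) :: rat;
          \<Gamma> = \<lambda>x. morita_Gamma (of_rat x :: 'p padic)
      in \<Gamma> (frac (x - r)) / \<Gamma> (frac x) *
         (\<Gamma> (frac (- 1 + r)) / \<Gamma> (frac (- 1))) *
         (- of_nat ?p) powi (- \<lfloor>frac x - r\<rfloor> - \<lfloor>frac (- 1) + r\<rfloor>))" for j x
  define A where "A j = (-1) ^ (j * n) * (\<Prod>i = 1..n. F j (a i))" for j
  have G: "padic_G k b (\<lambda>_. 1) x = (- 1) / of_nat (?p - 1) *
      (\<Sum>j = 0..?p - 2. (- 1) ^ (j * k) * ?\<chi> j x * (\<Prod>i = 1..k. F j (b i)))" for k b and x :: "'p mod_ring"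
    unfolding padic_G_def F_def ..
  have half: "F j (1 / 2) = half_factor j" for j
    unfolding F_def half_factor_def ..
  \<comment> \<open>The claim holds for each \<open>j\<close> separately: the extra sign and factor
    form \<open>(-1) ^ j * half_factor j\<close>, and multiplicativity merges the characters at
    \<open>s\<close> and \<open>t\<close>.\<close>
  have step: "(- 1) ^ (j * (n + 1)) * ?\<chi> j s * (\<Prod>i = 1..n + 1. F j ((a(n + 1 := 1 / 2)) i)) =
      - (\<Sum>t = 2..?p - 1. (-1) ^ (j * n) * ?\<chi> j (s * of_nat t) * (\<Prod>i = 1..n. F j (a i)) * ?\<phi> (1 - of_nat t))"
    if "j \<in> {0..?p - 2}" for j
  proof -
    have j: "j < ?p - 1" using that prime_ge_2_nat[OF prime_card[where 'a = 'p]] by auto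
    have "(\<Prod>i = 1..n + 1. F j ((a(n + 1 := 1 / 2)) i)) = (\<Prod>i = 1..n. F j (a i)) * half_factor j"
    proof -
      have "(\<Prod>i = 1..n. F j ((a(n + 1 := 1 / 2)) i)) = (\<Prod>i = 1..n. F j (a i))"
        by (intro prod.cong) auto
      then show ?thesis by (simp add: half)
    qed
    then have "(- 1) ^ (j * (n + 1)) * ?\<chi> j s * (\<Prod>i = 1..n + 1. F j ((a(n + 1 := 1 / 2)) i)) =
        A j * ?\<chi> j s * ((-1) ^ j * half_factor j)"
      by (simp add: A_def power_add mult_ac)
    also have "\<dots> = - (\<Sum>t = 2..?p - 1. A j * ?\<chi> j s * (?\<chi> j (of_nat t) * ?\<phi> (1 - of_nat t)))"
      unfolding half_factor_eq_jacobi_sum[OF assms(1) j] by (simp add: sum_distrib_left)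
    also have "(\<Sum>t = 2..?p - 1. A j * ?\<chi> j s * (?\<chi> j (of_nat t) * ?\<phi> (1 - of_nat t))) =
        (\<Sum>t = 2..?p - 1. (-1) ^ (j * n) * ?\<chi> j (s * of_nat t) * (\<Prod>i = 1..n. F j (a i)) * ?\<phi> (1 - of_nat t))"
      by (intro sum.cong refl) (simp only: A_def char_pow_mult mult_ac)
    finally show ?thesis .
  qed
  have lhs: "padic_G (n + 1) (a(n + 1 := 1 / 2)) (\<lambda>_. 1) s = (- 1) / of_nat (?p - 1) * (\<Sum>j = 0..?p - 2.
      - (\<Sum>t = 2..?p - 1. (-1) ^ (j * n) * ?\<chi> j (s * of_nat t) * (\<Prod>i = 1..n. F j (a i)) * ?\<phi> (1 - of_nat t)))"
    unfolding G by (rule arg_cong[OF sum.cong[OF refl step]])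
  have "(\<Sum>t = 2..?p - 1. padic_G n a (\<lambda>_. 1) (s * of_nat t) * ?\<phi> (1 - of_nat t)) =
      (- 1) / of_nat (?p - 1) * (\<Sum>t = 2..?p - 1. \<Sum>j = 0..?p - 2.
        (-1) ^ (j * n) * ?\<chi> j (s * of_nat t) * (\<Prod>i = 1..n. F j (a i)) * ?\<phi> (1 - of_nat t))"
    unfolding G sum_distrib_left sum_distrib_right by (intro sum.cong refl) (simp only: mult_ac)
  also have "\<dots> = (- 1) / of_nat (?p - 1) * (\<Sum>j = 0..?p - 2. \<Sum>t = 2..?p - 1.
        (-1) ^ (j * n) * ?\<chi> j (s * of_nat t) * (\<Prod>i = 1..n. F j (a i)) * ?\<phi> (1 - of_nat t))"
    by (subst sum.swap) (rule refl)
  also have "\<dots> = - padic_G (n + 1) (a(n + 1 := 1 / 2)) (\<lambda>_. 1) s"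
    unfolding lhs by (simp only: sum_negf mult_minus_right minus_minus)
  finally show ?thesis by simp
qed

end
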